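(* Let $\tau>0$ and $1<p<\infty$. If $\Lambda=\{\lambda_n\}_{n\ge1}\subset\mathbb{C}$ is a weak interpolating sequence in $PW_\tau^p$, then, for every $\epsilon>0$, $\Lambda$ is interpolating in $PW_{\tau+\epsilon}^p$.
   Context: For $\tau>0$ and $1<p<\infty$, the Paley-Wiener space $PW_\tau^p$ is the space of all entire functions $f$ of exponential type at most $\tau$ with $\|f\|_p^p=\int_{-\infty}^{+\infty}|f(t)|^p\,dt<\infty$. A sequence $\Lambda=\{\lambda_n\}_{n\ge1}$ of complex numbers is a weak interpolating sequence in $PW_\tau^p$ if there are functions $f_n\in PW_\tau^p$, $n\ge1$, with $f_n(\lambda_k)\,(1+|\mathrm{Im}\,\lambda_n|)^{1/p}e^{-\tau|\mathrm{Im}\,\lambda_n|}=\delta_{nk}$ for all $n,k\ge1$ and $\sup_{n\ge1}\|f_n\|_p<\infty$. For $\sigma>0$, $\Lambda$ is interpolating in $PW_\sigma^p$ if for every $(a_n)_{n\ge1}\in\ell^p$ there is $f\in PW_\sigma^p$ with $f(\lambda_n)\,(1+|\mathrm{Im}\,\lambda_n|)^{1/p}e^{-\sigma|\mathrm{Im}\,\lambda_n|}=a_n$ for all $n\ge1$. *)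

theory Defs
  imports "HOL-Analysis.Analysis"
begin

text \<open>
  ``Exponential type at most \<open>\<tau>\<close>'' has its usual meaning
  \<open>limsup log |f z| / |z| \<le> \<tau>\<close> as \<open>|z|\<close> tends to infinity, hence the slack \<open>\<eta>\<close>;
  the bound \<open>|f z| \<le> C exp (\<tau> |z|)\<close> is not required.
\<close>

definition exp_type_le :: "real \<Rightarrow> (complex \<Rightarrow> complex) \<Rightarrow> bool" where
  "exp_type_le \<tau> f \<longleftrightarrow>
     (\<forall>\<eta>>0. \<exists>C. \<forall>z. norm (f z) \<le> C * exp ((\<tau> + \<eta>) * norm z))"

definition paley_wiener :: "real \<Rightarrow> real \<Rightarrow> (complex \<Rightarrow> complex) set" where
  "paley_wiener \<tau> p =
     {f. f holomorphic_on UNIV \<and> exp_type_le \<tau> f \<and>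
         integrable lborel (\<lambda>t::real. norm (f (of_real t)) powr p)}"

definition pw_norm :: "real \<Rightarrow> (complex \<Rightarrow> complex) \<Rightarrow> real" where
  "pw_norm p f = (LINT t|lborel. norm (f (of_real t)) powr p) powr (1 / p)"

definition pw_weight :: "real \<Rightarrow> real \<Rightarrow> complex \<Rightarrow> real" where
  "pw_weight \<tau> p z = (1 + \<bar>Im z\<bar>) powr (1 / p) * exp (- \<tau> * \<bar>Im z\<bar>)"

text \<open>Sequences are indexed from \<open>0\<close>, so all of \<^typ>\<open>nat\<close> is the index set.\<close>

definition weak_interpolating :: "real \<Rightarrow> real \<Rightarrow> (nat \<Rightarrow> complex) \<Rightarrow> bool" where
  "weak_interpolating \<tau> p \<Lambda> \<longleftrightarrow>
     (\<exists>f :: nat \<Rightarrow> complex \<Rightarrow> complex.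
        (\<forall>n. f n \<in> paley_wiener \<tau> p) \<and>
        (\<forall>n k. f n (\<Lambda> k) * of_real (pw_weight \<tau> p (\<Lambda> n)) = (if n = k then 1 else 0)) \<and>
        bdd_above (range (\<lambda>n. pw_norm p (f n))))"

definition interpolating :: "real \<Rightarrow> real \<Rightarrow> (nat \<Rightarrow> complex) \<Rightarrow> bool" where
  "interpolating \<sigma> p \<Lambda> \<longleftrightarrow>
     (\<forall>a :: nat \<Rightarrow> complex. summable (\<lambda>n. norm (a n) powr p) \<longrightarrow>
        (\<exists>f \<in> paley_wiener \<sigma> p. \<forall>n. f (\<Lambda> n) * of_real (pw_weight \<sigma> p (\<Lambda> n)) = a n))"

end

theory Submission
  imports Defs "HOL-Complex_Analysis.Complex_Analysis" "HOL-Probability.Probability" "HOL-Real_Asymp.Real_Asymp"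
begin

text \<open>
  Let \<open>f\<^sub>n\<close> be the functions of a weak interpolation and \<open>y\<^sub>n = Im \<lambda>\<^sub>n\<close>. It suffices to find entire multipliers
  \<open>g\<^sub>n\<close> with \<open>g\<^sub>n(\<lambda>\<^sub>n) = exp (\<epsilon> \<bar>y\<^sub>n\<bar>)\<close> and \<open>\<Sum>\<^sub>n \<bar>g\<^sub>n(z)\<bar> \<le> A exp (\<epsilon> \<bar>Im z\<bar>)\<close>. Then \<open>\<Sum> a\<^sub>n f\<^sub>n g\<^sub>n\<close> takes
  the right values, because \<open>f\<^sub>n(\<lambda>\<^sub>k) = 0\<close> for \<open>k \<noteq> n\<close>, and convexity of \<open>x \<mapsto> x\<^sup>p\<close> with the weights
  \<open>\<bar>g\<^sub>n(t)\<bar>\<close> gives \<open>\<bar>\<Sum> a\<^sub>n f\<^sub>n g\<^sub>n\<bar>\<^sup>p \<le> A\<^sup>p \<Sum> \<bar>a\<^sub>n\<bar>\<^sup>p \<bar>f\<^sub>n\<bar>\<^sup>p\<close> on the real line, hence an \<open>L\<^sup>p\<close> bound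
  (\<open>interpolation_series\<close>). Points with \<open>y\<^sub>n < 0\<close> are carried to the upper half-plane by \<open>z \<mapsto> -z\<close>, so
  multipliers for the points with \<open>y\<^sub>n \<ge> 0\<close> suffice.

  A vertical shift by a large \<open>M\<close> turns these points into points \<open>\<mu>\<^sub>n\<close> with \<open>Im \<mu>\<^sub>n \<ge> M\<close>. The function
  \<open>h(z) = f\<^sub>n(z - \<i> M) exp (\<i> \<tau> z)\<close> is bounded in the upper half-plane and has \<open>L\<^sup>p\<close> boundary values; its
  size at \<open>\<mu>\<^sub>n\<close> is comparable to the largest one allowed, and it vanishes at every other \<open>\<mu>\<^sub>j\<close>. Dividing by the
  Blaschke factors of these zeros does not change the boundary modulus, so the factors cannot be small at
  \<open>\<mu>\<^sub>n\<close>. This is the Carleson condition \<open>\<Sum>\<^sub>j Im \<mu>\<^sub>j Im \<mu>\<^sub>n / \<bar>\<mu>\<^sub>n - cnj \<mu>\<^sub>j\<bar>\<^sup>2 \<le> C\<close> (\<open>carleson_sum_bound\<close>).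

  From the Carleson condition, P. Jones' explicit formula gives analytic functions \<open>G\<^sub>n\<close> on the upper
  half-plane, uniformly bounded, with \<open>G\<^sub>n(\<mu>\<^sub>n) = 1\<close> and \<open>\<Sum> \<bar>G\<^sub>n\<bar>\<close> bounded on the real line
  (\<open>jones_functions\<close>). They are not entire; convolution with a Fejer kernel of type \<open>2 \<epsilon>\<close> makes them entire,
  and the factor \<open>exp (- \<i> \<epsilon> z)\<close> centres the resulting band \<open>[0, 2 \<epsilon>]\<close> of frequencies at \<open>0\<close>. In the upper
  half-plane the convolution differs from \<open>G\<^sub>n\<close> by at most a Poisson average of \<open>\<bar>G\<^sub>n\<bar>\<close> times
  \<open>1 / (2 \<epsilon> Im z)\<close> (\<open>fejer_conv_upper\<close>). Since the bound on \<open>\<bar>G\<^sub>n\<bar>\<close> is an absolute constant, a shift \<open>M\<close>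
  depending on \<open>\<epsilon>\<close> alone makes the error at \<open>\<mu>\<^sub>n\<close> at most \<open>1/2\<close>, and dividing by the value at \<open>\<mu>\<^sub>n\<close> gives the
  multipliers (\<open>half_plane_multipliers\<close>).

  The analysis behind this is classical and elementary: a Phragmen-Lindelof theorem, the Cauchy and Poisson
  formulas for the half-plane, and the pointwise and Plancherel-Polya bounds for Paley-Wiener functions.
\<close>

section \<open>Phragmen-Lindelof in the upper half-plane\<close>

text \<open>
  On an unbounded closed set the maximum principle survives if the bound holds in the limit at infinity: apply
  the bounded version on the intersection with a large disc.
\<close>
lemma maximum_modulus_unbounded:
  fixes u :: "complex \<Rightarrow> complex"
  assumes "closed S" and cont: "continuous_on S u" and hol: "u holomorphic_on interior S"
    and front: "\<And>z. z \<in> frontier S \<Longrightarrow> norm (u z) \<le> B"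
    and inf: "\<And>e. e > 0 \<Longrightarrow> \<exists>R. \<forall>z\<in>S. norm z \<ge> R \<longrightarrow> norm (u z) \<le> B + e"
    and z: "z \<in> S"
  shows "norm (u z) \<le> B"
proof (rule field_le_epsilon)
  fix e :: real assume e: "e > 0"
  then obtain R0 where R0: "\<And>z. z \<in> S \<Longrightarrow> norm z \<ge> R0 \<Longrightarrow> norm (u z) \<le> B + e"
    using inf by blast
  define R where "R = max R0 (norm z + 1)"
  define T where "T = S \<inter> cball 0 R"
  have clT: "closed T" using assms(1) by (auto simp: T_def)
  show "norm (u z) \<le> B + e"
  proof (rule maximum_modulus_frontier[of u T])
    show "u holomorphic_on interior T"
      by (rule holomorphic_on_subset[OF hol]) (auto simp: T_def intro: interior_mono[THEN subsetD])
    show "continuous_on (closure T) u"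
      using clT cont by (auto simp: T_def closure_closed intro: continuous_on_subset)
    show "bounded T" by (auto simp: T_def)
    show "z \<in> T" using z by (auto simp: T_def R_def)
    fix x assume x: "x \<in> frontier T"
    then have xT: "x \<in> T" using clT frontier_subset_closed by blast
    have "frontier T \<subseteq> frontier S \<union> frontier (cball 0 R)"
      unfolding T_def by (rule frontier_Int_subset)
    then consider "x \<in> frontier S" | "norm x = R"
      using x by (auto simp: frontier_cball)
    then show "norm (u x) \<le> B + e"
    proof cases
      case 1 then show ?thesis using front e by fastforce
    next
      case 2 then show ?thesis using R0[of x] xT by (auto simp: T_def R_def)
    qed
  qed
qed

text \<open>
  The multiplier \<open>exp (- \<delta> w sqrt w)\<close> decays like \<open>exp (- c \<bar>w\<bar>\<^sup>3\<^sup>/\<^sup>2)\<close> in the sector \<open>\<bar>arg w\<bar> \<le> \<pi>/4\<close>, where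
  \<open>\<bar>arg (w sqrt w)\<bar> \<le> 3 \<pi>/8\<close>. With \<open>a = Re (sqrt w)\<close> both estimates are polynomial, because there the imaginary
  part of \<open>sqrt w\<close> is at most \<open>a / 2\<close>.
\<close>
lemma Re_mult_csqrt_ge:
  assumes "Re w > 0" "\<bar>Im w\<bar> \<le> Re w"
  shows "Re (w * csqrt w) \<ge> (Re (csqrt w)) ^ 3 / 4" "norm w \<le> 5/4 * (Re (csqrt w))\<^sup>2"
proof -
  obtain c where c: "csqrt w = c" by blast
  have w: "w = c\<^sup>2" unfolding c[symmetric] by simp
  define a where "a = Re c"
  define b where "b = Im c"
  have re: "Re (c\<^sup>2) = a\<^sup>2 - b\<^sup>2" and im: "Im (c\<^sup>2) = 2 * a * b"
    by (simp_all add: a_def b_def Re_power2 Im_power2)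
  have a0: "a \<ge> 0" unfolding a_def c[symmetric] using csqrt_principal[of w] by linarith
  have a: "a > 0"
  proof (rule ccontr)
    assume "\<not> a > 0" then have "a = 0" using a0 by simp
    then show False using re assms(1) w by simp
  qed
  have "2 * a * \<bar>b\<bar> \<le> a\<^sup>2 - b\<^sup>2" using assms(2) a unfolding w re im by (simp add: abs_mult)
  also have "\<dots> \<le> a * a" by (simp add: power2_eq_square)
  finally have "2 * \<bar>b\<bar> \<le> a" using a by simp
  then have "(2 * \<bar>b\<bar>)\<^sup>2 \<le> a\<^sup>2" by (intro power_mono) auto
  then have b: "4 * b\<^sup>2 \<le> a\<^sup>2" by (simp add: power_mult_distrib)
  have "Re (w * csqrt w) = (a\<^sup>2 - b\<^sup>2) * a - (2 * a * b) * b"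
    unfolding c unfolding w times_complex.simps(1) re im a_def b_def ..
  also have "\<dots> = a * (a\<^sup>2 - 3 * b\<^sup>2)" by (simp add: power2_eq_square algebra_simps)
  also have "\<dots> \<ge> a * (a\<^sup>2 / 4)"
    using a b by (intro mult_left_mono) auto
  finally show "Re (w * csqrt w) \<ge> (Re (csqrt w)) ^ 3 / 4"
    unfolding c by (simp add: a_def[symmetric] power3_eq_cube power2_eq_square)
  have "norm w = a\<^sup>2 + b\<^sup>2" by (simp add: w norm_power cmod_power2 a_def b_def)
  also have "\<dots> \<le> 5/4 * a\<^sup>2" using b by simp
  finally show "norm w \<le> 5/4 * (Re (csqrt w))\<^sup>2" unfolding c by (simp add: a_def)
qed

lemma closed_quadrant: "closed {z. Re z \<ge> 0 \<and> Im z \<ge> 0}"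
  by (intro closed_Collect_conj closed_halfspace_Re_ge closed_halfspace_Im_ge)

lemma frontier_quadrant:
  assumes "z \<in> frontier {z. Re z \<ge> 0 \<and> Im z \<ge> 0}"
  shows "Re z \<ge> 0 \<and> Im z \<ge> 0 \<and> (Re z = 0 \<or> Im z = 0)"
proof -
  have 1: "Re z \<ge> 0" "Im z \<ge> 0"
    using assms frontier_subset_closed[OF closed_quadrant] by auto
  have "open {z. Re z > 0 \<and> Im z > 0}"
    by (intro open_Collect_conj open_halfspace_Re_gt open_halfspace_Im_gt)
  then have "{z. Re z > 0 \<and> Im z > 0} \<subseteq> interior {z. Re z \<ge> 0 \<and> Im z \<ge> 0}"
    by (intro interior_maximal) auto
  then have "\<not> (Re z > 0 \<and> Im z > 0)" using assms by (auto simp: frontier_def)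
  with 1 show ?thesis by linarith
qed

text \<open>
  Growth of order one is harmless in a quadrant, since it is beaten by a convergence factor of order \<open>3/2\<close>,
  which is available in any sector of opening less than \<open>2 \<pi> / 3\<close>. The quadrant is rotated to be symmetric about the
  positive real axis and shifted by \<open>1\<close> to avoid the branch point.
\<close>
lemma phragmen_lindelof_quadrant:
  fixes u :: "complex \<Rightarrow> complex"
  defines "Q \<equiv> {z. Re z \<ge> 0 \<and> Im z \<ge> 0}"
  assumes cont: "continuous_on Q u" and hol: "u holomorphic_on interior Q"
    and axes: "\<And>z. z \<in> Q \<Longrightarrow> Re z = 0 \<or> Im z = 0 \<Longrightarrow> norm (u z) \<le> B"
    and growth: "\<And>z. z \<in> Q \<Longrightarrow> norm (u z) \<le> C * exp (A * norm z)"
    and z: "z \<in> Q"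
  shows "norm (u z) \<le> B"
proof -
  \<comment> \<open>rotation by \<open>-\<pi>/4\<close>, which maps the quadrant onto the sector \<open>\<bar>arg w\<bar> \<le> \<pi>/4\<close>\<close>
  define r where "r = Complex (1 / sqrt 2) (- 1 / sqrt 2)"
  define W where "W = (\<lambda>z. r * z + 1)"
  have nr: "norm r = 1" by (simp add: r_def cmod_def power_divide)
  have W: "Re (W z) \<ge> 1" "\<bar>Im (W z)\<bar> \<le> Re (W z)" if "z \<in> Q" for z
  proof -
    have "Re (W z) = (Re z + Im z) / sqrt 2 + 1" "Im (W z) = (Im z - Re z) / sqrt 2"
      by (simp_all add: W_def r_def field_simps)
    moreover have "\<bar>Im z - Re z\<bar> / sqrt 2 \<le> (Re z + Im z) / sqrt 2"
      using that by (intro divide_right_mono) (auto simp: Q_def)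
    moreover have "(Re z + Im z) / sqrt 2 \<ge> 0" using that by (auto simp: Q_def)
    ultimately show "Re (W z) \<ge> 1" "\<bar>Im (W z)\<bar> \<le> Re (W z)" by auto
  qed
  define P where "P = (\<lambda>z. W z * csqrt (W z))"
  have P: "Re (P z) \<ge> Re (csqrt (W z)) ^ 3 / 4" "norm (W z) \<le> 5/4 * (Re (csqrt (W z)))\<^sup>2"
    "Re (csqrt (W z)) \<ge> 0" if "z \<in> Q" for z
    using Re_mult_csqrt_ge[of "W z"] W[OF that] csqrt_principal[of "W z"] by (auto simp: P_def)
  have P0: "Re (P z) \<ge> 0" if "z \<in> Q" for z
    using P[OF that] by (smt (verit, best) divide_nonneg_nonneg zero_le_power)
  have nonneg: "W z \<notin> \<real>\<^sub>\<le>\<^sub>0" if "z \<in> Q" for z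
    using W[OF that] by (auto simp: complex_nonpos_Reals_iff)
  have contP: "continuous_on Q P" unfolding P_def W_def
    by (intro continuous_intros continuous_on_compose2[OF continuous_on_csqrt])
      (use nonneg in \<open>auto simp: W_def\<close>)
  have holP: "P holomorphic_on interior Q"
    unfolding P_def W_def using nonneg interior_subset[of Q]
    by (auto intro!: holomorphic_intros simp: W_def)
  have bound: "norm (u z) * exp (- (d * Re (P z))) \<le> B" if d: "d > 0" and z: "z \<in> Q" for d z
  proof -
    define v where "v = (\<lambda>z. u z * exp (- (of_real d * P z)))"
    have nv: "norm (v z) = norm (u z) * exp (- (d * Re (P z)))" for z
      by (simp add: v_def norm_mult)
    have "norm (v z) \<le> B"
    proof (rule maximum_modulus_unbounded[of Q v])
      show "closed Q" unfolding Q_def by (rule closed_quadrant)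
      show "continuous_on Q v" unfolding v_def by (intro continuous_intros cont contP)
      show "v holomorphic_on interior Q" unfolding v_def by (intro holomorphic_intros hol holP)
      show "z \<in> Q" by fact
      show "norm (v z) \<le> B" if "z \<in> frontier Q" for z
      proof -
        have z: "z \<in> Q" "Re z = 0 \<or> Im z = 0"
          using frontier_quadrant[OF that[unfolded Q_def]] by (simp_all add: Q_def)
        have "norm (v z) \<le> norm (u z) * 1" unfolding nv
          by (intro mult_left_mono) (use P0[OF z(1)] d in auto)
        then show ?thesis using axes[OF z] by simp
      qed
      fix e :: real assume e: "e > 0"
      have B: "B \<ge> 0" using order_trans[OF norm_ge_zero axes[of 0]] by (simp add: Q_def)
      define A' where "A' = max A 0"
      define C' where "C' = max C 1"
      define D where "D = (\<lambda>a::real. C' * exp (A' * (5/4 * a\<^sup>2 + 1) - d * (a ^ 3 / 4)))"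
      have "filterlim (\<lambda>a. A' * (5/4 * a\<^sup>2 + 1) - d * (a ^ 3 / 4)) at_bot at_top"
        using d by real_asymp
      then have "(D \<longlongrightarrow> C' * 0) at_top" unfolding D_def
        by (intro tendsto_mult tendsto_const filterlim_compose[OF exp_at_bot])
      then have "eventually (\<lambda>a. D a < e) at_top"
        using e by (intro order_tendstoD) auto
      then obtain a0 where a0: "\<And>a. a \<ge> a0 \<Longrightarrow> D a < e" by (auto simp: eventually_at_top_linorder)
      \<comment> \<open>\<open>\<bar>z\<bar> \<le> 5/4 a\<^sup>2 + 1\<close> with \<open>a = Re (sqrt (W z))\<close>, so large \<open>z\<close> have large \<open>a\<close>\<close>
      define R where "R = 5/4 * (max a0 0)\<^sup>2 + 1"
      show "\<exists>R. \<forall>z\<in>Q. norm z \<ge> R \<longrightarrow> norm (v z) \<le> B + e"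
      proof (intro exI ballI impI)
        fix z assume z: "z \<in> Q" and R: "norm z \<ge> R"
        define a where "a = Re (csqrt (W z))"
        have "norm z = norm (W z - 1)" by (simp add: W_def norm_mult nr)
        also have "\<dots> \<le> norm (W z) + 1" using norm_triangle_ineq4[of "W z" 1] by simp
        also have "\<dots> \<le> 5/4 * a\<^sup>2 + 1" using P(2)[OF z] by (simp add: a_def)
        finally have nz: "norm z \<le> 5/4 * a\<^sup>2 + 1" .
        with R have "(max a0 0)\<^sup>2 \<le> a\<^sup>2" by (simp add: R_def)
        moreover have "a \<ge> 0" unfolding a_def by (rule P(3)[OF z])
        ultimately have "max a0 0 \<le> a" by (rule power2_le_imp_le)
        then have "D a < e" using a0[of a] by linarith
        have "norm (v z) \<le> (C' * exp (A' * (5/4 * a\<^sup>2 + 1))) * exp (- (d * (a^3/4)))"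
          unfolding nv
        proof (intro mult_mono)
          have "norm (u z) \<le> C * exp (A * norm z)" by (rule growth[OF z])
          also have "\<dots> \<le> C' * exp (A' * (5/4 * a\<^sup>2 + 1))"
          proof (intro mult_mono)
            show "exp (A * norm z) \<le> exp (A' * (5/4 * a\<^sup>2 + 1))" 
              using nz by (auto simp: A'_def intro!: mult_mono)
          qed (auto simp: C'_def)
          finally show "norm (u z) \<le> C' * exp (A' * (5/4 * a\<^sup>2 + 1))" .
          show "exp (- (d * Re (P z))) \<le> exp (- (d * (a^3/4)))"
            using P(1)[OF z] d unfolding exp_le_cancel_iff neg_le_iff_le a_def by (intro mult_left_mono) auto
        qed (auto simp: C'_def)
        also have "\<dots> = D a" by (simp only: D_def mult.assoc mult_exp_exp add_uminus_conv_diff)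
        finally show "norm (v z) \<le> B + e" using \<open>D a < e\<close> B by simp
      qed
    qed
    then show ?thesis by (simp add: nv)
  qed
  have "((\<lambda>d. norm (u z) * exp (- (d * Re (P z)))) \<longlongrightarrow> norm (u z) * exp (- (0 * Re (P z)))) (at_right 0)"
    by (intro tendsto_intros)
  then have "norm (u z) * exp (- (0 * Re (P z))) \<le> B"
    by (rule tendsto_upperbound) (auto simp: eventually_at_right_less bound[OF _ z] intro!: eventually_at_rightI[of 0 1])
  then show ?thesis by simp
qed

lemma interior_half_planes:
  "interior {z. Re z \<ge> 0} = {z. Re z > 0}" "interior {z. Im z \<ge> 0} = {z. Im z > 0}"
  using interior_halfspace_ge[of "1::complex" 0] interior_halfspace_ge[of \<i> 0] by (simp_all add: inner_complex_def)

lemma interior_quadrant_subset: "interior {z. Re z \<ge> 0 \<and> Im z \<ge> 0} \<subseteq> {z. Re z > 0 \<and> Im z > 0}"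
proof -
  have "interior {z. Re z \<ge> 0 \<and> Im z \<ge> 0} \<subseteq> interior {z. Re z \<ge> 0} \<inter> interior {z. Im z \<ge> 0}"
    by (intro Int_greatest interior_mono) auto
  also have "\<dots> = {z. Re z > 0 \<and> Im z > 0}"
    by (auto simp: interior_half_planes)
  finally show ?thesis .
qed

text \<open>
  Order one is critical for a half-plane, so its two quadrants come first: after multiplication by
  \<open>exp (\<i> (\<tau> + \<eta>) z)\<close> the function is bounded on the imaginary axis as well. Once it is known to be bounded, the
  factor \<open>1 / (1 - \<i> d z)\<close> enforces decay at infinity, and the bound on the real line alone decides.
\<close>
lemma phragmen_lindelof_half_plane:
  fixes F :: "complex \<Rightarrow> complex"
  assumes hol: "F holomorphic_on {z. Im z > - a}" and a: "a > 0"
    and real: "\<And>x. norm (F (of_real x)) \<le> B"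
    and type: "\<And>\<eta>. \<eta> > 0 \<Longrightarrow> \<exists>C. \<forall>z. Im z \<ge> 0 \<longrightarrow> norm (F z) \<le> C * exp ((\<tau> + \<eta>) * norm z)"
    and z: "Im z \<ge> 0"
  shows "norm (F z) \<le> B * exp (\<tau> * Im z)"
proof -
  have main: "norm (F z) \<le> B * exp ((\<tau> + \<eta>) * Im z)" if \<eta>: "\<eta> > 0" for \<eta>
  proof -
    obtain C where C: "\<And>z. Im z \<ge> 0 \<Longrightarrow> norm (F z) \<le> C * exp ((\<tau> + \<eta>) * norm z)" using type[OF \<eta>] by blast
    define u where "u = (\<lambda>z. F z * exp (\<i> * of_real (\<tau> + \<eta>) * z))"
    have nu: "norm (u z) = norm (F z) * exp (- ((\<tau> + \<eta>) * Im z))" for z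
      by (simp add: u_def norm_mult algebra_simps)
    have holu: "u holomorphic_on {z. Im z > - a}" unfolding u_def by (intro holomorphic_intros hol)
    define B' where "B' = max B C"
    have C0: "C \<ge> 0" using C[of 0] order_trans[OF norm_ge_zero[of "F 0"]] by simp
    have B0: "B \<ge> 0" using real[of 0] norm_ge_zero order_trans by blast
    have ureal: "norm (u z) \<le> B" if "Im z = 0" for z
      using real[of "Re z"] that by (simp add: nu complex_eq_iff[of _ z] of_real_Re complex_is_Real_iff)
    have uimag: "norm (u z) \<le> C" if "Re z = 0" "Im z \<ge> 0" for z
    proof -
      have "norm z = Im z" using that by (simp add: cmod_def)
      then have "norm (u z) \<le> C * exp ((\<tau> + \<eta>) * Im z) * exp (- ((\<tau> + \<eta>) * Im z))"
        unfolding nu using C[OF that(2)] by (intro mult_right_mono) auto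
      then show ?thesis by (simp only: mult.assoc exp_minus_inverse mult_1_right)
    qed
    define A where "A = \<bar>\<tau> + \<eta>\<bar> + \<bar>\<tau> + \<eta>\<bar>"
    have ugrowth: "norm (u z) \<le> C * exp (A * norm z)" if "Im z \<ge> 0" for z
    proof -
      have "norm (u z) \<le> C * exp ((\<tau> + \<eta>) * norm z) * exp (- ((\<tau> + \<eta>) * Im z))"
        unfolding nu using C[OF that] by (intro mult_right_mono) auto
      also have "\<dots> = C * exp ((\<tau> + \<eta>) * norm z - (\<tau> + \<eta>) * Im z)" by (simp only: mult.assoc mult_exp_exp add_uminus_conv_diff)
      also have "\<dots> \<le> C * exp (A * norm z)"
      proof (intro mult_left_mono C0)
        have "(\<tau> + \<eta>) * norm z \<le> \<bar>\<tau> + \<eta>\<bar> * norm z" by (intro mult_right_mono) auto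
        moreover have "- ((\<tau> + \<eta>) * Im z) \<le> \<bar>(\<tau> + \<eta>) * Im z\<bar>" by simp
        moreover have "\<bar>(\<tau> + \<eta>) * Im z\<bar> \<le> \<bar>\<tau> + \<eta>\<bar> * norm z"
          unfolding abs_mult by (intro mult_left_mono abs_Im_le_cmod) auto
        ultimately show "exp ((\<tau> + \<eta>) * norm z - (\<tau> + \<eta>) * Im z) \<le> exp (A * norm z)"
          by (simp add: A_def algebra_simps)
      qed
      finally show ?thesis .
    qed
    have ubd: "norm (u z) \<le> B'" if z: "Im z \<ge> 0" for z
    proof (cases "Re z \<ge> 0")
      case True
      show ?thesis
      proof (rule phragmen_lindelof_quadrant[where u = u])
        show "continuous_on {z. 0 \<le> Re z \<and> 0 \<le> Im z} u"
          by (rule holomorphic_on_imp_continuous_on[THEN continuous_on_subset, OF holu]) (use a in auto)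
        show "u holomorphic_on interior {z. 0 \<le> Re z \<and> 0 \<le> Im z}"
          by (rule holomorphic_on_subset[OF holu]) (use a interior_quadrant_subset in fastforce)
        show "norm (u z) \<le> C * exp (A * norm z)" if "z \<in> {z. 0 \<le> Re z \<and> 0 \<le> Im z}" for z
          using ugrowth that by simp
        show "z \<in> {z. 0 \<le> Re z \<and> 0 \<le> Im z}" using True z by simp
        show "norm (u z) \<le> B'" if "z \<in> {z. 0 \<le> Re z \<and> 0 \<le> Im z}" "Re z = 0 \<or> Im z = 0" for z
          using that ureal[of z] uimag[of z] by (auto simp: B'_def)
      qed
    next
      case False
      define u' where "u' = (\<lambda>z. u (\<i> * z))"
      have "norm (u' (- \<i> * z)) \<le> B'"
      proof (rule phragmen_lindelof_quadrant[where u = u'])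
        show "continuous_on {z. 0 \<le> Re z \<and> 0 \<le> Im z} u'" unfolding u'_def
          by (rule continuous_on_compose2[OF holomorphic_on_imp_continuous_on[OF holu]])
            (use a in \<open>auto intro!: continuous_intros\<close>)
        have "(u \<circ> (\<lambda>z. \<i> * z)) holomorphic_on interior {z. 0 \<le> Re z \<and> 0 \<le> Im z}"
          by (rule holomorphic_on_compose_gen[OF _ holu])
            (use a interior_quadrant_subset in \<open>fastforce intro!: holomorphic_intros\<close>)+
        then show "u' holomorphic_on interior {z. 0 \<le> Re z \<and> 0 \<le> Im z}"
          by (simp add: u'_def comp_def)
        show "norm (u' z) \<le> C * exp (A * norm z)" if "z \<in> {z. 0 \<le> Re z \<and> 0 \<le> Im z}" for z
          using ugrowth[of "\<i> * z"] that by (simp add: u'_def norm_mult)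
        show "- \<i> * z \<in> {z. 0 \<le> Re z \<and> 0 \<le> Im z}" using False z by simp
        show "norm (u' z) \<le> B'" if "z \<in> {z. 0 \<le> Re z \<and> 0 \<le> Im z}" "Re z = 0 \<or> Im z = 0" for z
          using that ureal[of "\<i> * z"] uimag[of "\<i> * z"] by (auto simp: B'_def u'_def)
      qed
      then show ?thesis by (simp add: u'_def mult.assoc[symmetric])
    qed
    have bnd: "norm (u z) / norm (1 - \<i> * of_real d * z) \<le> B" if d: "d > 0" for d
    proof -
      define v where "v = (\<lambda>z. u z / (1 - \<i> * of_real d * z))"
      have ge1: "norm (1 - \<i> * of_real d * z) \<ge> 1" if "Im z \<ge> 0" for z
      proof -
        have "1 \<le> Re (1 - \<i> * of_real d * z)" using that d by simp
        also have "\<dots> \<le> norm (1 - \<i> * of_real d * z)" by (rule complex_Re_le_cmod)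
        finally show ?thesis .
      qed
      have nz: "1 - \<i> * of_real d * z \<noteq> 0" if "Im z \<ge> 0" for z using ge1[OF that] by auto
      have "norm (v z) \<le> B"
      proof (rule maximum_modulus_unbounded[of "{z. Im z \<ge> 0}" v])
        show "closed {z. Im z \<ge> 0}" by (rule closed_halfspace_Im_ge)
        show "continuous_on {z. Im z \<ge> 0} v" unfolding v_def
          by (intro continuous_intros holomorphic_on_imp_continuous_on[THEN continuous_on_subset, OF holu])
            (use a nz in auto)
        show "v holomorphic_on interior {z. Im z \<ge> 0}" unfolding v_def
          by (intro holomorphic_intros holomorphic_on_subset[OF holu])
            (use a nz in \<open>auto simp: interior_half_planes\<close>)
        show "z \<in> {z. Im z \<ge> 0}" using z by simp
        show "norm (v z) \<le> B" if "z \<in> frontier {z. Im z \<ge> 0}" for z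
        proof -
          have "Im z = 0" using that frontier_subset_closed[OF closed_halfspace_Im_ge[of 0]]
            by (force simp: frontier_def interior_half_planes)
          then have "norm (v z) \<le> norm (u z) / 1"
            unfolding v_def norm_divide using ge1[of z] by (intro divide_left_mono) auto
          then show ?thesis using ureal[of z] \<open>Im z = 0\<close> by simp
        qed
        fix e :: real assume e: "e > 0"
        have B': "B' \<ge> 0" using B0 by (auto simp: B'_def)
        show "\<exists>R. \<forall>z\<in>{z. Im z \<ge> 0}. norm z \<ge> R \<longrightarrow> norm (v z) \<le> B + e"
        proof (intro exI ballI impI)
          fix z assume z: "z \<in> {z. Im z \<ge> 0}" "norm z \<ge> (B' / e + 1) / d"
          have "B' / e \<le> d * norm z - 1" using z(2) d by (simp add: field_simps)
          also have "\<dots> \<le> norm (1 - \<i> * of_real d * z)"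
            using norm_triangle_ineq2[of "\<i> * of_real d * z" 1] d by (simp add: norm_mult norm_minus_commute)
          finally have "B' \<le> e * norm (1 - \<i> * of_real d * z)" using e by (simp add: field_simps)
          then have "norm (u z) \<le> e * norm (1 - \<i> * of_real d * z)" using ubd[of z] z by simp
          then have "norm (v z) \<le> e" using ge1[of z] z
            unfolding v_def norm_divide by (subst pos_divide_le_eq) auto
          then show "norm (v z) \<le> B + e" using B0 by simp
        qed
      qed
      then show ?thesis by (simp add: v_def norm_divide)
    qed
    have "((\<lambda>d. norm (u z) / norm (1 - \<i> * of_real d * z)) \<longlongrightarrow> norm (u z) / norm (1 - \<i> * of_real 0 * z)) (at_right 0)"
      by (intro tendsto_intros) auto
    then have "norm (u z) / norm (1 - \<i> * of_real 0 * z) \<le> B"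
      by (rule tendsto_upperbound) (auto intro!: eventually_at_rightI[of 0 1] bnd)
    then have "norm (u z) \<le> B" by simp
    then have "norm (u z) * exp ((\<tau> + \<eta>) * Im z) \<le> B * exp ((\<tau> + \<eta>) * Im z)" by (intro mult_right_mono) auto
    moreover have "norm (u z) * exp ((\<tau> + \<eta>) * Im z) = norm (F z)"
      unfolding nu by (simp only: mult.assoc mult_exp_exp) simp
    ultimately show ?thesis by simp
  qed
  have "((\<lambda>\<eta>. B * exp ((\<tau> + \<eta>) * Im z)) \<longlongrightarrow> B * exp ((\<tau> + 0) * Im z)) (at_right 0)"
    by (intro tendsto_intros)
  then have "norm (F z) \<le> B * exp ((\<tau> + 0) * Im z)"
    by (rule tendsto_lowerbound) (auto intro!: eventually_at_rightI[of 0 1] main)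
  then show ?thesis by simp
qed

section \<open>Poisson kernel and Cauchy formula for the upper half-plane\<close>

lemma integrable_inverse_1_plus_sq:
  "integrable lborel (\<lambda>x::real. 1 / (1 + x\<^sup>2))" "(LINT x|lborel. 1 / (1 + x\<^sup>2)) = pi"
proof -
  have D: "((\<lambda>x. arctan x) has_field_derivative (1 / (1 + x\<^sup>2))) (at x)" for x :: real
    by (auto intro!: derivative_eq_intros simp: field_simps)
  have C: "isCont (\<lambda>x::real. 1 / (1 + x\<^sup>2)) x" for x
    by (intro continuous_intros) (auto simp: add_nonneg_eq_0_iff)
  have at: "((arctan \<circ> real_of_ereal) \<longlongrightarrow> - (pi/2)) (at_right (-\<infinity>))" "((arctan \<circ> real_of_ereal) \<longlongrightarrow> pi/2) (at_left \<infinity>)"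
    by (simp_all add: ereal_tendsto_simps tendsto_arctan_at_top tendsto_arctan_at_bot)
  have "set_integrable lborel (einterval (-\<infinity>) \<infinity>) (\<lambda>x::real. 1 / (1 + x\<^sup>2))"
    "(LBINT x=-\<infinity>..\<infinity>. 1 / (1 + x\<^sup>2)) = pi/2 - (- (pi/2))"
    by (rule interval_integral_FTC_nonneg[where F = arctan]; use D C at in auto)+
  then show "integrable lborel (\<lambda>x::real. 1 / (1 + x\<^sup>2))" "(LINT x|lborel. 1 / (1 + x\<^sup>2)) = pi"
    by (simp_all add: set_integrable_def interval_lebesgue_integral_def set_lebesgue_integral_def)
qed

definition poisson :: "complex \<Rightarrow> real \<Rightarrow> real" where
  "poisson w t = Im w / (pi * (norm (of_real t - w))\<^sup>2)"

lemma norm_of_real_minus_sq: "(norm (of_real t - w))\<^sup>2 = (t - Re w)\<^sup>2 + (Im w)\<^sup>2"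
  by (simp add: cmod_power2)

lemma poisson_altdef: 
  assumes "Im w > 0"
  shows "poisson w t = 1 / (pi * Im w) * (1 / (1 + (- Re w / Im w + 1 / Im w * t)\<^sup>2))"
proof -
  have "(t - Re w)\<^sup>2 + (Im w)\<^sup>2 = (Im w)\<^sup>2 * (1 + (- Re w / Im w + 1 / Im w * t)\<^sup>2)"
    using assms by (simp add: field_simps power2_eq_square)
  then show ?thesis using assms
    unfolding poisson_def norm_of_real_minus_sq by (simp add: power2_eq_square)
qed

lemma poisson_nonneg: "Im w > 0 \<Longrightarrow> poisson w t \<ge> 0"
  by (simp add: poisson_def)

lemma poisson_le: 
  assumes "Im w > 0" shows "poisson w t \<le> 1 / (pi * Im w)"
proof -
  have "poisson w t \<le> Im w / (pi * (Im w)\<^sup>2)"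
    unfolding poisson_def norm_of_real_minus_sq using assms
    by (intro divide_left_mono mult_left_mono mult_pos_pos add_nonneg_pos) auto
  then show ?thesis using assms by (simp add: power2_eq_square split: if_splits)
qed

lemma poisson_measurable [measurable]: "poisson w \<in> borel_measurable borel"
  unfolding poisson_def by measurable

lemma integrable_poisson: "Im w > 0 \<Longrightarrow> integrable lborel (poisson w)"
  using poisson_altdef[of w] unfolding ext[of "poisson w", OF poisson_altdef]
  by (intro integrable_mult_right lborel_integrable_real_affine[OF integrable_inverse_1_plus_sq(1)]) auto

lemma integral_poisson:
  assumes "Im w > 0" shows "(LINT t|lborel. poisson w t) = 1"
proof -
  have "(LINT t|lborel. poisson w t) = 1 / (pi * Im w) * (LINT t|lborel. 1 / (1 + (- Re w / Im w + 1 / Im w * t)\<^sup>2))"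
    by (simp only: poisson_altdef[OF assms] integral_mult_right_zero)
  also have "pi = \<bar>1 / Im w\<bar> *\<^sub>R (LINT t|lborel. 1 / (1 + (- Re w / Im w + 1 / Im w * t)\<^sup>2))"
    by (subst integrable_inverse_1_plus_sq(2)[symmetric], rule lborel_integral_real_affine) (use assms in auto)
  then have "(LINT t|lborel. 1 / (1 + (- Re w / Im w + 1 / Im w * t)\<^sup>2)) = pi * Im w"
    using assms by (simp add: field_simps)
  finally show ?thesis using assms by simp
qed

lemma integrable_inverse_square_decay:
  fixes h :: "real \<Rightarrow> complex"
  assumes "continuous_on UNIV h" and b: "\<And>t. norm (h t) \<le> C / (1 + t\<^sup>2)"
  shows "integrable lborel h"
proof (rule Bochner_Integration.integrable_bound)
  show "integrable lborel (\<lambda>t::real. C * (1 / (1 + t\<^sup>2)))"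
    by (intro integrable_mult_right integrable_inverse_1_plus_sq)
  show "h \<in> borel_measurable lborel" using borel_measurable_continuous_onI[OF assms(1)] by simp
  show "AE t in lborel. norm (h t) \<le> norm (C * (1 / (1 + t\<^sup>2)))"
    using order_trans[OF b abs_ge_self] by (intro AE_I2) simp
qed

lemma continuous_on_real_line:
  fixes F :: "complex \<Rightarrow> complex"
  assumes "F holomorphic_on {z. Im z > - a}" "a > 0"
  shows "continuous_on UNIV (\<lambda>t::real. F (of_real t))"
  by (rule continuous_on_compose2[OF holomorphic_on_imp_continuous_on[OF assms(1)]])
    (use assms(2) in \<open>auto intro: continuous_intros\<close>)

text \<open>
  Cauchy's formula on the rectangle with corners \<open>-R\<close> and \<open>R + \<i> R\<close>: on the three sides away from the real line the
  integrand is \<open>O(R\<^sup>-\<^sup>2)\<close>, so they contribute \<open>O(1/R)\<close>.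
\<close>
lemma cauchy_half_plane:
  fixes F :: "complex \<Rightarrow> complex"
  assumes hol: "F holomorphic_on {z. Im z > - a}" and a: "a > 0" and w: "Im w > 0"
    and decay: "\<And>z. Im z \<ge> 0 \<Longrightarrow> norm (F z) \<le> C / (1 + norm z)"
  shows "integrable lborel (\<lambda>t::real. F (of_real t) / (of_real t - w))"
    and "(LINT t|lborel. F (of_real t) / (of_real t - w)) = 2 * pi * \<i> * F w"
proof -
  define g where "g = (\<lambda>z. F z / (z - w))"
  define h where "h = (\<lambda>t::real. g (of_real t))"
  have C0: "C \<ge> 0" using order_trans[OF norm_ge_zero decay[of 0]] by simp
  have contF: "continuous_on {z. Im z > - a} F" by (rule holomorphic_on_imp_continuous_on[OF hol])
  have conth: "continuous_on UNIV h" unfolding h_def g_def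
    by (intro continuous_intros continuous_on_compose2[OF contF]) (use w a in \<open>auto simp: complex_eq_iff\<close>)
  have gfar: "norm (g z) \<le> 2 * C / R\<^sup>2" if "Im z \<ge> 0" "norm z \<ge> R" "R \<ge> 2 * norm w" "R > 0" for z R
  proof -
    have 1: "norm (F z) \<le> C / R" 
      by (rule order_trans[OF decay[OF that(1)]]) (use that C0 in \<open>auto intro!: divide_left_mono mult_pos_pos\<close>)
    have "norm (z - w) \<ge> R / 2" using norm_triangle_ineq2[of z w] that by linarith
    then have "norm (g z) \<le> (C / R) / (R / 2)"
      unfolding g_def norm_divide using 1 that C0 by (intro frac_le) auto
    also have "\<dots> = 2 * C / R\<^sup>2" by (simp add: power2_eq_square)
    finally show ?thesis .
  qed
  define m where "m = 2 * norm w + 1"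
  have hnear: "norm (h t) \<le> C / Im w" for t
  proof -
    have 1: "norm (F (of_real t)) \<le> C / 1" 
      by (rule order_trans[OF decay]) (use C0 in \<open>auto simp: divide_le_eq distrib_left\<close>)
    have "norm (of_real t - w) \<ge> Im w" using abs_Im_le_cmod[of "of_real t - w"] w by simp
    then show ?thesis unfolding h_def g_def norm_divide using 1 w C0 by (intro frac_le) auto
  qed
  define C' where "C' = C / Im w * (1 + m\<^sup>2) + 4 * C"
  have C': "C / Im w * (1 + m\<^sup>2) \<ge> 0" using C0 w by simp
  have hb: "norm (h t) \<le> C' / (1 + t\<^sup>2)" for t
  proof (cases "\<bar>t\<bar> \<le> m")
    case True
    then have "1 + t\<^sup>2 \<le> 1 + m\<^sup>2" using abs_le_square_iff[of t m] by simp
    then have "C / Im w * (1 + t\<^sup>2) \<le> C / Im w * (1 + m\<^sup>2)" using C0 w by (intro mult_left_mono) auto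
    then have "C / Im w * (1 + t\<^sup>2) \<le> C'" using C0 unfolding C'_def by linarith
    then have "C / Im w \<le> C' / (1 + t\<^sup>2)" by (subst pos_le_divide_eq) (auto intro: add_pos_nonneg)
    then show ?thesis using hnear[of t] by linarith
  next
    case False
    then have t: "\<bar>t\<bar> \<ge> m" "\<bar>t\<bar> \<ge> 1" using norm_ge_zero[of w] unfolding m_def by linarith+
    then have t1: "1 \<le> t\<^sup>2" using abs_le_square_iff[of 1 t] by simp
    have "norm (h t) \<le> 2 * C / \<bar>t\<bar>\<^sup>2" unfolding h_def 
      by (rule gfar) (use t in \<open>auto simp: m_def\<close>)
    also have "\<dots> = 4 * C / (t\<^sup>2 + t\<^sup>2)" by simp
    also have "\<dots> \<le> 4 * C / (1 + t\<^sup>2)"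
      using t1 C0 by (intro divide_left_mono mult_pos_pos add_pos_nonneg) auto
    also have "\<dots> \<le> C' / (1 + t\<^sup>2)" using C' by (intro divide_right_mono) (auto simp: C'_def)
    finally show ?thesis .
  qed
  have inth: "integrable lborel h" by (rule integrable_inverse_square_decay[OF conth hb])
  then show "integrable lborel (\<lambda>t::real. F (of_real t) / (of_real t - w))" by (simp add: h_def g_def)
  define I where "I = (\<lambda>R::real. integral {-R..R} h)"
  have lim1: "(I \<longlongrightarrow> (LINT t|lborel. h t)) at_top"
  proof -
    have "((\<lambda>R. LINT t|lborel. indicator {-R..R} t *\<^sub>R h t) \<longlongrightarrow> (LINT t|lborel. h t)) at_top"
    proof (rule integral_dominated_convergence_at_top[where w = "\<lambda>t. norm (h t)"])
      show "h \<in> borel_measurable lborel" using inth by auto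
      show "integrable lborel (\<lambda>t. norm (h t))" using inth by auto
      show "\<forall>\<^sub>F R in at_top. AE t in lborel. norm (indicator {- R..R} t *\<^sub>R h t) \<le> norm (h t)"
        by (auto simp: indicator_def)
      show "AE t in lborel. ((\<lambda>R. indicator {- R..R} t *\<^sub>R h t) \<longlongrightarrow> h t) at_top"
      proof (rule AE_I2)
        fix t :: real
        have "\<forall>\<^sub>F R in at_top. indicator {- R..R} t *\<^sub>R h t = h t"
          using eventually_ge_at_top[of "\<bar>t\<bar>"] by eventually_elim (auto simp: indicator_def)
        then show "((\<lambda>R. indicator {- R..R} t *\<^sub>R h t) \<longlongrightarrow> h t) at_top"
          by (rule tendsto_eventually)
      qed
    qed (use inth in auto)
    also have "(\<lambda>R. LINT t|lborel. indicator {-R..R} t *\<^sub>R h t) = I"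
    proof
      fix R :: real
      have "set_integrable lborel {-R..R} h"
        by (rule borel_integrable_atLeastAtMost') (rule continuous_on_subset[OF conth], simp)
      then have "(LINT t:{-R..R}|lborel. h t) = I R" unfolding I_def
        by (rule set_borel_integral_eq_integral(2))
      then show "(LINT t|lborel. indicator {-R..R} t *\<^sub>R h t) = I R" by (simp add: set_lebesgue_integral_def)
    qed
    finally show ?thesis .
  qed
  have est: "norm (I R - 2 * pi * \<i> * F w) \<le> 8 * C / R" if R: "R > 2 * norm w" for R
  proof -
    have R0: "R > 0" using norm_ge_zero[of w] R by linarith
    define b1 b2 b3 b4 :: complex where b: "b1 = - of_real R" "b2 = (of_real R :: complex)" "b3 = Complex R R" "b4 = Complex (-R) R"
    have rp: "rectpath b1 b3 = linepath b1 b2 +++ linepath b2 b3 +++ linepath b3 b4 +++ linepath b4 b1"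
    proof -
      have "Complex (Re b3) (Im b1) = b2" "Complex (Re b1) (Im b3) = b4" by (simp_all add: b complex_eq_iff)
      then show ?thesis unfolding rectpath_def Let_def by simp
    qed
    have wbox: "w \<in> box b1 b3" using w R abs_Re_le_cmod[of w] abs_Im_le_cmod[of w]
      by (auto simp: in_box_complex_iff b)
    have img: "path_image (rectpath b1 b3) \<subseteq> cbox b1 b3"
      by (rule path_image_rectpath_subset_cbox) (use R0 in \<open>auto simp: b\<close>)
    have wn: "w \<notin> path_image (rectpath b1 b3)"
      using path_image_rectpath_inter_box[of b1 b3] wbox R0 by (auto simp: b)
    have cv: "convex {z. Im z > - a}" by (rule convex_halfspace_Im_gt)
    have op: "open {z. Im z > - a}" by (rule open_halfspace_Im_gt)
    have sub: "path_image (rectpath b1 b3) \<subseteq> {z. Im z > - a} - {w}"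
      using img wn a by (force simp: in_cbox_complex_iff b)
    have ci: "(g has_contour_integral (2 * pi * \<i> * winding_number (rectpath b1 b3) w * F w)) (rectpath b1 b3)"
      unfolding g_def
      by (rule Cauchy_integral_formula_convex_simple[OF cv hol]) (use sub w a op in \<open>auto simp: interior_open\<close>)
    then have ci: "(g has_contour_integral (2 * pi * \<i> * F w)) (rectpath b1 b3)"
      using winding_number_rectpath[OF wbox] by simp
    have contg: "continuous_on (path_image (rectpath b1 b3)) g" unfolding g_def
      by (intro continuous_intros continuous_on_subset[OF contF]) (use sub in auto)
    have pimg: "path_image (rectpath b1 b3) = closed_segment b1 b2 \<union> (closed_segment b2 b3 \<union> (closed_segment b3 b4 \<union> closed_segment b4 b1))"
      unfolding rp by (simp add: path_image_join)
    have ints0: "g contour_integrable_on linepath u v" if "closed_segment u v \<subseteq> path_image (rectpath b1 b3)" for u v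
      by (rule contour_integrable_continuous_linepath[OF continuous_on_subset[OF contg that]])
    have ints: "g contour_integrable_on linepath b1 b2" "g contour_integrable_on linepath b2 b3"
       "g contour_integrable_on linepath b3 b4" "g contour_integrable_on linepath b4 b1"
      by (intro ints0; use pimg in blast)+
    have "2 * pi * \<i> * F w = contour_integral (rectpath b1 b3) g"
      using ci contour_integral_unique by metis
    also have "\<dots> = contour_integral (linepath b1 b2) g + (contour_integral (linepath b2 b3) g
        + (contour_integral (linepath b3 b4) g + contour_integral (linepath b4 b1) g))"
      unfolding rp using ints by (simp add: contour_integral_join)
    also have "contour_integral (linepath b1 b2) g = I R"
      unfolding b I_def h_def by (subst contour_integral_linepath_Reals_eq) (use R0 in auto)
    finally have eq: "2 * pi * \<i> * F w - I R = contour_integral (linepath b2 b3) g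
        + (contour_integral (linepath b3 b4) g + contour_integral (linepath b4 b1) g)" by simp
    have segb: "norm (contour_integral (linepath u v) g) \<le> 2 * C / R\<^sup>2 * norm (v - u)"
      if "closed_segment u v \<subseteq> {z. Im z \<ge> 0 \<and> norm z \<ge> R}" "g contour_integrable_on linepath u v" for u v
      by (rule has_contour_integral_bound_linepath[OF has_contour_integral_integral[OF that(2)]])
        (use that gfar R R0 C0 in auto)
    have far: "norm z \<ge> R" if "\<bar>Re z\<bar> = R \<or> Im z = R" for z
      using that abs_Re_le_cmod[of z] abs_Im_le_cmod[of z] by linarith
    have sides: "\<bar>Re z\<bar> = R \<or> Im z = R" "Im z \<ge> 0"
      if "z \<in> closed_segment b2 b3 \<union> closed_segment b3 b4 \<union> closed_segment b4 b1" for z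
      using that R0 by (auto simp: closed_segment_same_Re closed_segment_same_Im b closed_segment_eq_real_ivl)
    have seg: "closed_segment b2 b3 \<subseteq> {z. Im z \<ge> 0 \<and> norm z \<ge> R}"
      "closed_segment b3 b4 \<subseteq> {z. Im z \<ge> 0 \<and> norm z \<ge> R}"
      "closed_segment b4 b1 \<subseteq> {z. Im z \<ge> 0 \<and> norm z \<ge> R}"
      by (intro subsetI CollectI conjI far sides; simp)+
    have len: "norm (b3 - b2) = R" "norm (b4 - b3) = 2 * R" "norm (b1 - b4) = R"
    proof -
      have "b3 - b2 = \<i> * of_real R" "b4 - b3 = - (2 * of_real R)" "b1 - b4 = - (\<i> * of_real R)"
        by (simp_all add: b complex_eq_iff)
      then show "norm (b3 - b2) = R" "norm (b4 - b3) = 2 * R" "norm (b1 - b4) = R"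
        using R0 by (simp_all add: norm_mult)
    qed
    have "norm (2 * pi * \<i> * F w - I R) \<le> 2 * C / R\<^sup>2 * R + (2 * C / R\<^sup>2 * (2 * R) + 2 * C / R\<^sup>2 * R)"
      unfolding eq
      using segb[OF seg(1) ints(2)] segb[OF seg(2) ints(3)] segb[OF seg(3) ints(4)] unfolding len
      by (intro norm_triangle_le add_mono norm_triangle_mono) auto
    also have "\<dots> = 8 * C / R" using R0 by (simp add: power2_eq_square field_simps)
    finally show ?thesis by (simp add: norm_minus_commute)
  qed
  have "((\<lambda>R. I R - 2 * pi * \<i> * F w) \<longlongrightarrow> 0) at_top"
  proof (rule Lim_null_comparison)
    show "\<forall>\<^sub>F R in at_top. norm (I R - 2 * pi * \<i> * F w) \<le> 8 * C / R"
      using eventually_gt_at_top[of "2 * norm w"] by eventually_elim (rule est)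
    show "((\<lambda>R. 8 * C / R) \<longlongrightarrow> 0) at_top"
      by (rule tendsto_divide_0[OF tendsto_const]) (simp add: filterlim_at_top_imp_at_infinity filterlim_ident)
  qed
  then have "(I \<longlongrightarrow> 2 * pi * \<i> * F w) at_top" by (simp add: LIM_zero_iff)
  then have "(LINT t|lborel. h t) = 2 * pi * \<i> * F w"
    using lim1 tendsto_unique[of at_top] by (metis trivial_limit_at_top_linorder)
  then show "(LINT t|lborel. F (of_real t) / (of_real t - w)) = 2 * pi * \<i> * F w"
    by (simp add: h_def g_def)
qed

text \<open>
  For analytic functions Poisson's formula is Cauchy's formula for \<open>F(z) / (z - cnj w)\<close>; the additional factor
  supplies the decay that a bounded \<open>F\<close> lacks.
\<close>
lemma poisson_formula:
  fixes F :: "complex \<Rightarrow> complex"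
  assumes hol: "F holomorphic_on {z. Im z > - a}" and a: "a > 0" and w: "Im w > 0"
    and bdd: "\<And>z. Im z \<ge> 0 \<Longrightarrow> norm (F z) \<le> C"
  shows "integrable lborel (\<lambda>t::real. of_real (poisson w t) * F (of_real t))"
    and "(LINT t|lborel. of_real (poisson w t) * F (of_real t)) = F w"
proof -
  define G where "G = (\<lambda>z. F z / (z - cnj w))"
  have C0: "C \<ge> 0" using order_trans[OF norm_ge_zero bdd[of 0]] by simp
  have holG: "G holomorphic_on {z. Im z > - min a (Im w)}" unfolding G_def
    by (intro holomorphic_intros holomorphic_on_subset[OF hol]) (auto simp: complex_eq_iff)
  define m where "m = Im w / (1 + Im w + norm w)"
  have m: "m > 0" using w by (auto simp: m_def intro!: divide_pos_pos add_pos_nonneg)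
  have lower: "norm (z - cnj w) \<ge> m * (1 + norm z)" if "Im z \<ge> 0" for z
  proof -
    have 1: "norm (z - cnj w) \<ge> Im w" using abs_Im_le_cmod[of "z - cnj w"] that w by simp
    have "norm z \<le> norm (z - cnj w) + norm w" using norm_triangle_ineq2[of z "cnj w"] by simp
    then have "m * (1 + norm z) \<le> m * (1 + norm w + norm (z - cnj w))"
      using m by (intro mult_left_mono) auto
    also have "\<dots> = Im w * (1 + norm w + norm (z - cnj w)) / (1 + Im w + norm w)" by (simp add: m_def)
    also have "\<dots> \<le> norm (z - cnj w)"
    proof (subst pos_divide_le_eq)
      show "0 < 1 + Im w + norm w" using w by (auto intro!: add_pos_nonneg)
      have "Im w * (1 + norm w) \<le> norm (z - cnj w) * (1 + norm w)" using 1 by (intro mult_right_mono) auto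
      then show "Im w * (1 + norm w + norm (z - cnj w)) \<le> norm (z - cnj w) * (1 + Im w + norm w)"
        by (simp add: algebra_simps)
    qed
    finally show ?thesis .
  qed
  have decay: "norm (G z) \<le> (C / m) / (1 + norm z)" if "Im z \<ge> 0" for z
  proof -
    have "norm (G z) \<le> C / (m * (1 + norm z))" unfolding G_def norm_divide
      using bdd[OF that] lower[OF that] C0 m by (intro frac_le mult_pos_pos add_pos_nonneg) auto
    then show ?thesis by simp
  qed
  have eq: "of_real (Im w / pi) * (G (of_real t) / (of_real t - w)) = of_real (poisson w t) * F (of_real t)" for t
  proof -
    have "(of_real t - cnj w) * (of_real t - w) = of_real ((norm (of_real t - w))\<^sup>2)"
      by (subst complex_norm_square) (simp add: mult.commute)
    then have "G (of_real t) / (of_real t - w) = F (of_real t) / of_real ((norm (of_real t - w))\<^sup>2)"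
      by (simp add: G_def)
    then show ?thesis by (simp add: poisson_def)
  qed
  note c = cauchy_half_plane[OF holG _ w decay]
  have pos: "min a (Im w) > 0" using a w by simp
  show "integrable lborel (\<lambda>t::real. of_real (poisson w t) * F (of_real t))"
    unfolding eq[symmetric] by (intro integrable_mult_right c(1)[OF pos])
  have c2: "(LINT t|lborel. G (of_real t) / (of_real t - w)) = 2 * pi * \<i> * G w"
    by (rule c(2)[OF pos])
  have "(LINT t|lborel. of_real (poisson w t) * F (of_real t)) = of_real (Im w / pi) * (LINT t|lborel. G (of_real t) / (of_real t - w))"
    unfolding eq[symmetric] by (rule integral_mult_right_zero)
  also have "\<dots> = of_real (Im w / pi) * (2 * pi * \<i> * (F w / (w - cnj w)))" unfolding c2 by (simp only: G_def)
  also have "w - cnj w = 2 * \<i> * of_real (Im w)" by (simp add: complex_eq_iff)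
  finally show "(LINT t|lborel. of_real (poisson w t) * F (of_real t)) = F w"
    using w by simp
qed

section \<open>Pointwise bounds in Paley-Wiener spaces\<close>

text \<open>
  Membership in \<open>L\<^sup>p\<close> does not directly bound \<open>f\<close> on the real line, but it bounds the growth of a primitive:
  \<open>\<bar>f\<bar> \<le> 1 + \<bar>f\<bar>\<^sup>p\<close>, so \<open>\<Phi>\<close> grows at most linearly there. Division by \<open>z - x\<^sub>0 + \<i>\<close> removes the linear growth
  and has no pole in the upper half-plane, so the Phragmen-Lindelof theorem applies to the quotient.
\<close>
lemma primitive_bound_upper:
  fixes f \<Phi> :: "complex \<Rightarrow> complex"
  assumes D: "\<And>z. (\<Phi> has_field_derivative f z) (at z)" and zero: "\<Phi> (of_real x0) = 0"
    and type: "exp_type_le \<tau> f" and \<tau>: "\<tau> \<ge> 0" and p: "p \<ge> 1"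
    and int: "integrable lborel (\<lambda>t::real. norm (f (of_real t)) powr p)"
    and K: "(LINT t|lborel. norm (f (of_real t)) powr p) \<le> K"
    and z: "Im z \<ge> 0"
  shows "norm (\<Phi> z) \<le> (1 + K) * exp (\<tau> * Im z) * norm (z - of_real x0 + \<i>)"
proof -
  have hol\<Phi>: "\<Phi> holomorphic_on UNIV" using D by (auto simp: holomorphic_on_open)
  have holf: "f holomorphic_on UNIV"
  proof -
    have "deriv \<Phi> = f" using D by (auto intro!: DERIV_imp_deriv)
    then show ?thesis using holomorphic_deriv[OF hol\<Phi>] by simp
  qed
  have contf: "continuous_on A (\<lambda>t::real. f (of_real t))" for A
    by (intro continuous_on_compose2[OF holomorphic_on_imp_continuous_on[OF holf]] continuous_intros) auto
  have K0: "K \<ge> 0" using order_trans[OF Bochner_Integration.integral_nonneg K] by simp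
  have ab: "norm (\<Phi> (of_real b) - \<Phi> (of_real a)) \<le> (b - a) + K" if "a \<le> b" for a b
  proof -
    have FTC: "((\<lambda>t. f (of_real t)) has_integral \<Phi> (of_real b) - \<Phi> (of_real a)) {a..b}"
    proof (rule fundamental_theorem_of_calculus[OF that])
      fix t show "((\<lambda>t. \<Phi> (of_real t)) has_vector_derivative f (of_real t)) (at t within {a..b})"
        using D[of "of_real t"] has_vector_derivative_real_field has_vector_derivative_at_within by blast
    qed
    have cont: "continuous_on {a..b} (\<lambda>t. norm (f (of_real t)) powr p)"
      using contf p by (intro continuous_on_powr' continuous_intros) auto
    have bi: "integral {a..b} (\<lambda>t. norm (f (of_real t)) powr p) \<le> K"
    proof -
      have "set_integrable lborel {a..b} (\<lambda>t. norm (f (of_real t)) powr p)"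
        by (rule borel_integrable_atLeastAtMost'[OF cont])
      then have "(LINT t:{a..b}|lborel. norm (f (of_real t)) powr p) = integral {a..b} (\<lambda>t. norm (f (of_real t)) powr p)"
        by (rule set_borel_integral_eq_integral)
      moreover have "(LINT t:{a..b}|lborel. norm (f (of_real t)) powr p) \<le> (LINT t|lborel. norm (f (of_real t)) powr p)"
        unfolding set_lebesgue_integral_def
        by (rule integral_mono'[OF int]) (auto simp: indicator_def)
      ultimately show ?thesis using K by linarith
    qed
    have "norm (\<Phi> (of_real b) - \<Phi> (of_real a)) = norm (integral {a..b} (\<lambda>t. f (of_real t)))"
      using FTC by (simp add: integral_unique)
    also have "\<dots> \<le> integral {a..b} (\<lambda>t. 1 + norm (f (of_real t)) powr p)"
    proof (rule Henstock_Kurzweil_Integration.integral_norm_bound_integral)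
      show "(\<lambda>t. f (of_real t)) integrable_on {a..b}" using FTC by blast
      show "(\<lambda>t. 1 + norm (f (of_real t)) powr p) integrable_on {a..b}"
        by (intro integrable_continuous_real continuous_intros cont)
      fix t show "norm (f (of_real t)) \<le> 1 + norm (f (of_real t)) powr p"
      proof (cases "norm (f (of_real t)) \<le> 1")
        case False
        then have "norm (f (of_real t)) powr 1 \<le> norm (f (of_real t)) powr p" 
          using p by (intro powr_mono) auto
        then show ?thesis by simp
      qed (simp add: add_increasing2)
    qed
    also have "\<dots> = integral {a..b} (\<lambda>t. 1) + integral {a..b} (\<lambda>t. norm (f (of_real t)) powr p)"
      by (intro Henstock_Kurzweil_Integration.integral_add integrable_continuous_real continuous_intros cont)
    also have "\<dots> \<le> (b - a) + K" using bi that by simp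
    finally show ?thesis .
  qed
  have real: "norm (\<Phi> (of_real x)) \<le> \<bar>x - x0\<bar> + K" for x
    using ab[of x x0] ab[of x0 x] zero by (cases "x \<le> x0") auto
  define F where "F = (\<lambda>z. \<Phi> z / (z - of_real x0 + \<i>))"
  have nz: "z - of_real x0 + \<i> \<noteq> 0" if "Im z > - 1" for z using that by (auto simp: complex_eq_iff)
  have ge: "norm (z - of_real x0 + \<i>) \<ge> 1" "norm (z - of_real x0 + \<i>) \<ge> norm (z - of_real x0)" if "Im z \<ge> 0" for z
  proof -
    show "norm (z - of_real x0 + \<i>) \<ge> 1" using abs_Im_le_cmod[of "z - of_real x0 + \<i>"] that by simp
    show "norm (z - of_real x0 + \<i>) \<ge> norm (z - of_real x0)" 
      unfolding cmod_def using power_mono[of "Im z" "Im z + 1" 2] that by (intro real_sqrt_le_mono) simp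
  qed
  have "norm (F z) \<le> (1 + K) * exp (\<tau> * Im z)"
  proof (rule phragmen_lindelof_half_plane[of F 1])
    show "F holomorphic_on {z. Im z > - 1}" unfolding F_def
      by (intro holomorphic_intros holomorphic_on_subset[OF hol\<Phi>]) (use nz in auto)
    show "norm (F (of_real x)) \<le> 1 + K" for x
    proof -
      have "norm (\<Phi> (of_real x)) \<le> \<bar>x - x0\<bar> + K" by (rule real)
      also have "\<dots> \<le> 1 * norm (of_real x - of_real x0 + \<i>) + K * norm (of_real x - of_real x0 + \<i>)"
      proof (intro add_mono)
        show "\<bar>x - x0\<bar> \<le> 1 * norm (of_real x - of_real x0 + \<i>)" 
          using abs_Re_le_cmod[of "of_real x - of_real x0 + \<i>"] by simp
        show "K \<le> K * norm (of_real x - of_real x0 + \<i>)" 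
          using K0 ge(1)[of "of_real x"] by (simp add: mult_le_cancel_left1)
      qed
      finally have "norm (\<Phi> (of_real x)) \<le> (1 + K) * norm (of_real x - of_real x0 + \<i>)" by (simp add: distrib_right)
      then show ?thesis unfolding F_def norm_divide 
        using ge(1)[of "of_real x"] by (subst pos_divide_le_eq) auto
    qed
    fix \<eta> :: real assume \<eta>: "\<eta> > 0"
    then obtain C where C: "\<And>z. norm (f z) \<le> C * exp ((\<tau> + \<eta>) * norm z)"
      using type unfolding exp_type_le_def by blast
    have C0: "C \<ge> 0" using order_trans[OF norm_ge_zero C[of 0]] by simp
    show "\<exists>C. \<forall>z. Im z \<ge> 0 \<longrightarrow> norm (F z) \<le> C * exp ((\<tau> + \<eta>) * norm z)"
    proof (intro exI allI impI)
      fix z assume z: "Im z \<ge> 0"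
      define R where "R = norm z + \<bar>x0\<bar>"
      have "norm (\<Phi> z - \<Phi> (of_real x0)) \<le> C * exp ((\<tau> + \<eta>) * R) * norm (z - of_real x0)"
      proof (rule field_differentiable_bound[where S = "cball 0 R" and f' = f])
        show "(\<Phi> has_field_derivative f z) (at z within cball 0 R)" for z
          using D has_field_derivative_at_within by blast
        show "norm (f z) \<le> C * exp ((\<tau> + \<eta>) * R)" if "z \<in> cball 0 R" for z
          by (rule order_trans[OF C]) (use that C0 \<tau> \<eta> in \<open>auto intro!: mult_left_mono\<close>)
      qed (auto simp: R_def)
      also have "\<dots> \<le> C * exp ((\<tau> + \<eta>) * R) * norm (z - of_real x0 + \<i>)"
        using ge(2)[OF z] C0 by (intro mult_left_mono) auto
      finally have "norm (F z) \<le> C * exp ((\<tau> + \<eta>) * R)" 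
        unfolding F_def norm_divide using zero ge(1)[OF z] by (subst pos_divide_le_eq) auto
      then show "norm (F z) \<le> C * exp ((\<tau> + \<eta>) * \<bar>x0\<bar>) * exp ((\<tau> + \<eta>) * norm z)"
        by (simp add: R_def distrib_left exp_add mult_ac)
    qed
  qed (use z in auto)
  then show ?thesis unfolding F_def norm_divide using ge(1)[OF z] by (subst (asm) pos_divide_le_eq) auto
qed

lemma holomorphic_reflect:
  assumes "f holomorphic_on UNIV" shows "(\<lambda>z. f (- z)) holomorphic_on UNIV"
proof -
  have "(f \<circ> uminus) holomorphic_on UNIV"
    by (rule holomorphic_on_compose) (auto intro: holomorphic_intros holomorphic_on_subset[OF assms])
  then show ?thesis by (simp add: comp_def)
qed

lemma exp_type_le_reflect: "exp_type_le \<tau> (\<lambda>z. f (- z)) \<longleftrightarrow> exp_type_le \<tau> f"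
proof -
  have "exp_type_le \<tau> (\<lambda>z. f (- z))" if "exp_type_le \<tau> f" for f
    using that unfolding exp_type_le_def by (metis norm_minus_cancel)
  from this[of f] this[of "\<lambda>z. f (- z)"] show ?thesis by auto
qed

lemma lborel_reflect:
  fixes h :: "real \<Rightarrow> 'a :: {banach, second_countable_topology}"
  shows "integrable lborel (\<lambda>t. h (- t)) \<longleftrightarrow> integrable lborel h"
    and "(LINT t|lborel. h (- t)) = (LINT t|lborel. h t)"
  using lborel_integrable_real_affine_iff[of "-1" h 0] lborel_integral_real_affine[of "-1" h 0] by auto

lemma real_line_bound_imp_exp_bound:
  fixes f :: "complex \<Rightarrow> complex"
  assumes hol: "f holomorphic_on UNIV" and type: "exp_type_le \<tau> f"
    and real: "\<And>x. norm (f (of_real x)) \<le> B"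
  shows "norm (f z) \<le> B * exp (\<tau> * \<bar>Im z\<bar>)"
proof -
  have *: "norm (g z) \<le> B * exp (\<tau> * Im z)" 
    if "g holomorphic_on UNIV" "exp_type_le \<tau> g" "\<And>x. norm (g (of_real x)) \<le> B" "Im z \<ge> 0" for g z
  proof (rule phragmen_lindelof_half_plane[of g 1])
    show "\<exists>C. \<forall>z. 0 \<le> Im z \<longrightarrow> norm (g z) \<le> C * exp ((\<tau> + \<eta>) * norm z)" if "\<eta> > 0" for \<eta>
      using \<open>exp_type_le \<tau> g\<close> that unfolding exp_type_le_def by blast
  qed (use that in \<open>auto intro: holomorphic_on_subset\<close>)
  show ?thesis
  proof (cases "Im z \<ge> 0")
    case True then show ?thesis using *[OF hol type real] by simp
  next
    case False
    have "(\<lambda>z. f (- z)) holomorphic_on UNIV" by (rule holomorphic_reflect[OF hol])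
    moreover have "norm (f (- of_real x)) \<le> B" for x using real[of "- x"] by simp
    ultimately show ?thesis
      using *[of "\<lambda>z. f (- z)" "- z"] type False by (simp add: exp_type_le_reflect)
  qed
qed

text \<open>
  Cauchy's inequality on the unit circle about a real point \<open>x\<^sub>0\<close> recovers \<open>f(x\<^sub>0)\<close> from the primitive that vanishes
  at \<open>x\<^sub>0\<close>; the estimate does not depend on \<open>x\<^sub>0\<close>.
\<close>
lemma paley_wiener_pointwise_bound:
  fixes f :: "complex \<Rightarrow> complex"
  assumes hol: "f holomorphic_on UNIV" and type: "exp_type_le \<tau> f" and \<tau>: "\<tau> \<ge> 0" and p: "p \<ge> 1"
    and int: "integrable lborel (\<lambda>t::real. norm (f (of_real t)) powr p)"
    and K: "(LINT t|lborel. norm (f (of_real t)) powr p) \<le> K"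
  shows "norm (f z) \<le> 2 * (1 + K) * exp \<tau> * exp (\<tau> * \<bar>Im z\<bar>)"
proof (rule real_line_bound_imp_exp_bound[OF hol type])
  fix x0 :: real
  have K0: "K \<ge> 0" using order_trans[OF Bochner_Integration.integral_nonneg K] by simp
  obtain \<Psi> where \<Psi>: "\<And>z. (\<Psi> has_field_derivative f z) (at z)"
    using holomorphic_convex_primitive'[OF convex_UNIV open_UNIV hol] by auto
  define \<Phi> where "\<Phi> = (\<lambda>z. \<Psi> z - \<Psi> (of_real x0))"
  have D: "(\<Phi> has_field_derivative f z) (at z)" for z
    unfolding \<Phi>_def by (auto intro!: derivative_eq_intros \<Psi>)
  have up: "norm (\<Phi> z) \<le> (1 + K) * exp (\<tau> * Im z) * norm (z - of_real x0 + \<i>)" if "Im z \<ge> 0" for z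
    by (rule primitive_bound_upper[OF D _ type \<tau> p int K that]) (simp add: \<Phi>_def)
  have down: "norm (\<Phi> (- z)) \<le> (1 + K) * exp (\<tau> * Im z) * norm (z - of_real (- x0) + \<i>)" if "Im z \<ge> 0" for z
  proof -
    have "((\<lambda>z. - \<Phi> (- z)) has_field_derivative f (- z)) (at z)" for z
      by (rule derivative_eq_intros DERIV_chain2[OF D] refl | simp)+
    moreover have "integrable lborel (\<lambda>t::real. norm (f (- of_real t)) powr p)"
      using int lborel_reflect(1)[of "\<lambda>t. norm (f (of_real t)) powr p"] by simp
    moreover have "(LINT t|lborel. norm (f (- of_real t)) powr p) \<le> K"
      using K lborel_reflect(2)[of "\<lambda>t. norm (f (of_real t)) powr p"] by simp
    ultimately have "norm (- \<Phi> (- z)) \<le> (1 + K) * exp (\<tau> * Im z) * norm (z - of_real (- x0) + \<i>)"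
      using type that \<tau> p 
      by (intro primitive_bound_upper[where f = "\<lambda>z. f (- z)" and p = p]) (auto simp: \<Phi>_def exp_type_le_reflect)
    then show ?thesis by simp
  qed
  have circ: "norm (\<Phi> z) \<le> 2 * (1 + K) * exp \<tau>" if z: "norm (of_real x0 - z) = 1" for z
  proof -
    have im: "\<bar>Im z\<bar> \<le> 1" using abs_Im_le_cmod[of "of_real x0 - z"] z by simp
    have n1: "norm (z - of_real x0 + \<i>) \<le> 2" "norm (- z - of_real (- x0) + \<i>) \<le> 2"
      using norm_triangle_ineq[of "z - of_real x0" \<i>] norm_triangle_ineq[of "of_real x0 - z" \<i>] z
      by (simp_all add: norm_minus_commute)
    have e: "exp (\<tau> * \<bar>Im z\<bar>) \<le> exp \<tau>" using \<tau> im by (simp add: mult_left_le)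
    have "norm (\<Phi> z) \<le> (1 + K) * exp \<tau> * 2"
    proof (cases "Im z \<ge> 0")
      case True
      have "norm (\<Phi> z) \<le> (1 + K) * exp (\<tau> * \<bar>Im z\<bar>) * norm (z - of_real x0 + \<i>)" using up[OF True] True by simp
      also have "\<dots> \<le> (1 + K) * exp \<tau> * 2" using n1 e K0 by (intro mult_mono) auto
      finally show ?thesis .
    next
      case False
      have "norm (\<Phi> z) \<le> (1 + K) * exp (\<tau> * \<bar>Im z\<bar>) * norm (- z - of_real (- x0) + \<i>)" using down[of "- z"] False by simp
      also have "\<dots> \<le> (1 + K) * exp \<tau> * 2" using n1(2) e K0 by (intro mult_mono) auto
      finally show ?thesis .
    qed
    then show ?thesis by (simp add: mult_ac)
  qed
  have hol\<Phi>: "\<Phi> holomorphic_on A" for A using D by (meson has_field_derivative_at_within holomorphic_on_def field_differentiable_def)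
  have "norm ((deriv ^^ 1) \<Phi> (of_real x0)) \<le> fact 1 * (2 * (1 + K) * exp \<tau>) / 1 ^ 1"
    by (rule Cauchy_inequality) (use circ hol\<Phi> in \<open>auto intro: holomorphic_on_imp_continuous_on\<close>)
  then show "norm (f (of_real x0)) \<le> 2 * (1 + K) * exp \<tau>"
    using DERIV_imp_deriv[OF D] by simp
qed

section \<open>Jensen's inequality for Poisson averages, and horizontal translates\<close>

lemma powr_minus_one_mult: "c > 0 \<Longrightarrow> c powr (p - 1) * c = c powr p" for c p :: real
  using powr_add[of c "p - 1" 1] by (simp only: powr_one diff_add_cancel)

lemma powr_above_tangent:
  fixes a c p :: real
  assumes "a \<ge> 0" "c > 0" "p \<ge> 1"
  shows "a powr p \<ge> c powr p + p * c powr (p - 1) * (a - c)"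
proof (cases "a = 0")
  case True
  have "p * c powr (p - 1) * (a - c) = - (p * (c powr (p - 1) * c))"
    unfolding True by (simp only: diff_0 mult_minus_right mult.assoc)
  then have "p * c powr (p - 1) * (a - c) = - (p * c powr p)" by (simp only: powr_minus_one_mult[OF assms(2)])
  moreover have "1 * c powr p \<le> p * c powr p" using assms(3) by (intro mult_right_mono) auto
  moreover have "a powr p \<ge> 0" by simp
  ultimately show ?thesis by linarith
next
  case False
  have "a powr p - c powr p \<ge> (p * c powr (p - 1)) * (a - c)"
  proof (rule convex_on_imp_above_tangent[OF powr_convex[OF assms(3)]])
    show "((\<lambda>x. x powr p) has_real_derivative p * c powr (p - 1)) (at c within {0<..})"
      by (rule has_field_derivative_at_within[OF has_real_derivative_powr[OF assms(2)]])
  qed (use assms False in \<open>auto simp: interior_open\<close>)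
  then show ?thesis by linarith
qed

text \<open>
  Integrating the tangent inequality at \<open>c = \<bar>F(w)\<bar>\<close> against the Poisson kernel gives Jensen's inequality, because
  \<open>c\<close> is at most the Poisson average of \<open>\<bar>F\<bar>\<close>.
\<close>
lemma poisson_jensen:
  fixes F :: "complex \<Rightarrow> complex"
  assumes hol: "F holomorphic_on {z. Im z > - a}" and a: "a > 0" and w: "Im w > 0"
    and bdd: "\<And>z. Im z \<ge> 0 \<Longrightarrow> norm (F z) \<le> C" and p: "p \<ge> 1"
  shows "integrable lborel (\<lambda>t::real. poisson w t * norm (F (of_real t)) powr p)"
    and "norm (F w) powr p \<le> (LINT t|lborel. poisson w t * norm (F (of_real t)) powr p)"
proof -
  have [measurable]: "(\<lambda>t::real. F (of_real t)) \<in> borel_measurable borel"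
    by (rule borel_measurable_continuous_onI[OF continuous_on_real_line[OF hol a]])
  show int: "integrable lborel (\<lambda>t::real. poisson w t * norm (F (of_real t)) powr p)"
  proof (rule Bochner_Integration.integrable_bound)
    show "integrable lborel (\<lambda>t. C powr p * poisson w t)" using integrable_poisson[OF w] by auto
    have "norm (F (of_real t)) powr p \<le> C powr p" for t using bdd[of "of_real t"] p by (intro powr_mono2) auto
    then show "AE t in lborel. norm (poisson w t * norm (F (of_real t)) powr p) \<le> norm (C powr p * poisson w t)"
      using poisson_nonneg[OF w] by (intro AE_I2) (auto simp: abs_mult mult.commute intro!: mult_left_mono)
  qed measurable
  define c where "c = norm (F w)"
  show "norm (F w) powr p \<le> (LINT t|lborel. poisson w t * norm (F (of_real t)) powr p)"
  proof (cases "c = 0")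
    case True
    then have "norm (F w) powr p = 0" by (simp add: c_def)
    moreover have "0 \<le> (LINT t|lborel. poisson w t * norm (F (of_real t)) powr p)"
      by (intro Bochner_Integration.integral_nonneg mult_nonneg_nonneg poisson_nonneg w) simp
    ultimately show ?thesis by linarith
  next
    case False
    then have c: "c > 0" by (simp add: c_def)
    note pf = poisson_formula[OF hol a w bdd]
    have int1: "integrable lborel (\<lambda>t. poisson w t * norm (F (of_real t)))"
      using integrable_norm[OF pf(1)] poisson_nonneg[OF w] by (simp add: norm_mult)
    have "c = norm (LINT t|lborel. of_real (poisson w t) * F (of_real t))"
      by (simp add: c_def pf(2))
    also have "\<dots> \<le> (LINT t|lborel. norm (of_real (poisson w t) * F (of_real t)))"
      by (rule Bochner_Integration.integral_norm_bound)
    also have "\<dots> = (LINT t|lborel. poisson w t * norm (F (of_real t)))"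
      using poisson_nonneg[OF w] by (simp add: norm_mult)
    finally have le: "c \<le> (LINT t|lborel. poisson w t * norm (F (of_real t)))" .
    define q where "q = p * c powr (p - 1)"
    have q: "q \<ge> 0" using p by (simp add: q_def)
    have i1: "integrable lborel (\<lambda>t. (c powr p - q * c) * poisson w t)"
      by (rule integrable_mult_right[OF integrable_poisson[OF w]])
    have i2: "integrable lborel (\<lambda>t. q * (poisson w t * norm (F (of_real t))))"
      by (rule integrable_mult_right[OF int1])
    have "c powr p = c powr p - q * c + q * c" by simp
    also have "\<dots> \<le> c powr p - q * c + q * (LINT t|lborel. poisson w t * norm (F (of_real t)))"
      by (intro add_left_mono mult_left_mono le q)
    also have "\<dots> = (c powr p - q * c) * (LINT t|lborel. poisson w t) + q * (LINT t|lborel. poisson w t * norm (F (of_real t)))"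
      unfolding integral_poisson[OF w] by (simp only: mult_1_right)
    also have "\<dots> = (LINT t|lborel. (c powr p - q * c) * poisson w t + q * (poisson w t * norm (F (of_real t))))"
      by (simp only: Bochner_Integration.integral_add[OF i1 i2] integral_mult_right_zero)
    also have "\<dots> \<le> (LINT t|lborel. poisson w t * norm (F (of_real t)) powr p)"
    proof (rule integral_mono[OF Bochner_Integration.integrable_add[OF i1 i2] int])
      fix t :: real
      define x where "x = norm (F (of_real t))"
      have "poisson w t * (c powr p + q * (x - c)) \<le> poisson w t * x powr p"
        unfolding q_def by (intro mult_left_mono powr_above_tangent poisson_nonneg w c p) (simp add: x_def)
      moreover have "poisson w t * (c powr p + q * (x - c)) = (c powr p - q * c) * poisson w t + q * (poisson w t * x)"
        by (simp add: algebra_simps)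
      ultimately show "(c powr p - q * c) * poisson w t + q * (poisson w t * norm (F (of_real t))) \<le> poisson w t * norm (F (of_real t)) powr p"
        unfolding x_def by linarith
    qed
    finally show ?thesis unfolding c_def .
  qed
qed

lemma poisson_swap: "poisson (of_real x + \<i> * of_real y) t = poisson (of_real t + \<i> * of_real y) x"
  unfolding poisson_def norm_of_real_minus_sq by (simp add: power2_commute)

lemma nn_integral_poisson: "Im w > 0 \<Longrightarrow> (\<integral>\<^sup>+ t. ennreal (poisson w t) \<partial>lborel) = 1"
  using nn_integral_eq_integral[OF integrable_poisson[of w]] integral_poisson[of w] poisson_nonneg[of w] by simp

lemma poisson_measurable_pair [measurable]:
  "(\<lambda>(x, t). poisson (of_real x + \<i> * of_real y) t) \<in> borel_measurable (borel \<Otimes>\<^sub>M borel)"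
  unfolding poisson_def norm_of_real_minus_sq by measurable

text \<open>
  By Jensen's inequality \<open>\<bar>f(x + \<i> y)\<bar>\<^sup>p\<close> is at most \<open>exp (p \<tau> y)\<close> times a Poisson average of \<open>\<bar>f\<bar>\<^sup>p\<close> over the real
  line. Integrating in \<open>x\<close> first, the kernel has total mass \<open>1\<close>.
\<close>
lemma plancherel_polya:
  fixes f :: "complex \<Rightarrow> complex"
  assumes hol: "f holomorphic_on UNIV" and bd: "\<And>z. norm (f z) \<le> B * exp (\<tau> * \<bar>Im z\<bar>)"
    and p: "p \<ge> 1" and y: "y > 0"
    and int: "integrable lborel (\<lambda>t::real. norm (f (of_real t)) powr p)"
  shows "integrable lborel (\<lambda>x::real. norm (f (of_real x + \<i> * of_real y)) powr p)"
    and "(LINT x|lborel. norm (f (of_real x + \<i> * of_real y)) powr p)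
          \<le> exp (p * \<tau> * y) * (LINT t|lborel. norm (f (of_real t)) powr p)"
proof -
  let ?P = "\<lambda>x t. poisson (of_real x + \<i> * of_real y) t"
  let ?N = "\<lambda>t::real. ennreal (norm (f (of_real t)) powr p)"
  define F where "F = (\<lambda>z. f z * exp (\<i> * of_real \<tau> * z))"
  have nF: "norm (F z) = norm (f z) * exp (- (\<tau> * Im z))" for z by (simp add: F_def norm_mult)
  have holF: "F holomorphic_on A" for A unfolding F_def
    by (intro holomorphic_intros holomorphic_on_subset[OF hol]) auto
  have bdF: "norm (F z) \<le> B" if "Im z \<ge> 0" for z
  proof -
    have "norm (F z) \<le> B * exp (\<tau> * Im z) * exp (- (\<tau> * Im z))"
      unfolding nF using bd[of z] that by (intro mult_right_mono) auto
    also have "\<dots> = B" by (simp only: mult.assoc exp_minus_inverse mult_1_right)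
    finally show ?thesis .
  qed
  have contf: "continuous_on A f" for A by (rule holomorphic_on_imp_continuous_on[OF holomorphic_on_subset[OF hol]]) simp
  have "continuous_on UNIV (\<lambda>x::real. f (of_real x + \<i> * of_real y))" "continuous_on UNIV (\<lambda>x::real. f (of_real x))"
    by (rule continuous_on_compose2[OF contf]; auto intro!: continuous_intros)+
  then have [measurable]: "(\<lambda>x::real. f (of_real x + \<i> * of_real y)) \<in> borel_measurable borel"
    "(\<lambda>x::real. f (of_real x)) \<in> borel_measurable borel"
    by (auto intro: borel_measurable_continuous_onI)
  define I where "I = (LINT t|lborel. norm (f (of_real t)) powr p)"
  have I0: "I \<ge> 0" unfolding I_def by (rule Bochner_Integration.integral_nonneg) simp
  have step: "norm (f (of_real x + \<i> * of_real y)) powr p \<le> exp (p * \<tau> * y) * (LINT t|lborel. ?P x t * norm (f (of_real t)) powr p)"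
    "integrable lborel (\<lambda>t. ?P x t * norm (f (of_real t)) powr p)" for x
  proof -
    define w where "w = of_real x + \<i> * of_real y"
    have w: "Im w = y" "Im w > 0" using y by (auto simp: w_def)
    note j = poisson_jensen[of F 1 w B p, OF holF _ w(2) bdF p]
    show "integrable lborel (\<lambda>t. poisson w t * norm (f (of_real t)) powr p)" using j(1) by (simp add: nF)
    have "exp (p * \<tau> * y) = exp (\<tau> * y) powr p" by (simp add: powr_def mult_ac)
    moreover have "norm (f w) = exp (\<tau> * y) * norm (F w)"
      by (simp add: nF w exp_minus)
    ultimately have "norm (f w) powr p = exp (p * \<tau> * y) * norm (F w) powr p"
      by (simp only: powr_mult)
    also have "\<dots> \<le> exp (p * \<tau> * y) * (LINT t|lborel. poisson w t * norm (f (of_real t)) powr p)"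
      using j(2) by (intro mult_left_mono) (auto simp: nF)
    finally show "norm (f w) powr p \<le> exp (p * \<tau> * y) * (LINT t|lborel. poisson w t * norm (f (of_real t)) powr p)" .
  qed
  have "(\<integral>\<^sup>+ x. ennreal (norm (f (of_real x + \<i> * of_real y)) powr p) \<partial>lborel) \<le>
     (\<integral>\<^sup>+ x. ennreal (exp (p * \<tau> * y)) * (\<integral>\<^sup>+ t. ennreal (?P x t) * ?N t \<partial>lborel) \<partial>lborel)"
  proof (rule nn_integral_mono)
    fix x :: real
    have nn: "?P x t \<ge> 0" for t using y by (intro poisson_nonneg) simp
    have "ennreal (norm (f (of_real x + \<i> * of_real y)) powr p) \<le> ennreal (exp (p * \<tau> * y)) * 
       ennreal (LINT t|lborel. ?P x t * norm (f (of_real t)) powr p)"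
    proof (subst ennreal_mult[symmetric])
      show "0 \<le> (LINT t|lborel. ?P x t * norm (f (of_real t)) powr p)"
        by (intro Bochner_Integration.integral_nonneg mult_nonneg_nonneg nn) simp
    qed (use step(1)[of x] in \<open>auto intro: ennreal_leI\<close>)
    also have "ennreal (LINT t|lborel. ?P x t * norm (f (of_real t)) powr p) =
      (\<integral>\<^sup>+ t. ennreal (?P x t * norm (f (of_real t)) powr p) \<partial>lborel)"
      by (rule nn_integral_eq_integral[symmetric, OF step(2)]) (use nn in auto)
    also have "\<dots> = (\<integral>\<^sup>+ t. ennreal (?P x t) * ?N t \<partial>lborel)"
      using nn by (simp add: ennreal_mult)
    finally show "ennreal (norm (f (of_real x + \<i> * of_real y)) powr p) \<le> ennreal (exp (p * \<tau> * y)) * 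
      (\<integral>\<^sup>+ t. ennreal (?P x t) * ?N t \<partial>lborel)" .
  qed
  also have "\<dots> = ennreal (exp (p * \<tau> * y)) * (\<integral>\<^sup>+ x. (\<integral>\<^sup>+ t. ennreal (?P x t) * ?N t \<partial>lborel) \<partial>lborel)"
    by (rule nn_integral_cmult) measurable
  also have "(\<integral>\<^sup>+ x. (\<integral>\<^sup>+ t. ennreal (?P x t) * ?N t \<partial>lborel) \<partial>lborel)
    = (\<integral>\<^sup>+ t. (\<integral>\<^sup>+ x. ennreal (?P x t) * ?N t \<partial>lborel) \<partial>lborel)"
    by (rule lborel_pair.Fubini') measurable
  also have "\<dots> = (\<integral>\<^sup>+ t. ?N t \<partial>lborel)"
  proof (rule nn_integral_cong)
    fix t :: real
    have "(\<integral>\<^sup>+ x. ennreal (?P x t) * ?N t \<partial>lborel)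
      = (\<integral>\<^sup>+ x. ennreal (poisson (of_real t + \<i> * of_real y) x) * ?N t \<partial>lborel)"
      by (subst poisson_swap) simp
    also have "\<dots> = (\<integral>\<^sup>+ x. ennreal (poisson (of_real t + \<i> * of_real y) x) \<partial>lborel) * ?N t"
      by (rule nn_integral_multc) measurable
    also have "\<dots> = ?N t" using y by (subst nn_integral_poisson) auto
    finally show "(\<integral>\<^sup>+ x. ennreal (?P x t) * ?N t \<partial>lborel)
      = ?N t" .
  qed
  also have "\<dots> = ennreal I" unfolding I_def by (rule nn_integral_eq_integral[OF int]) simp
  also have "ennreal (exp (p * \<tau> * y)) * ennreal I = ennreal (exp (p * \<tau> * y) * I)" 
    using I0 by (simp add: ennreal_mult)
  finally have main: "(\<integral>\<^sup>+ x. ennreal (norm (f (of_real x + \<i> * of_real y)) powr p) \<partial>lborel) \<le> ennreal (exp (p * \<tau> * y) * I)" .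
  show i: "integrable lborel (\<lambda>x::real. norm (f (of_real x + \<i> * of_real y)) powr p)"
    by (rule integrableI_bounded) (use main in \<open>auto intro: le_less_trans\<close>)
  have "ennreal (LINT x|lborel. norm (f (of_real x + \<i> * of_real y)) powr p) \<le> ennreal (exp (p * \<tau> * y) * I)"
    using main nn_integral_eq_integral[OF i] by simp
  then show "(LINT x|lborel. norm (f (of_real x + \<i> * of_real y)) powr p) \<le> exp (p * \<tau> * y) * (LINT t|lborel. norm (f (of_real t)) powr p)"
    using I0 by (subst (asm) ennreal_le_iff) (auto simp: I_def)
qed

section \<open>The Carleson condition from division by Blaschke products\<close>

lemma factor_out_zeros:
  fixes h :: "complex \<Rightarrow> complex"
  assumes hol: "h holomorphic_on UNIV" and "finite S" "inj_on \<mu> S" "\<And>j. j \<in> S \<Longrightarrow> h (\<mu> j) = 0"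
  obtains q where "q holomorphic_on UNIV" "\<And>z. h z = q z * (\<Prod>j\<in>S. z - \<mu> j)"
proof -
  have "\<exists>q. q holomorphic_on UNIV \<and> (\<forall>z. h z = q z * (\<Prod>j\<in>S. z - \<mu> j))"
    using assms(2-4)
  proof (induction S)
    case empty then show ?case using hol by auto
  next
    case (insert a S)
    then obtain q where q: "q holomorphic_on UNIV" "\<And>z. h z = q z * (\<Prod>j\<in>S. z - \<mu> j)" by auto
    have "(\<Prod>j\<in>S. \<mu> a - \<mu> j) \<noteq> 0" using insert by (auto simp: inj_on_def)
    then have qa: "q (\<mu> a) = 0" using q(2)[of "\<mu> a"] insert.prems(2)[of a] by auto
    define r where "r = (\<lambda>z. if z = \<mu> a then deriv q (\<mu> a) else (q z - q (\<mu> a)) / (z - \<mu> a))"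
    have "r holomorphic_on UNIV" unfolding r_def by (rule pole_lemma[OF q(1)]) simp
    moreover have "h z = r z * (\<Prod>j\<in>insert a S. z - \<mu> j)" for z
      using insert.hyps q(2)[of z] qa by (auto simp: r_def)
    ultimately show ?case by blast
  qed
  then show ?thesis using that by blast
qed

lemma norm_reflect_eq_Im0: "Im z = 0 \<Longrightarrow> norm (z - cnj m) = norm (z - m)"
  by (simp add: cmod_def)

text \<open>
  Replacing the zeros \<open>\<mu>\<^sub>j\<close> of \<open>h\<close> by their reflections \<open>cnj \<mu>\<^sub>j\<close> amounts to dividing by a Blaschke product: it keeps
  the modulus on the real line and enlarges it at \<open>w\<close>. The Poisson kernel at \<open>w\<close> is at most \<open>1 / (\<pi> Im w)\<close>, so Jensen's
  inequality bounds the enlarged value.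
\<close>
lemma blaschke_quotient_bound:
  fixes h :: "complex \<Rightarrow> complex"
  assumes hol: "h holomorphic_on UNIV" and bdd: "\<And>z. Im z \<ge> 0 \<Longrightarrow> norm (h z) \<le> B" and p: "p \<ge> 1"
    and int: "integrable lborel (\<lambda>t::real. norm (h (of_real t)) powr p)"
    and K: "(LINT t|lborel. norm (h (of_real t)) powr p) \<le> K"
    and S: "finite S" "inj_on \<mu> S" "\<And>j. j \<in> S \<Longrightarrow> h (\<mu> j) = 0" "\<And>j. j \<in> S \<Longrightarrow> Im (\<mu> j) > 0"
    and w: "Im w > 0" "\<And>j. j \<in> S \<Longrightarrow> \<mu> j \<noteq> w"
  shows "(norm (h w) * (\<Prod>j\<in>S. norm (w - cnj (\<mu> j)) / norm (w - \<mu> j))) powr p \<le> K / (pi * Im w)"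
proof -
  obtain q where q: "q holomorphic_on UNIV" "\<And>z. h z = q z * (\<Prod>j\<in>S. z - \<mu> j)"
    using factor_out_zeros[OF hol S(1-3)] by blast
  define F where "F = (\<lambda>z. q z * (\<Prod>j\<in>S. z - cnj (\<mu> j)))"
  have holF: "F holomorphic_on A" for A unfolding F_def
    by (intro holomorphic_intros holomorphic_on_subset[OF q(1)]) auto
  have B0: "B \<ge> 0" using order_trans[OF norm_ge_zero bdd[of 0]] by simp
  have Fh: "norm (F z) = norm (h z) * (\<Prod>j\<in>S. norm (z - cnj (\<mu> j)) / norm (z - \<mu> j))"
    if "\<And>j. j \<in> S \<Longrightarrow> \<mu> j \<noteq> z" for z
  proof -
    have "(\<Prod>j\<in>S. norm (z - \<mu> j)) \<noteq> 0" using that S(1) by auto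
    then show ?thesis unfolding F_def q(2) norm_mult prod_norm[symmetric] prod_dividef by simp
  qed
  \<comment> \<open>outside this disc every quotient \<open>\<bar>z - cnj \<mu>\<^sub>j\<bar> / \<bar>z - \<mu>\<^sub>j\<bar>\<close> is at most \<open>2\<close>\<close>
  define R where "R = 3 * (\<Sum>j\<in>S. norm (\<mu> j)) + 1"
  have "continuous_on (cball 0 R) F" by (rule holomorphic_on_imp_continuous_on[OF holF])
  then have "bounded (F ` cball 0 R)" by (intro compact_imp_bounded compact_continuous_image) auto
  then obtain C where C: "\<And>z. norm z \<le> R \<Longrightarrow> norm (F z) \<le> C" 
    unfolding bounded_iff by (metis imageI mem_cball_0)
  have bdF: "norm (F z) \<le> max C (B * 2 ^ card S)" if z: "Im z \<ge> 0" for z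
  proof (cases "norm z \<le> R")
    case True then show ?thesis using C[of z] by simp
  next
    case False
    have far: "norm z \<ge> 3 * norm (\<mu> j) + 1" if "j \<in> S" for j
      using False member_le_sum[of j S "\<lambda>j. norm (\<mu> j)"] that S(1) unfolding R_def by simp
    have quo: "norm (z - cnj (\<mu> j)) / norm (z - \<mu> j) \<le> 2" "\<mu> j \<noteq> z" if "j \<in> S" for j
    proof -
      have 1: "norm (z - cnj (\<mu> j)) \<le> norm z + norm (\<mu> j)" using norm_triangle_ineq4[of z "cnj (\<mu> j)"] by simp
      have 2: "norm (z - \<mu> j) \<ge> norm z - norm (\<mu> j)" by (rule norm_triangle_ineq2)
      have 3: "norm (z - \<mu> j) > 0" using 2 far[OF that] norm_ge_zero[of "\<mu> j"] by linarith
      show "norm (z - cnj (\<mu> j)) / norm (z - \<mu> j) \<le> 2"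
        using 1 2 3 far[OF that] by (subst pos_divide_le_eq) linarith+
      show "\<mu> j \<noteq> z" using 3 by auto
    qed
    have "norm (F z) = norm (h z) * (\<Prod>j\<in>S. norm (z - cnj (\<mu> j)) / norm (z - \<mu> j))" by (rule Fh) (use quo in auto)
    also have "\<dots> \<le> B * (\<Prod>j\<in>S. 2)"
      using bdd[OF z] quo B0 by (intro mult_mono prod_mono) (auto intro!: prod_nonneg)
    finally show ?thesis by simp
  qed
  have real: "norm (F (of_real t)) = norm (h (of_real t))" for t
  proof -
    have "norm (F (of_real t)) = norm (h (of_real t)) * (\<Prod>j\<in>S. norm (of_real t - cnj (\<mu> j)) / norm (of_real t - \<mu> j))"
      by (rule Fh) (use S(4) in fastforce)
    also have "(\<Prod>j\<in>S. norm (of_real t - cnj (\<mu> j)) / norm (of_real t - \<mu> j)) = (\<Prod>j\<in>S. 1)"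
    proof (rule prod.cong)
      fix j assume "j \<in> S"
      then have "of_real t \<noteq> \<mu> j" using S(4)[of j] by (metis Im_complex_of_real less_irrefl)
      then show "norm (of_real t - cnj (\<mu> j)) / norm (of_real t - \<mu> j) = 1" by (simp add: norm_reflect_eq_Im0)
    qed simp
    finally show ?thesis by simp
  qed
  note j = poisson_jensen[of F 1 w _ p, OF holF _ w(1) bdF p]
  have "norm (F w) powr p \<le> (LINT t|lborel. poisson w t * norm (h (of_real t)) powr p)"
    using j(2) by (simp add: real)
  also have "\<dots> \<le> (LINT t|lborel. 1 / (pi * Im w) * norm (h (of_real t)) powr p)"
    using j(1) poisson_le[OF w(1)] by (intro integral_mono integrable_mult_right int mult_right_mono) (auto simp: real)
  also have "\<dots> = (LINT t|lborel. norm (h (of_real t)) powr p) / (pi * Im w)" by simp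
  also have "\<dots> \<le> K / (pi * Im w)" using K w by (intro divide_right_mono) auto
  also have "norm (F w) = norm (h w) * (\<Prod>j\<in>S. norm (w - cnj (\<mu> j)) / norm (w - \<mu> j))"
    by (rule Fh) (use w in auto)
  finally show ?thesis .
qed

lemma norm_reflected_diff_sq:
  "(norm (w - cnj m))\<^sup>2 - (norm (w - m))\<^sup>2 = 4 * Im m * Im w"
  unfolding cmod_power2 by (simp add: power2_eq_square algebra_simps)

lemma one_plus_sum_le_prod:
  assumes "finite S" "\<And>j. j \<in> S \<Longrightarrow> x j \<ge> (0::real)"
  shows "1 + (\<Sum>j\<in>S. x j) \<le> (\<Prod>j\<in>S. 1 + x j)"
  using assms
proof (induction S)
  case (insert a S)
  have "1 + (\<Sum>j\<in>insert a S. x j) \<le> (1 + x a) * (1 + (\<Sum>j\<in>S. x j))"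
    using insert sum_nonneg[of S x] by (simp add: algebra_simps)
  also have "\<dots> \<le> (1 + x a) * (\<Prod>j\<in>S. 1 + x j)" using insert by (intro mult_left_mono) auto
  finally show ?case using insert by simp
qed simp

text \<open>
  If \<open>h\<close> is nearly extremal at \<open>w\<close>, the Blaschke product of zeros of \<open>h\<close> is bounded below there. Each factor
  satisfies \<open>\<bar>b\<^sub>j(w)\<bar>\<^sup>-\<^sup>2 \<ge> 1 + X\<^sub>j\<close> with \<open>X\<^sub>j\<close> the summand of the Carleson sum, and a product of factors
  \<open>1 + X\<^sub>j\<close> dominates the sum of the \<open>X\<^sub>j\<close>.
\<close>
lemma carleson_sum_bound:
  fixes h :: "complex \<Rightarrow> complex"
  assumes hol: "h holomorphic_on UNIV" and bdd: "\<And>z. Im z \<ge> 0 \<Longrightarrow> norm (h z) \<le> B" and p: "p \<ge> 1"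
    and int: "integrable lborel (\<lambda>t::real. norm (h (of_real t)) powr p)"
    and K: "(LINT t|lborel. norm (h (of_real t)) powr p) \<le> K"
    and S: "finite S" "inj_on \<mu> S" "\<And>j. j \<in> S \<Longrightarrow> h (\<mu> j) = 0" "\<And>j. j \<in> S \<Longrightarrow> Im (\<mu> j) > 0"
    and w: "Im w > 0" and hw: "Im w * norm (h w) powr p \<ge> c" and c: "c > 0"
  shows "(\<Sum>j\<in>S. Im (\<mu> j) * Im w / (norm (w - cnj (\<mu> j)))\<^sup>2) \<le> (K / (pi * c)) powr (2 / p)"
proof -
  have hw0: "norm (h w) > 0" using hw c p by (cases "h w = 0") auto
  have wS: "\<mu> j \<noteq> w" if "j \<in> S" for j using S(3)[OF that] hw0 by auto
  define P where "P = (\<Prod>j\<in>S. norm (w - cnj (\<mu> j)) / norm (w - \<mu> j))"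
  define X where "X = (\<lambda>j. Im (\<mu> j) * Im w / (norm (w - cnj (\<mu> j)))\<^sup>2)"
  have P0: "P \<ge> 0" unfolding P_def by (intro prod_nonneg) auto
  have X: "0 \<le> X j" "1 + X j \<le> (norm (w - cnj (\<mu> j)) / norm (w - \<mu> j))\<^sup>2" if j: "j \<in> S" for j
  proof -
    have b: "(norm (w - \<mu> j))\<^sup>2 > 0" using wS[OF j] by auto
    have v: "Im (\<mu> j) * Im w > 0" using S(4)[OF j] w by simp
    have eq: "(norm (w - cnj (\<mu> j)))\<^sup>2 = (norm (w - \<mu> j))\<^sup>2 + 4 * (Im (\<mu> j) * Im w)"
      using norm_reflected_diff_sq[of w "\<mu> j"] by simp
    show "0 \<le> X j" unfolding X_def using v by (intro divide_nonneg_nonneg) auto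
    have "(norm (w - cnj (\<mu> j)))\<^sup>2 > 0" using b v eq by linarith
    then have "X j \<le> Im (\<mu> j) * Im w / (norm (w - \<mu> j))\<^sup>2"
      unfolding X_def using v b eq by (intro divide_left_mono mult_pos_pos) linarith+
    also have "\<dots> \<le> 4 * (Im (\<mu> j) * Im w) / (norm (w - \<mu> j))\<^sup>2"
      using v b by (intro divide_right_mono) linarith+
    finally show "1 + X j \<le> (norm (w - cnj (\<mu> j)) / norm (w - \<mu> j))\<^sup>2"
      using b unfolding power_divide eq add_divide_distrib by simp
  qed
  have "norm (h w) powr p * P powr p \<le> K / (pi * Im w)"
    using blaschke_quotient_bound[OF hol bdd p int K S w wS] P0 by (simp add: P_def powr_mult)
  then have "(Im w * norm (h w) powr p) * P powr p \<le> K / pi"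
    using w by (simp add: field_simps)
  then have "c * P powr p \<le> K / pi" using mult_right_mono[OF hw, of "P powr p"] by simp
  then have "P powr p \<le> K / (pi * c)" using c by (simp add: field_simps)
  then have "(P powr p) powr (2 / p) \<le> (K / (pi * c)) powr (2 / p)" using p by (intro powr_mono2) auto
  moreover have "(P powr p) powr (2 / p) = P powr 2" using p by (simp add: powr_powr)
  moreover have "P powr 2 = P\<^sup>2" using P0 by (cases "P = 0") (simp_all add: powr_numeral)
  ultimately have P2: "P\<^sup>2 \<le> (K / (pi * c)) powr (2 / p)" by simp
  have "(\<Sum>j\<in>S. X j) \<le> 1 + (\<Sum>j\<in>S. X j)" by simp
  also have "\<dots> \<le> (\<Prod>j\<in>S. 1 + X j)" by (rule one_plus_sum_le_prod[OF S(1)]) (use X in auto)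
  also have "\<dots> \<le> (\<Prod>j\<in>S. (norm (w - cnj (\<mu> j)) / norm (w - \<mu> j))\<^sup>2)"
    by (intro prod_mono) (use X in force)
  also have "\<dots> = P\<^sup>2" by (simp add: P_def prod_power_distrib)
  finally show ?thesis using P2 by (simp add: X_def)
qed

section \<open>Jones' functions for a Carleson sequence\<close>

text \<open>
  Listed by increasing \<open>v\<close>, the left-hand side is a lower Riemann sum for the integral of \<open>exp (- s)\<close> from \<open>0\<close> to
  \<open>\<Sum> x\<^sub>j\<close>, evaluated at right end points. Equal values of \<open>v\<close> only make it smaller, since all of them are
  subtracted in the exponent.
\<close>
lemma sum_ordered_exp_le:
  fixes x :: "'a \<Rightarrow> real" and v :: "'a \<Rightarrow> real"
  assumes "finite S" "\<And>j. j \<in> S \<Longrightarrow> x j \<ge> 0"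
  shows "(\<Sum>n\<in>S. x n * exp (- (\<Sum>j | j \<in> S \<and> v j \<le> v n. x j))) \<le> 1 - exp (- (\<Sum>j\<in>S. x j))"
  using assms
proof (induction S rule: finite_ranking_induct[where f = v])
  case empty then show ?case by simp
next
  case (insert m S)
  show ?case
  proof (cases "m \<in> S")
    case True then show ?thesis using insert by (simp add: insert_absorb)
  next
    case False
    let ?A = "\<Sum>j\<in>S. x j"
    have m: "{j. j \<in> insert m S \<and> v j \<le> v m} = insert m S" using insert by auto
    have "(\<Sum>n\<in>insert m S. x n * exp (- (\<Sum>j | j \<in> insert m S \<and> v j \<le> v n. x j))) =
       x m * exp (- (x m + ?A)) + (\<Sum>n\<in>S. x n * exp (- (\<Sum>j | j \<in> insert m S \<and> v j \<le> v n. x j)))"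
      unfolding sum.insert[OF insert.hyps(1) False] m by simp
    also have "(\<Sum>n\<in>S. x n * exp (- (\<Sum>j | j \<in> insert m S \<and> v j \<le> v n. x j)))
       \<le> (\<Sum>n\<in>S. x n * exp (- (\<Sum>j | j \<in> S \<and> v j \<le> v n. x j)))"
      using insert by (intro sum_mono mult_left_mono) (auto intro!: sum_mono2)
    also have "\<dots> \<le> 1 - exp (- ?A)" using insert by auto
    also have "x m * exp (- (x m + ?A)) + (1 - exp (- ?A)) \<le> 1 - exp (- (x m + ?A))"
    proof -
      have "(1 + x m) * exp (- (x m + ?A)) \<le> exp (x m) * exp (- (x m + ?A))"
        by (intro mult_right_mono exp_ge_add_one_self) auto
      also have "\<dots> = exp (- ?A)" by (simp add: mult_exp_exp)
      finally show ?thesis by (simp add: algebra_simps)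
    qed
    finally show ?thesis using insert.hyps(1) False by simp
  qed
qed

text \<open>
  Here \<open>G\<^sub>n(z) = (2 \<i> v\<^sub>n / (z - cnj \<mu>\<^sub>n))\<^sup>2 exp (- \<kappa> S\<^sub>n(z))\<close>, where \<open>S\<^sub>n\<close> is the sum of
  \<open>\<i> v\<^sub>j / (z - cnj \<mu>\<^sub>j) - \<i> v\<^sub>j / (\<mu>\<^sub>n - cnj \<mu>\<^sub>j)\<close> over the points with \<open>v\<^sub>j \<le> v\<^sub>n\<close>. Subtracting the values at
  \<open>\<mu>\<^sub>n\<close> makes the series converge and normalises \<open>G\<^sub>n(\<mu>\<^sub>n)\<close>; by the Carleson condition it costs at most \<open>2 C\<close> in the
  real part, because \<open>v\<^sub>n + v\<^sub>j \<le> 2 v\<^sub>n\<close> over the points used. On the real line the first factor has modulus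
  \<open>4 x\<^sub>n\<close> and the real parts of the terms of \<open>S\<^sub>n\<close> contribute \<open>x\<^sub>j\<close>, with \<open>x\<^sub>j = v\<^sub>j\<^sup>2 / \<bar>t - \<mu>\<^sub>j\<bar>\<^sup>2\<close>, so
  \<open>sum_ordered_exp_le\<close> bounds the sum of the moduli. The bound \<open>4 e\<close> for a single \<open>G\<^sub>n\<close> is independent of \<open>C\<close>, which
  matters because \<open>C\<close> grows with the vertical shift of the points.
\<close>
lemma jones_functions:
  fixes \<mu> :: "nat \<Rightarrow> complex"
  assumes M: "M > 0" "\<And>n. n \<in> I \<Longrightarrow> Im (\<mu> n) \<ge> M" and C: "C > 0"
    and carl: "\<And>n S. n \<in> I \<Longrightarrow> finite S \<Longrightarrow> S \<subseteq> I \<Longrightarrow>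
        (\<Sum>j\<in>S. Im (\<mu> j) * Im (\<mu> n) / (norm (\<mu> n - cnj (\<mu> j)))\<^sup>2) \<le> C"
  obtains G :: "nat \<Rightarrow> complex \<Rightarrow> complex" where
    "\<And>n. n \<in> I \<Longrightarrow> G n holomorphic_on {z. Im z > - (M / 2)}"
    "\<And>n. n \<in> I \<Longrightarrow> G n (\<mu> n) = 1"
    "\<And>n z. n \<in> I \<Longrightarrow> Im z \<ge> 0 \<Longrightarrow> norm (G n z) \<le> 4 * exp 1"
    "\<And>S t. finite S \<Longrightarrow> S \<subseteq> I \<Longrightarrow> (\<Sum>n\<in>S. norm (G n (of_real t))) \<le> 8 * exp 1 * C"
proof -
  define v where "v = (\<lambda>n. Im (\<mu> n))"
  have v: "v n \<ge> M" "v n > 0" if "n \<in> I" for n using M(2)[OF that] M(1) by (auto simp: v_def)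
  have lowM: "norm (z - cnj (\<mu> j)) \<ge> M / 2" if "j \<in> I" "Im z \<ge> - (M / 2)" for j z
    using abs_Im_le_cmod[of "z - cnj (\<mu> j)"] v[OF that(1)] that(2) M(1) by (simp add: v_def)
  define J where "J = (\<lambda>n. {j \<in> I. v j \<le> v n})"
  define T where "T = (\<lambda>n j z. if j \<in> J n then of_real (v j) * (\<i> / (z - cnj (\<mu> j)) - \<i> / (\<mu> n - cnj (\<mu> j))) else 0)"
  define Sm where "Sm = (\<lambda>n z. \<Sum>j. T n j z)"
  \<comment> \<open>a summable majorant of the terms, up to a factor that is locally bounded in \<open>z\<close>\<close>
  define W where "W = (\<lambda>n j. if j \<in> J n then v j * v n / (norm (\<mu> n - cnj (\<mu> j)))\<^sup>2 else 0)"
  have W0: "W n j \<ge> 0" if "n \<in> I" for n j using v that by (auto simp: W_def J_def intro!: divide_nonneg_nonneg mult_nonneg_nonneg less_imp_le[OF v(2)])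
  have sumW_le: "(\<Sum>j\<in>S. W n j) \<le> C" if n: "n \<in> I" and S: "finite S" for n S
  proof -
    have "(\<Sum>j\<in>S. W n j) = (\<Sum>j\<in>S \<inter> J n. v j * v n / (norm (\<mu> n - cnj (\<mu> j)))\<^sup>2)"
      unfolding W_def using S by (simp add: sum.If_cases Int_def)
    also have "\<dots> \<le> C" unfolding v_def by (rule carl[OF n]) (use S in \<open>auto simp: J_def\<close>)
    finally show ?thesis .
  qed
  have sumW: "summable (W n)" if "n \<in> I" for n
    by (rule bounded_imp_summable[of _ C]) (use W0 sumW_le that in auto)
  have Tbd: "norm (T n j z) \<le> D * (1 + 2 * D / M) / v n * W n j"
    if n: "n \<in> I" and z: "Im z \<ge> - (M / 2)" and D: "norm (\<mu> n - z) \<le> D" for n j z D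
  proof (cases "j \<in> J n")
    case True
    then have j: "j \<in> I" by (simp add: J_def)
    have D0: "D \<ge> 0" using D norm_ge_zero order_trans by blast
    let ?a = "norm (z - cnj (\<mu> j))" and ?b = "norm (\<mu> n - cnj (\<mu> j))"
    have a: "?a \<ge> M / 2" by (rule lowM[OF j z])
    have b: "?b \<ge> M / 2" by (rule lowM[OF j]) (use v[OF n] M(1) in \<open>auto simp: v_def\<close>)
    have ab0: "z - cnj (\<mu> j) \<noteq> 0" "\<mu> n - cnj (\<mu> j) \<noteq> 0" using a b M(1) by auto
    have a0: "?a > 0" and b0: "?b > 0" using ab0 by auto
    have "D * 1 \<le> D * (2 * ?a / M)" using a M(1) D0 by (intro mult_left_mono) (auto simp: le_divide_eq)
    then have "?b \<le> ?a * (1 + 2 * D / M)"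
      using norm_triangle_ineq[of "\<mu> n - z" "z - cnj (\<mu> j)"] D by (simp add: algebra_simps)
    then have "1 / ?a \<le> (1 + 2 * D / M) / ?b" using a0 b0 by (simp add: field_simps)
    then have "(1 / ?a) * (D * v j / ?b) \<le> ((1 + 2 * D / M) / ?b) * (D * v j / ?b)"
      using D0 v[OF j] b0 by (intro mult_right_mono) auto
    have "T n j z = of_real (v j) * (\<i> * (\<mu> n - z) / ((z - cnj (\<mu> j)) * (\<mu> n - cnj (\<mu> j))))"
      using True ab0 by (simp add: T_def field_simps)
    then have "norm (T n j z) = v j * norm (\<mu> n - z) / (?a * ?b)"
      using v[OF j] by (simp add: norm_mult norm_divide)
    also have "\<dots> \<le> v j * D / (?a * ?b)"
      using v[OF j] D a0 b0 by (intro divide_right_mono mult_left_mono) auto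
    also have "\<dots> = (1 / ?a) * (D * v j / ?b)" by simp
    also have "\<dots> \<le> ((1 + 2 * D / M) / ?b) * (D * v j / ?b)" by fact
    also have "\<dots> = D * (1 + 2 * D / M) / v n * W n j" 
      using True v(2)[OF n] by (simp add: W_def power2_eq_square)
    finally show ?thesis .
  qed (auto simp: T_def W_def)
  have sumT: "summable (\<lambda>j. T n j z)" if n: "n \<in> I" and z: "Im z \<ge> - (M / 2)" for n z
    by (rule summable_comparison_test'[where N = 0, OF summable_mult[OF sumW[OF n]] Tbd[OF n z order_refl]])
  have holSm: "Sm n holomorphic_on {z. Im z > - (M / 2)}" if n: "n \<in> I" for n
  proof (rule holomorphic_uniform_sequence[where f = "\<lambda>k z. \<Sum>j<k. T n j z"])
    show op: "open {z. Im z > - (M / 2)}" by (rule open_halfspace_Im_gt)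
    show "(\<lambda>z. \<Sum>j<k. T n j z) holomorphic_on {z. Im z > - (M / 2)}" for k
    proof (intro holomorphic_on_sum)
      fix j show "T n j holomorphic_on {z. Im z > - (M / 2)}"
      proof (cases "j \<in> J n")
        case True
        have nz: "z - cnj (\<mu> j) \<noteq> 0" if "Im z > - (M / 2)" for z
          using lowM[of j z] True M(1) that by (auto simp: J_def)
        show ?thesis unfolding T_def using True nz by (simp) (intro holomorphic_intros; auto)
      qed (simp add: T_def)
    qed
    fix x assume x: "x \<in> {z. Im z > - (M / 2)}"
    then obtain d where d: "d > 0" "cball x d \<subseteq> {z. Im z > - (M / 2)}" using op open_contains_cball by blast
    define D where "D = norm (\<mu> n - x) + d"
    have "uniform_limit (cball x d) (\<lambda>k z. \<Sum>j<k. T n j z) (\<lambda>z. suminf (\<lambda>j. T n j z)) sequentially"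
    proof (rule Weierstrass_m_test)
      show "summable (\<lambda>j. D * (1 + 2 * D / M) / v n * W n j)" by (intro summable_mult sumW n)
      fix j z assume z: "z \<in> cball x d"
      have "norm (\<mu> n - z) \<le> D" using norm_triangle_ineq[of "\<mu> n - x" "x - z"] z by (simp add: D_def dist_norm)
      moreover have "Im z \<ge> - (M / 2)" using d z by (auto simp: subset_eq less_imp_le)
      ultimately show "norm (T n j z) \<le> D * (1 + 2 * D / M) / v n * W n j" using Tbd[OF n] by blast
    qed
    then show "\<exists>d>0. cball x d \<subseteq> {z. Im z > - (M / 2)} \<and> uniform_limit (cball x d) (\<lambda>k z. \<Sum>j<k. T n j z) (Sm n) sequentially"
      using d by (auto simp: Sm_def)
  qed
  have ReT: "Re (T n j z) \<ge> v j * (Im z + v j) / (norm (z - cnj (\<mu> j)))\<^sup>2 - 2 * W n j"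
    if n: "n \<in> I" and j: "j \<in> J n" for n j z
  proof -
    have jI: "j \<in> I" "v j \<le> v n" using j by (auto simp: J_def)
    have Re1: "Re (\<i> / (z - cnj (\<mu> j))) = (Im z + v j) / (norm (z - cnj (\<mu> j)))\<^sup>2" for z
      by (simp add: Re_divide cmod_power2 v_def)
    have Re_real_mult: "Re (of_real r * u) = r * Re u" for r u by simp
    have "Re (T n j z) = v j * ((Im z + v j) / (norm (z - cnj (\<mu> j)))\<^sup>2) - v j * ((v n + v j) / (norm (\<mu> n - cnj (\<mu> j)))\<^sup>2)"
      using Re_real_mult[of "v j" "\<i> / (z - cnj (\<mu> j)) - \<i> / (\<mu> n - cnj (\<mu> j))"] j
      unfolding T_def minus_complex.simps Re1 by (simp add: right_diff_distrib v_def)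
    moreover have "v j * ((v n + v j) / (norm (\<mu> n - cnj (\<mu> j)))\<^sup>2) \<le> v j * ((v n + v n) / (norm (\<mu> n - cnj (\<mu> j)))\<^sup>2)"
      using jI v(2)[OF jI(1)] by (intro mult_left_mono divide_right_mono) auto
    moreover have "v j * ((v n + v n) / (norm (\<mu> n - cnj (\<mu> j)))\<^sup>2) = 2 * W n j" using j by (simp add: W_def)
    ultimately show ?thesis by simp
  qed
  have ReSm: "Re (Sm n z) \<ge> (\<Sum>j\<in>S. v j * (Im z + v j) / (norm (z - cnj (\<mu> j)))\<^sup>2) - 2 * C"
    if n: "n \<in> I" and z: "Im z \<ge> 0" and S: "finite S" "S \<subseteq> J n" for n z S
  proof -
    let ?Y = "\<lambda>j. v j * (Im z + v j) / (norm (z - cnj (\<mu> j)))\<^sup>2"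
    have Y0: "?Y j \<ge> 0" if "j \<in> I" for j using z v(2)[OF that] by (intro divide_nonneg_nonneg mult_nonneg_nonneg) auto
    have "(\<lambda>k. \<Sum>j<k. T n j z) \<longlonglongrightarrow> Sm n z" unfolding Sm_def
      by (rule summable_LIMSEQ[OF sumT[OF n]]) (use z M(1) in simp)
    then have lim: "(\<lambda>k. Re (\<Sum>j<k. T n j z)) \<longlonglongrightarrow> Re (Sm n z)" by (rule tendsto_Re)
    obtain N where N: "S \<subseteq> {..<N}" using S(1) finite_nat_iff_bounded by blast
    show ?thesis
    proof (rule tendsto_lowerbound[OF lim])
      show "\<forall>\<^sub>F k in sequentially. (\<Sum>j\<in>S. ?Y j) - 2 * C \<le> Re (\<Sum>j<k. T n j z)"
        using eventually_ge_at_top[of N]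
      proof eventually_elim
        case (elim k)
        have "(\<Sum>j\<in>S. ?Y j) \<le> (\<Sum>j\<in>{..<k} \<inter> J n. ?Y j)"
          by (rule sum_mono2) (use N S elim Y0 in \<open>auto simp: J_def\<close>)
        moreover have "(\<Sum>j\<in>{..<k} \<inter> J n. W n j) \<le> C" by (rule sumW_le[OF n]) auto
        ultimately have "(\<Sum>j\<in>S. ?Y j) - 2 * C \<le> (\<Sum>j\<in>{..<k} \<inter> J n. ?Y j - 2 * W n j)"
          by (simp add: sum_subtractf sum_distrib_left[symmetric])
        also have "\<dots> \<le> (\<Sum>j\<in>{..<k} \<inter> J n. Re (T n j z))" by (intro sum_mono ReT[OF n]) auto
        also have "\<dots> = (\<Sum>j<k. Re (T n j z))" by (rule sum.mono_neutral_left) (auto simp: T_def)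
        finally show ?case by simp
      qed
    qed simp
  qed
  \<comment> \<open>the constant \<open>2 C\<close> lost in the real part then costs a factor of at most \<open>e\<close>\<close>
  define \<kappa> where "\<kappa> = 1 / (2 * C)"
  have \<kappa>: "\<kappa> > 0" using C by (simp add: \<kappa>_def)
  define G where "G = (\<lambda>n z. (2 * \<i> * of_real (v n) / (z - cnj (\<mu> n)))\<^sup>2 * exp (- (of_real \<kappa> * Sm n z)))"
  have nG: "norm (G n z) \<le> 4 * (v n)\<^sup>2 / (norm (z - cnj (\<mu> n)))\<^sup>2 * (exp 1 * exp (- (\<kappa> * (\<Sum>j\<in>S. v j * (Im z + v j) / (norm (z - cnj (\<mu> j)))\<^sup>2))))"
    if n: "n \<in> I" and z: "Im z \<ge> 0" and S: "finite S" "S \<subseteq> J n" for n z S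
  proof -
    have "norm (G n z) = 4 * (v n)\<^sup>2 / (norm (z - cnj (\<mu> n)))\<^sup>2 * exp (- (\<kappa> * Re (Sm n z)))"
      by (simp add: G_def norm_mult norm_power norm_divide power_divide power_mult_distrib)
    also have "\<dots> \<le> 4 * (v n)\<^sup>2 / (norm (z - cnj (\<mu> n)))\<^sup>2 * exp (1 + - (\<kappa> * (\<Sum>j\<in>S. v j * (Im z + v j) / (norm (z - cnj (\<mu> j)))\<^sup>2)))"
    proof (intro mult_left_mono)
      have "\<kappa> * ((\<Sum>j\<in>S. v j * (Im z + v j) / (norm (z - cnj (\<mu> j)))\<^sup>2) - 2 * C) \<le> \<kappa> * Re (Sm n z)"
        using ReSm[OF that] \<kappa> by (intro mult_left_mono) auto
      moreover have "\<kappa> * (2 * C) = 1" using C by (simp add: \<kappa>_def)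
      ultimately show "exp (- (\<kappa> * Re (Sm n z))) \<le> exp (1 + - (\<kappa> * (\<Sum>j\<in>S. v j * (Im z + v j) / (norm (z - cnj (\<mu> j)))\<^sup>2)))"
        by (simp add: right_diff_distrib)
    qed auto
    finally show ?thesis unfolding exp_add .
  qed
  show thesis
  proof (rule that[of G])
    show "G n holomorphic_on {z. Im z > - (M / 2)}" if n: "n \<in> I" for n
    proof -
      have nz: "z - cnj (\<mu> n) \<noteq> 0" if "Im z > - (M / 2)" for z
        using lowM[of n z] n M(1) that by auto
      show ?thesis unfolding G_def by (intro holomorphic_intros holSm n) (use nz in auto)
    qed
    show "G n (\<mu> n) = 1" if n: "n \<in> I" for n
    proof -
      have "\<mu> n - cnj (\<mu> n) = 2 * \<i> * of_real (v n)" by (simp add: complex_eq_iff v_def)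
      moreover have "(\<lambda>j. T n j (\<mu> n)) = (\<lambda>j. 0)" by (auto simp: T_def)
      then have "Sm n (\<mu> n) = 0" unfolding Sm_def by simp
      ultimately show ?thesis using v(2)[OF n] by (simp add: G_def)
    qed
    show "norm (G n z) \<le> 4 * exp 1" if n: "n \<in> I" and z: "Im z \<ge> 0" for n z
    proof -
      have "v n \<le> norm (z - cnj (\<mu> n))" using abs_Im_le_cmod[of "z - cnj (\<mu> n)"] z v(2)[OF n] by (simp add: v_def)
      then have "(v n)\<^sup>2 \<le> (norm (z - cnj (\<mu> n)))\<^sup>2" using v(2)[OF n] by (intro power_mono) auto
      then have "4 * (v n)\<^sup>2 / (norm (z - cnj (\<mu> n)))\<^sup>2 \<le> 4" by (auto simp: divide_le_eq)
      then have "4 * (v n)\<^sup>2 / (norm (z - cnj (\<mu> n)))\<^sup>2 * exp 1 \<le> 4 * exp 1" by (intro mult_right_mono) auto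
      then show ?thesis using nG[OF n z, of "{}"] by simp
    qed
    show "(\<Sum>n\<in>S. norm (G n (of_real t))) \<le> 8 * exp 1 * C" if S: "finite S" "S \<subseteq> I" for S and t :: real
    proof -
      define x where "x = (\<lambda>j. \<kappa> * ((v j)\<^sup>2 / (norm (of_real t - cnj (\<mu> j)))\<^sup>2))"
      have "(\<Sum>n\<in>S. norm (G n (of_real t))) \<le> (\<Sum>n\<in>S. 4 * exp 1 / \<kappa> * (x n * exp (- (\<Sum>j | j \<in> S \<and> v j \<le> v n. x j))))"
      proof (rule sum_mono)
        fix n assume n: "n \<in> S"
        have "norm (G n (of_real t)) \<le> 4 * (v n)\<^sup>2 / (norm (of_real t - cnj (\<mu> n)))\<^sup>2 * (exp 1 * exp (- (\<Sum>j | j \<in> S \<and> v j \<le> v n. x j)))"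
          using nG[of n "of_real t" "{j. j \<in> S \<and> v j \<le> v n}"] n S
          by (auto simp: J_def x_def power2_eq_square sum_distrib_left)
        also have "\<dots> = 4 * exp 1 / \<kappa> * (x n * exp (- (\<Sum>j | j \<in> S \<and> v j \<le> v n. x j)))"
          using \<kappa> by (simp add: x_def mult_ac)
        finally show "norm (G n (of_real t)) \<le> 4 * exp 1 / \<kappa> * (x n * exp (- (\<Sum>j | j \<in> S \<and> v j \<le> v n. x j)))" .
      qed
      also have "\<dots> = 4 * exp 1 / \<kappa> * (\<Sum>n\<in>S. x n * exp (- (\<Sum>j | j \<in> S \<and> v j \<le> v n. x j)))"
        by (simp add: sum_distrib_left)
      also have "\<dots> \<le> 4 * exp 1 / \<kappa> * (1 - exp (- (\<Sum>j\<in>S. x j)))"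
        using \<kappa> by (intro mult_left_mono sum_ordered_exp_le S(1)) (auto simp: x_def)
      also have "\<dots> \<le> 4 * exp 1 / \<kappa> * 1" using \<kappa> by (intro mult_left_mono) auto
      also have "\<dots> = 8 * exp 1 * C" using C by (simp add: \<kappa>_def)
      finally show ?thesis .
    qed
  qed
qed

section \<open>Smoothing by the Fejer kernel\<close>

text \<open>
  The entire function \<open>sin (s w) / w\<close>, whose normalised square is a Fejer kernel with frequencies in
  \<open>[- 2 s, 2 s]\<close>.
\<close>
definition fejer_root :: "real \<Rightarrow> complex \<Rightarrow> complex" where
  "fejer_root s w = (if w = 0 then of_real s else sin (of_real s * w) / w)"

definition fejer :: "real \<Rightarrow> complex \<Rightarrow> complex" where
  "fejer s w = (fejer_root s w)\<^sup>2 / of_real (pi * s)"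

lemma holomorphic_fejer_root: "fejer_root s holomorphic_on UNIV"
proof -
  let ?f = "\<lambda>w. sin (of_real s * w) :: complex"
  have "deriv ?f 0 = of_real s" by (rule DERIV_imp_deriv) (auto intro!: derivative_eq_intros)
  moreover have "(\<lambda>z. if z = 0 then deriv ?f 0 else (?f z - ?f 0) / (z - 0)) holomorphic_on UNIV"
    by (rule pole_lemma) (auto intro!: holomorphic_intros)
  moreover from calculation(1) have "(\<lambda>z. if z = 0 then deriv ?f 0 else (?f z - ?f 0) / (z - 0)) = fejer_root s"
    by (auto simp: fun_eq_iff fejer_root_def)
  ultimately show ?thesis by simp
qed

lemma holomorphic_fejer: "fejer s holomorphic_on UNIV"
proof (cases "s = 0")
  case True then show ?thesis by (simp add: fejer_def[abs_def])
next
  case False then show ?thesis unfolding fejer_def[abs_def] by (intro holomorphic_intros holomorphic_fejer_root) auto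
qed

lemma norm_sin_le_exp: "norm (sin w) \<le> exp \<bar>Im w\<bar>" for w :: complex
proof -
  have "norm (sin w) = norm (exp (\<i> * w) - exp (- (\<i> * w))) / 2" by (simp add: sin_exp_eq norm_divide norm_mult)
  also have "\<dots> \<le> (norm (exp (\<i> * w)) + norm (exp (- (\<i> * w)))) / 2"
    by (intro divide_right_mono norm_triangle_ineq4) auto
  also have "\<dots> = (exp (- Im w) + exp (Im w)) / 2" by simp
  also have "\<dots> \<le> (exp \<bar>Im w\<bar> + exp \<bar>Im w\<bar>) / 2" by (intro divide_right_mono add_mono) auto
  finally show ?thesis by simp
qed

lemma fejer_decay:
  assumes "s > 0"
  obtains c where "c > 0" "\<And>w. norm (fejer s w) \<le> c * exp (2 * s * \<bar>Im w\<bar>) / (1 + (Re w)\<^sup>2)"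
proof -
  have "continuous_on (cball 0 1) (fejer_root s)"
    by (rule holomorphic_on_imp_continuous_on[OF holomorphic_on_subset[OF holomorphic_fejer_root]]) simp
  then have "bounded (fejer_root s ` cball 0 1)" by (intro compact_imp_bounded compact_continuous_image) auto
  then obtain c0 where c0: "\<And>w. norm w \<le> 1 \<Longrightarrow> norm (fejer_root s w) \<le> c0"
    unfolding bounded_iff by (metis imageI mem_cball_0)
  define c1 where "c1 = max 1 c0"
  have sq: "(norm (fejer_root s w))\<^sup>2 * (1 + (Re w)\<^sup>2) \<le> 2 * c1\<^sup>2 * exp (2 * s * \<bar>Im w\<bar>)" for w
  proof (cases "norm w \<le> 1")
    case True
    have "(norm (fejer_root s w))\<^sup>2 \<le> c1\<^sup>2" using c0[OF True] by (intro power_mono) (auto simp: c1_def)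
    moreover have "1 + (Re w)\<^sup>2 \<le> 2 * exp (2 * s * \<bar>Im w\<bar>)"
    proof -
      have "\<bar>Re w\<bar> \<le> 1" using abs_Re_le_cmod[of w] True by linarith
      then have "(Re w)\<^sup>2 \<le> 1" using abs_le_square_iff[of "Re w" 1] by simp
      moreover have "1 \<le> exp (2 * s * \<bar>Im w\<bar>)" using assms by simp
      ultimately show ?thesis by linarith
    qed
    ultimately have "(norm (fejer_root s w))\<^sup>2 * (1 + (Re w)\<^sup>2) \<le> c1\<^sup>2 * (2 * exp (2 * s * \<bar>Im w\<bar>))"
      by (intro mult_mono) auto
    then show ?thesis by (simp add: mult_ac)
  next
    case False
    have "w \<noteq> 0" using False by auto
    have "norm (sin (of_real s * w)) \<le> exp (s * \<bar>Im w\<bar>)"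
      using norm_sin_le_exp[of "of_real s * w"] assms by (simp add: abs_mult)
    then have "(norm (sin (of_real s * w)))\<^sup>2 \<le> (exp (s * \<bar>Im w\<bar>))\<^sup>2" by (intro power_mono) auto
    also have "\<dots> = exp (2 * s * \<bar>Im w\<bar>)" by (simp add: exp_double[symmetric] mult.assoc)
    finally have sin_le: "(norm (sin (of_real s * w)))\<^sup>2 \<le> exp (2 * s * \<bar>Im w\<bar>)" .
    have n1: "1 \<le> (norm w)\<^sup>2" using False by (simp add: one_le_power)
    have "(Re w)\<^sup>2 \<le> (norm w)\<^sup>2" by (simp add: cmod_power2)
    then have r: "1 + (Re w)\<^sup>2 \<le> 2 * (norm w)\<^sup>2" using n1 by linarith
    have "(norm (fejer_root s w))\<^sup>2 * (1 + (Re w)\<^sup>2) = (norm (sin (of_real s * w)))\<^sup>2 * ((1 + (Re w)\<^sup>2) / (norm w)\<^sup>2)"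
      using \<open>w \<noteq> 0\<close> by (simp add: fejer_root_def norm_divide power_divide)
    also have "\<dots> \<le> exp (2 * s * \<bar>Im w\<bar>) * 2"
      using sin_le r n1 by (intro mult_mono) (auto simp: divide_le_eq)
    also have "\<dots> \<le> 2 * c1\<^sup>2 * exp (2 * s * \<bar>Im w\<bar>)"
      using one_le_power[of c1 2] by (simp add: c1_def)
    finally show ?thesis .
  qed
  show thesis
  proof (rule that[of "2 * c1\<^sup>2 / (pi * s)"])
    show "2 * c1\<^sup>2 / (pi * s) > 0" using assms by (auto simp: c1_def)
    fix w
    have pos: "1 + (Re w)\<^sup>2 > 0" by (intro add_pos_nonneg) auto
    have "norm (fejer s w) = (norm (fejer_root s w))\<^sup>2 / (pi * s)"
      using assms by (simp add: fejer_def norm_divide norm_power norm_mult)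
    also have "(norm (fejer_root s w))\<^sup>2 \<le> 2 * c1\<^sup>2 * exp (2 * s * \<bar>Im w\<bar>) / (1 + (Re w)\<^sup>2)"
      using sq[of w] pos by (subst pos_le_divide_eq) auto
    then have "(norm (fejer_root s w))\<^sup>2 / (pi * s) \<le> 2 * c1\<^sup>2 * exp (2 * s * \<bar>Im w\<bar>) / (1 + (Re w)\<^sup>2) / (pi * s)"
      using assms by (intro divide_right_mono) auto
    finally show "norm (fejer s w) \<le> 2 * c1\<^sup>2 / (pi * s) * exp (2 * s * \<bar>Im w\<bar>) / (1 + (Re w)\<^sup>2)"
      by (simp add: mult_ac)
  qed
qed

text \<open>
  This makes the decay of translated kernels locally uniform in the translation \<open>x\<close>.
\<close>
lemma translate_weight_le: "1 / (1 + (x - t)\<^sup>2) \<le> 2 * (1 + x\<^sup>2) / (1 + t\<^sup>2)" for x t :: real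
proof -
  have "0 \<le> (2 * x - t)\<^sup>2 + 2 * (x\<^sup>2 * (x - t)\<^sup>2)" by simp
  then have "1 + t\<^sup>2 \<le> 2 * (1 + x\<^sup>2) * (1 + (x - t)\<^sup>2)" by (simp add: power2_eq_square algebra_simps)
  moreover have "1 + t\<^sup>2 > 0" "1 + (x - t)\<^sup>2 > 0" by (intro add_pos_nonneg; simp)+
  moreover have "1 / b \<le> c / a" if "a \<le> c * b" "a > 0" "b > 0" for a b c :: real
    using that by (simp add: field_simps)
  ultimately show ?thesis by blast
qed

definition fejer_conv :: "real \<Rightarrow> (real \<Rightarrow> complex) \<Rightarrow> complex \<Rightarrow> complex" where
  "fejer_conv s g z = (LINT t|lborel. g t * fejer s (z - of_real t))"

lemma continuous_fejer_conv_integrand: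
  assumes "continuous_on UNIV g" shows "continuous_on A (\<lambda>t. g t * fejer s (z - of_real t))"
proof (intro continuous_on_mult)
  show "continuous_on A g" by (rule continuous_on_subset[OF assms]) simp
  show "continuous_on A (\<lambda>t. fejer s (z - of_real t))"
    by (rule continuous_on_compose2[OF holomorphic_on_imp_continuous_on[OF holomorphic_fejer]])
      (auto intro!: continuous_intros)
qed

lemma fejer_conv_integrand_bound:
  assumes "s > 0"
  obtains c where "c > 0" "\<And>g B z t. (\<And>t. norm (g t) \<le> B) \<Longrightarrow> 
      norm (g t * fejer s (z - of_real t)) \<le> B * c * exp (2 * s * \<bar>Im z\<bar>) * (1 + (Re z)\<^sup>2) / (1 + t\<^sup>2)"
proof -
  obtain c where c: "c > 0" "\<And>w. norm (fejer s w) \<le> c * exp (2 * s * \<bar>Im w\<bar>) / (1 + (Re w)\<^sup>2)"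
    using fejer_decay[OF assms] by blast
  show thesis
  proof (rule that[of "2 * c"])
    have regroup: "B * (c * E * (2 * R / T)) = B * (2 * c) * E * R / T" for B E R T :: real by simp
    fix g :: "real \<Rightarrow> complex" and B z t assume g: "\<And>t. norm (g t) \<le> B"
    have "norm (fejer s (z - of_real t)) \<le> c * exp (2 * s * \<bar>Im z\<bar>) * (1 / (1 + (Re z - t)\<^sup>2))"
      using c(2)[of "z - of_real t"] by simp
    also have "\<dots> \<le> c * exp (2 * s * \<bar>Im z\<bar>) * (2 * (1 + (Re z)\<^sup>2) / (1 + t\<^sup>2))"
      using c(1) by (intro mult_left_mono translate_weight_le) auto
    finally have fejer_le: "norm (fejer s (z - of_real t)) \<le> c * exp (2 * s * \<bar>Im z\<bar>) * (2 * (1 + (Re z)\<^sup>2) / (1 + t\<^sup>2))" .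
    have "norm (g t) * norm (fejer s (z - of_real t)) \<le> B * (c * exp (2 * s * \<bar>Im z\<bar>) * (2 * (1 + (Re z)\<^sup>2) / (1 + t\<^sup>2)))"
      by (rule mult_mono[OF g fejer_le]) (use order_trans[OF norm_ge_zero g[of t]] in simp_all)
    also have "\<dots> = B * (2 * c) * exp (2 * s * \<bar>Im z\<bar>) * (1 + (Re z)\<^sup>2) / (1 + t\<^sup>2)"
      by (rule regroup)
    finally show "norm (g t * fejer s (z - of_real t)) \<le> B * (2 * c) * exp (2 * s * \<bar>Im z\<bar>) * (1 + (Re z)\<^sup>2) / (1 + t\<^sup>2)"
      by (simp only: norm_mult)
  qed (use c(1) in auto)
qed

lemma integrable_fejer_conv:
  assumes "s > 0" "continuous_on UNIV g" "\<And>t. norm (g t) \<le> B"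
  shows "integrable lborel (\<lambda>t. g t * fejer s (z - of_real t))"
proof -
  obtain c where c: "c > 0" "\<And>g B z t. (\<And>t. norm (g t) \<le> B) \<Longrightarrow> 
      norm (g t * fejer s (z - of_real t)) \<le> B * c * exp (2 * s * \<bar>Im z\<bar>) * (1 + (Re z)\<^sup>2) / (1 + t\<^sup>2)"
    using fejer_conv_integrand_bound[OF assms(1)] by blast
  show ?thesis
    by (rule integrable_inverse_square_decay[OF continuous_fejer_conv_integrand[OF assms(2)]])
      (rule c(2)[of g B, OF assms(3)])
qed

text \<open>
  The truncated integrals over \<open>[-N, N]\<close> are holomorphic by differentiation under the integral sign, and the tails are
  locally uniformly small.
\<close>
lemma holomorphic_fejer_conv:
  assumes s: "s > 0" and cont: "continuous_on UNIV g" and B: "\<And>t. norm (g t) \<le> B"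
  shows "fejer_conv s g holomorphic_on UNIV"
proof (rule holomorphic_uniform_sequence)
  let ?f = "\<lambda>z t. g t * fejer s (z - of_real t)"
  let ?K = "\<lambda>N::nat. \<lambda>z. integral (cbox (- real N) (real N)) (?f z)"
  show "open (UNIV :: complex set)" by simp
  show "?K N holomorphic_on UNIV" for N
  proof (rule leibniz_rule_holomorphic[where fx = "\<lambda>z t. g t * deriv (fejer s) (z - of_real t)"])
    fix z t
    have "(fejer s has_field_derivative deriv (fejer s) (z - of_real t)) (at (z - of_real t))"
      using holomorphic_derivI[OF holomorphic_fejer open_UNIV] by auto
    moreover have "((\<lambda>z. z - of_real t) has_field_derivative 1) (at z)"
      by (auto intro!: derivative_eq_intros)
    ultimately have "((\<lambda>z. fejer s (z - of_real t)) has_field_derivative deriv (fejer s) (z - of_real t) * 1) (at z)"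
      by (rule DERIV_chain2)
    then have "((\<lambda>z. fejer s (z - of_real t)) has_field_derivative deriv (fejer s) (z - of_real t)) (at z)"
      by (simp only: mult_1_right)
    then show "((\<lambda>z. ?f z t) has_field_derivative g t * deriv (fejer s) (z - of_real t)) (at z within UNIV)"
      by (intro DERIV_cmult)
  next
    fix z show "?f z integrable_on cbox (- real N) (real N)"
      by (intro integrable_continuous continuous_fejer_conv_integrand cont)
  next
    have d: "continuous_on UNIV (deriv (fejer s))"
      by (rule holomorphic_on_imp_continuous_on[OF holomorphic_deriv[OF holomorphic_fejer]]) auto
    show "continuous_on (UNIV \<times> cbox (- real N) (real N)) (\<lambda>(z, t). g t * deriv (fejer s) (z - of_real t))"
      unfolding split_def by (intro continuous_intros continuous_on_compose2[OF cont] continuous_on_compose2[OF d]) auto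
  qed auto
  fix z0 :: complex
  obtain c where c: "c > 0" "\<And>g B z t. (\<And>t. norm (g t) \<le> B) \<Longrightarrow> 
      norm (g t * fejer s (z - of_real t)) \<le> B * c * exp (2 * s * \<bar>Im z\<bar>) * (1 + (Re z)\<^sup>2) / (1 + t\<^sup>2)"
    using fejer_conv_integrand_bound[OF s] by blast
  have B0: "B \<ge> 0" using order_trans[OF norm_ge_zero B[of 0]] .
  define D where "D = B * c * exp (2 * s * (norm z0 + 1)) * (1 + (norm z0 + 1)\<^sup>2)"
  have D0: "D \<ge> 0" using B0 c(1) by (simp add: D_def)
  have bd: "norm (?f z t) \<le> D * (1 / (1 + t\<^sup>2))" if z: "z \<in> cball z0 1" for z t
  proof -
    have nz: "norm z \<le> norm z0 + 1" using norm_triangle_ineq2[of z z0] z by (simp add: dist_norm norm_minus_commute)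
    have im: "\<bar>Im z\<bar> \<le> norm z0 + 1" and re: "\<bar>Re z\<bar> \<le> norm z0 + 1"
      using abs_Im_le_cmod[of z] abs_Re_le_cmod[of z] nz by linarith+
    have "norm (?f z t) \<le> B * c * exp (2 * s * \<bar>Im z\<bar>) * (1 + (Re z)\<^sup>2) / (1 + t\<^sup>2)" by (rule c(2)[of g B, OF B])
    also have "\<dots> \<le> D / (1 + t\<^sup>2)" unfolding D_def
    proof (intro divide_right_mono mult_mono)
      show "1 + (Re z)\<^sup>2 \<le> 1 + (norm z0 + 1)\<^sup>2" using re abs_le_square_iff[of "Re z" "norm z0 + 1"] by simp
    qed (use im B0 c(1) s in auto)
    finally show ?thesis by simp
  qed
  define \<rho> where "\<rho> = (\<lambda>N::nat. LINT t|lborel. indicator (- {- real N..real N}) t *\<^sub>R (1 / (1 + t\<^sup>2)))"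
  have \<rho>: "\<rho> \<longlonglongrightarrow> 0"
  proof -
    have "(\<lambda>N. \<rho> N) \<longlonglongrightarrow> (LINT t::real|lborel. (0::real))" unfolding \<rho>_def
    proof (rule integral_dominated_convergence[where w = "\<lambda>t::real. 1 / (1 + t\<^sup>2)"])
      show "AE t in lborel. (\<lambda>N. indicator (- {- real N..real N}) t *\<^sub>R (1 / (1 + t\<^sup>2))) \<longlonglongrightarrow> 0"
      proof (rule AE_I2, rule tendsto_eventually)
        fix t :: real
        obtain N0 :: nat where N0: "\<bar>t\<bar> \<le> real N0" using real_arch_simple by blast
        show "\<forall>\<^sub>F N in sequentially. indicator (- {- real N..real N}) t *\<^sub>R (1 / (1 + t\<^sup>2)) = 0"
          using eventually_ge_at_top[of N0] 
        proof eventually_elim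
          case (elim N)
          then have "\<bar>t\<bar> \<le> real N" using N0 of_nat_mono[OF elim, where 'a = real] by linarith
          then show ?case by (auto simp: indicator_def)
        qed
      qed
    qed (auto simp: integrable_inverse_1_plus_sq indicator_def)
    then show ?thesis by simp
  qed
  have "uniform_limit (cball z0 1) ?K (fejer_conv s g) sequentially"
  proof (rule uniform_limitI)
    fix e :: real assume e: "e > 0"
    have "(\<lambda>N. D * \<rho> N) \<longlonglongrightarrow> D * 0" by (intro tendsto_intros \<rho>)
    then have "\<forall>\<^sub>F N in sequentially. D * \<rho> N < e" using e by (intro order_tendstoD) auto
    then show "\<forall>\<^sub>F N in sequentially. \<forall>z\<in>cball z0 1. dist (?K N z) (fejer_conv s g z) < e"
    proof eventually_elim
      case (elim N)
      show ?case
      proof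
        fix z assume z: "z \<in> cball z0 1"
        have int: "integrable lborel (?f z)" by (rule integrable_fejer_conv[OF s cont B])
        have "set_integrable lborel {- real N..real N} (?f z)"
          by (rule borel_integrable_atLeastAtMost') (rule continuous_fejer_conv_integrand[OF cont])
        note K = set_borel_integral_eq_integral[OF this]
        have "fejer_conv s g z - ?K N z = (LINT t|lborel. ?f z t) - (LINT t|lborel. indicator {- real N..real N} t *\<^sub>R ?f z t)"
          using K(2) by (simp add: fejer_conv_def set_lebesgue_integral_def)
        also have "\<dots> = (LINT t|lborel. ?f z t - indicator {- real N..real N} t *\<^sub>R ?f z t)"
          using \<open>set_integrable lborel {- real N..real N} (?f z)\<close>
          by (intro Bochner_Integration.integral_diff[symmetric] int) (simp add: set_integrable_def)
        also have "norm \<dots> \<le> (LINT t|lborel. D * (indicator (- {- real N..real N}) t *\<^sub>R (1 / (1 + t\<^sup>2))))"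
        proof (rule Bochner_Integration.integral_norm_bound_integral)
          show "integrable lborel (\<lambda>t. ?f z t - indicator {- real N..real N} t *\<^sub>R ?f z t)"
            using \<open>set_integrable lborel {- real N..real N} (?f z)\<close>
            by (intro Bochner_Integration.integrable_diff int) (simp add: set_integrable_def)
          show "integrable lborel (\<lambda>t. D * (indicator (- {- real N..real N}) t *\<^sub>R (1 / (1 + t\<^sup>2))))"
            by (intro integrable_mult_right integrable_mult_indicator integrable_inverse_1_plus_sq) auto
          fix t :: real
          show "norm (?f z t - indicator {- real N..real N} t *\<^sub>R ?f z t) \<le> D * (indicator (- {- real N..real N}) t *\<^sub>R (1 / (1 + t\<^sup>2)))"
            using bd[OF z, of t] by (auto simp: indicator_def)
        qed
        also have "\<dots> = D * \<rho> N" unfolding \<rho>_def by (rule integral_mult_right_zero)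
        also have "\<dots> < e" by (rule elim)
        finally show "dist (?K N z) (fejer_conv s g z) < e" by (simp add: dist_norm norm_minus_commute)
      qed
    qed
  qed
  then show "\<exists>d>0. cball z0 d \<subseteq> UNIV \<and> uniform_limit (cball z0 d) ?K (fejer_conv s g) sequentially"
    by (intro exI[of _ 1]) auto
qed

lemma minus_add_diff_eq: "- (a + b - c) = c - a - b" for a b c :: "'a :: ab_group_add"
  by simp

text \<open>
  For \<open>Im z > 0\<close> the kernel splits as
  \<open>(1 - exp (2 \<i> s (t - z))) / (4 \<pi> s (t - z)\<^sup>2) + (1 - exp (2 \<i> s (z - t))) / (4 \<pi> s (t - z)\<^sup>2)\<close>.
  The first part continues analytically in \<open>t\<close> to the upper half-plane with a simple pole at \<open>z\<close>, so against \<open>G\<close> it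
  reproduces \<open>G(z)\<close> by Cauchy's formula. The numerator of the second part is at most \<open>2\<close> for real \<open>t\<close>, so this part is
  dominated by the Poisson kernel.
\<close>
lemma fejer_conv_upper:
  fixes G :: "complex \<Rightarrow> complex"
  assumes s: "s > 0" and hol: "G holomorphic_on {z. Im z > - a}" and a: "a > 0"
    and bdd: "\<And>z. Im z \<ge> 0 \<Longrightarrow> norm (G z) \<le> B" and z: "Im z > 0"
  shows "norm (fejer_conv s (\<lambda>t. G (of_real t)) z - G z)
     \<le> 1 / (2 * s * Im z) * (LINT t|lborel. poisson z t * norm (G (of_real t)))"
proof -
  define e where "e = (\<lambda>u. exp (2 * \<i> * of_real s * (u - z)))"
  define S where "S = (\<lambda>u. if u = z then - (2 * \<i> * of_real s) else (1 - e u) / (u - z))"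
  \<comment> \<open>\<open>S\<close> has its singularity at \<open>z\<close> removed; the simple pole needed for Cauchy's formula is supplied separately\<close>
  define F where "F = (\<lambda>u. G u * S u)"
  have holS: "S holomorphic_on A" for A
  proof -
    let ?f = "\<lambda>u. - e u"
    have "deriv ?f z = - (2 * \<i> * of_real s)"
      unfolding e_def by (rule DERIV_imp_deriv) (auto intro!: derivative_eq_intros)
    moreover have "(\<lambda>u. if u = z then deriv ?f z else (?f u - ?f z) / (u - z)) holomorphic_on UNIV"
      unfolding e_def by (rule pole_lemma) (auto intro!: holomorphic_intros)
    moreover from calculation(1) have "(\<lambda>u. if u = z then deriv ?f z else (?f u - ?f z) / (u - z)) = S"
      by (auto simp: fun_eq_iff S_def e_def)
    ultimately have "S holomorphic_on UNIV" by simp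
    then show ?thesis by (rule holomorphic_on_subset) simp
  qed
  have holF: "F holomorphic_on {u. Im u > - a}" unfolding F_def by (intro holomorphic_intros hol holS)
  have B0: "B \<ge> 0" using order_trans[OF norm_ge_zero bdd[of 0]] by simp
  define E where "E = 1 + exp (2 * s * Im z)"
  have E: "norm (1 - e u) \<le> E" if "Im u \<ge> 0" for u
  proof -
    have "norm (e u) = exp (2 * s * Im z - 2 * s * Im u)" by (simp add: e_def algebra_simps)
    also have "\<dots> \<le> exp (2 * s * Im z)" using that s by simp
    finally show ?thesis using norm_triangle_ineq4[of 1 "e u"] by (simp add: E_def)
  qed
  define R where "R = 2 * norm z + 1"
  have R1: "R \<ge> 1" by (simp add: R_def)
  have "compact (cball 0 R \<inter> {u. Im u \<ge> 0})" by (intro compact_Int_closed compact_cball closed_halfspace_Im_ge)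
  moreover have "continuous_on (cball 0 R \<inter> {u. Im u \<ge> 0}) F"
    by (rule holomorphic_on_imp_continuous_on[OF holomorphic_on_subset[OF holF]]) (use a in auto)
  ultimately have "bounded (F ` (cball 0 R \<inter> {u. Im u \<ge> 0}))"
    by (intro compact_imp_bounded compact_continuous_image)
  then obtain C1 where C1: "\<And>u. norm u \<le> R \<Longrightarrow> Im u \<ge> 0 \<Longrightarrow> norm (F u) \<le> C1"
    unfolding bounded_iff by (metis (no_types, lifting) IntI imageI mem_Collect_eq mem_cball_0)
  have C10: "C1 \<ge> 0" using order_trans[OF norm_ge_zero C1[of 0]] R1 by simp
  define C where "C = C1 * (1 + R) + 4 * (B * E)"
  have E0: "E \<ge> 0" by (simp add: E_def)
  have decay: "norm (F u) \<le> C / (1 + norm u)" if u: "Im u \<ge> 0" for u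
  proof -
    have "norm (F u) * (1 + norm u) \<le> C"
    proof (cases "norm u \<le> R")
      case True
      then have "norm (F u) * (1 + norm u) \<le> C1 * (1 + R)"
        using C1[OF True u] C10 by (intro mult_mono) auto
      also have "\<dots> \<le> C" using B0 E0 by (simp add: C_def)
      finally show ?thesis .
    next
      case False
      have 1: "norm (u - z) \<ge> norm u - norm z" by (rule norm_triangle_ineq2)
      then have 2: "4 * norm (u - z) \<ge> 1 + norm u" using False norm_ge_zero[of z] unfolding R_def by linarith
      then have 3: "norm (u - z) > 0" using norm_ge_zero[of u] by linarith
      have "norm (F u) = norm (G u) * norm (1 - e u) / norm (u - z)"
        using 3 by (auto simp: F_def S_def norm_mult norm_divide)
      also have "\<dots> \<le> B * E / norm (u - z)"
        using bdd[OF u] E[OF u] B0 3 by (intro divide_right_mono mult_mono) auto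
      finally have "norm (F u) * (1 + norm u) \<le> B * E / norm (u - z) * (4 * norm (u - z))"
        using 2 B0 E0 by (intro mult_mono) auto
      also have "\<dots> = 4 * (B * E)" using 3 by simp
      also have "\<dots> \<le> C" using C10 R1 by (simp add: C_def)
      finally show ?thesis .
    qed
    then show ?thesis by (subst pos_le_divide_eq) (auto intro: add_pos_nonneg)
  qed
  have cauchy: "integrable lborel (\<lambda>t::real. F (of_real t) / (of_real t - z))"
     "(LINT t|lborel. F (of_real t) / (of_real t - z)) = 2 * pi * \<i> * F z"
    by (rule cauchy_half_plane[OF holF a z decay]; assumption)+
  have Fz: "2 * pi * \<i> * F z = of_real (4 * pi * s) * G z" by (simp add: F_def S_def)
  have tz: "of_real t - z \<noteq> 0" "z - of_real t \<noteq> 0" for t using z by (auto simp: complex_eq_iff)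
  let ?g = "\<lambda>t. G (of_real t) * fejer s (z - of_real t)"
  let ?r = "\<lambda>t. G (of_real t) * (1 - exp (2 * \<i> * of_real s * (z - of_real t))) / (of_real (4 * pi * s) * (of_real t - z)\<^sup>2)"
  have split: "?g t = (F (of_real t) / (of_real t - z)) / of_real (4 * pi * s) + ?r t" for t
  proof -
    define d where "d = of_real t - z"
    have d: "d \<noteq> 0" "z - of_real t = - d" using tz by (auto simp: d_def)
    \<comment> \<open>in terms of \<open>q\<close> the identity is purely algebraic\<close>
    define q where "q = exp (\<i> * of_real s * d)"
    have q: "q \<noteq> 0" by (simp add: q_def)
    have q2': "exp (2 * \<i> * of_real s * d) = q\<^sup>2"
      unfolding q_def by (simp only: exp_double[symmetric] mult.assoc)
    have q2: "e (of_real t) = q\<^sup>2" unfolding e_def d_def[symmetric] by (rule q2')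
    have q3: "exp (2 * \<i> * of_real s * (z - of_real t)) = 1 / q\<^sup>2"
      unfolding d(2) by (simp only: mult_minus_right exp_minus q2' inverse_eq_divide)
    have q1: "exp (- (\<i> * of_real s * d)) = 1 / q"
      unfolding q_def by (simp only: exp_minus inverse_eq_divide)
    have sn: "(sin (of_real s * (z - of_real t)))\<^sup>2 = (2 - q\<^sup>2 - 1 / q\<^sup>2) / 4"
    proof -
      have "\<i> * (of_real s * (z - of_real t)) = - (\<i> * of_real s * d)" unfolding d(2) by simp
      then have "sin (of_real s * (z - of_real t)) = (1 / q - q) / (2 * \<i>)"
        unfolding sin_exp_eq by (simp only: minus_minus q1 q_def[symmetric])
      also have "\<dots> = - ((q - 1 / q) / (2 * \<i>))" by (simp only: minus_divide_left minus_diff_eq)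
      finally have "sin (of_real s * (z - of_real t)) = - ((q - 1 / q) / (2 * \<i>))" .
      then have "(sin (of_real s * (z - of_real t)))\<^sup>2 = - ((q - 1 / q)\<^sup>2 / 4)"
        by (simp only: power2_minus power_divide power_mult_distrib i_squared) simp
      also have "(q - 1 / q)\<^sup>2 = q\<^sup>2 + 1 / q\<^sup>2 - 2" using q by (simp add: power2_diff power_one_over)
      also have "- ((q\<^sup>2 + 1 / q\<^sup>2 - 2) / 4) = (2 - q\<^sup>2 - 1 / q\<^sup>2) / 4"
        unfolding minus_divide_left by (rule arg_cong[where f = "\<lambda>x. x / 4"]) (rule minus_add_diff_eq)
      finally show ?thesis .
    qed
    have "?g t = G (of_real t) * ((2 - q\<^sup>2 - 1 / q\<^sup>2) / 4 / d\<^sup>2 / of_real (pi * s))"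
    proof -
      have "fejer s (z - of_real t) = (sin (of_real s * (z - of_real t)))\<^sup>2 / (z - of_real t)\<^sup>2 / of_real (pi * s)"
        using tz(2)[of t] by (simp only: fejer_def fejer_root_def power_divide if_False)
      then show ?thesis unfolding sn by (simp only: d(2) power2_minus)
    qed
    also have "\<dots> = G (of_real t) * (1 - q\<^sup>2) / d / d / of_real (4 * pi * s)
        + G (of_real t) * (1 - 1 / q\<^sup>2) / (of_real (4 * pi * s) * d\<^sup>2)"
    proof -
      define P where "P = (of_real (pi * s) :: complex)"
      have P: "P \<noteq> 0" "of_real (4 * pi * s) = 4 * P" using s by (auto simp: P_def)
      define A where "A = q\<^sup>2"
      define Q where "Q = 1 / A"
      define D where "D = 4 * P * d\<^sup>2"
      define H where "H = G (of_real t)"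
      have 1: "H * ((2 - A - Q) / 4 / d\<^sup>2 / P) = H * (2 - A - Q) / D" 
        by (simp add: D_def mult_ac)
      have 2: "H * (1 - A) / d / d / (4 * P) = H * (1 - A) / D"
        by (simp add: D_def power2_eq_square mult_ac)
      have 3: "H * (2 - A - Q) = H * (1 - A) + H * (1 - Q)" by (simp add: algebra_simps)
      show ?thesis unfolding P(2) P_def[symmetric] A_def[symmetric] H_def[symmetric] D_def[symmetric]
        unfolding Q_def[symmetric] 1 2 3 add_divide_distrib ..
    qed
    finally show ?thesis
      unfolding q3 using tz(1)[of t] d(1) by (simp add: F_def S_def q2 d_def)
  qed
  have contG: "continuous_on UNIV (\<lambda>t::real. G (of_real t))"
    by (rule continuous_on_real_line[OF hol a])
  have bddt: "norm (G (of_real t)) \<le> B" for t :: real using bdd by simp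
  have intg: "integrable lborel ?g" by (rule integrable_fejer_conv[OF s contG bddt])
  have int1: "integrable lborel (\<lambda>t. (F (of_real t) / (of_real t - z)) / of_real (4 * pi * s))"
    by (intro integrable_divide_zero cauchy(1))
  have "integrable lborel (\<lambda>t. ?g t - (F (of_real t) / (of_real t - z)) / of_real (4 * pi * s))"
    by (rule Bochner_Integration.integrable_diff[OF intg int1])
  then have intr: "integrable lborel ?r" unfolding split by simp
  have "fejer_conv s (\<lambda>t. G (of_real t)) z = (LINT t|lborel. (F (of_real t) / (of_real t - z)) / of_real (4 * pi * s)) + (LINT t|lborel. ?r t)"
    unfolding fejer_conv_def split by (rule Bochner_Integration.integral_add[OF int1 intr])
  also have "(LINT t|lborel. (F (of_real t) / (of_real t - z)) / of_real (4 * pi * s)) = (LINT t|lborel. F (of_real t) / (of_real t - z)) / of_real (4 * pi * s)"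
    by (rule integral_divide_zero)
  also have "\<dots> = G z" unfolding cauchy(2) Fz using s by simp
  finally have "fejer_conv s (\<lambda>t. G (of_real t)) z - G z = (LINT t|lborel. ?r t)" by simp
  also have "norm \<dots> \<le> (LINT t|lborel. 1 / (2 * s * Im z) * (poisson z t * norm (G (of_real t))))"
  proof (rule Bochner_Integration.integral_norm_bound_integral[OF intr])
    have [measurable]: "(\<lambda>t::real. G (of_real t)) \<in> borel_measurable borel"
      using contG by (rule borel_measurable_continuous_onI)
    have "integrable lborel (\<lambda>t. poisson z t * norm (G (of_real t)))"
    proof (rule Bochner_Integration.integrable_bound)
      show "integrable lborel (\<lambda>t. B * poisson z t)" using integrable_poisson[OF z] by auto
      show "AE t in lborel. norm (poisson z t * norm (G (of_real t))) \<le> norm (B * poisson z t)"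
      proof (intro AE_I2)
        fix t
        have "poisson z t * norm (G (of_real t)) \<le> poisson z t * B"
          by (intro mult_left_mono bddt poisson_nonneg z)
        then show "norm (poisson z t * norm (G (of_real t))) \<le> norm (B * poisson z t)"
          using poisson_nonneg[OF z, of t] B0 by (simp add: abs_mult mult.commute[of B])
      qed
    qed measurable
    then show "integrable lborel (\<lambda>t. 1 / (2 * s * Im z) * (poisson z t * norm (G (of_real t))))"
      by (rule integrable_mult_right)
    fix t :: real
    have "norm (exp (2 * \<i> * of_real s * (z - of_real t))) \<le> 1" using s z by (simp)
    then have "norm (1 - exp (2 * \<i> * of_real s * (z - of_real t))) \<le> 2"
      using norm_triangle_ineq4[of 1 "exp (2 * \<i> * of_real s * (z - of_real t))"] unfolding norm_one by linarith
    then have "norm (G (of_real t)) * norm (1 - exp (2 * \<i> * of_real s * (z - of_real t))) / (4 * pi * s * (norm (of_real t - z))\<^sup>2)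
      \<le> norm (G (of_real t)) * 2 / (4 * pi * s * (norm (of_real t - z))\<^sup>2)"
      using s by (intro divide_right_mono mult_left_mono) auto
    also have "\<dots> = 1 / (2 * s * Im z) * (poisson z t * norm (G (of_real t)))"
      using z tz(1)[of t] s by (simp add: poisson_def field_simps)
    finally show "norm (?r t) \<le> 1 / (2 * s * Im z) * (poisson z t * norm (G (of_real t)))"
      using s by (simp add: norm_mult norm_divide norm_power)
  qed
  also have "\<dots> = 1 / (2 * s * Im z) * (LINT t|lborel. poisson z t * norm (G (of_real t)))"
    by (rule integral_mult_right_zero)
  finally show ?thesis .
qed

section \<open>Entire multipliers\<close>

lemma poisson_average:
  fixes G :: "complex \<Rightarrow> complex"
  assumes hol: "G holomorphic_on {z. Im z > - a}" and a: "a > 0"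
    and bdd: "\<And>z. Im z \<ge> 0 \<Longrightarrow> norm (G z) \<le> B" and z: "Im z > 0"
  shows "integrable lborel (\<lambda>t::real. poisson z t * norm (G (of_real t)))"
    and "norm (G z) \<le> (LINT t|lborel. poisson z t * norm (G (of_real t)))"
  using poisson_jensen[OF hol a z bdd, of 1] by simp_all

text \<open>
  For \<open>Im z \<ge> 1\<close> the direct estimate of the kernel would lose a factor \<open>exp (2 s Im z)\<close>; there the comparison with
  \<open>G\<^sub>n\<close> in the half-plane bounds the convolution by Poisson averages. For \<open>Im z < 1\<close> the direct estimate suffices, since
  the factor \<open>exp (- \<i> s z)\<close> compensates the growth in the lower half-plane.
\<close>
lemma fejer_multiplier_sum_le:
  fixes G :: "'i \<Rightarrow> complex \<Rightarrow> complex"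
  assumes s: "s > 0" 
    and c: "c > 0" "\<And>w. norm (fejer s w) \<le> c * exp (2 * s * \<bar>Im w\<bar>) / (1 + (Re w)\<^sup>2)"
    and S: "finite S" and hol: "\<And>n. n \<in> S \<Longrightarrow> G n holomorphic_on {z. Im z > - a}" and a: "a > 0"
    and bdd: "\<And>n z. n \<in> S \<Longrightarrow> Im z \<ge> 0 \<Longrightarrow> norm (G n z) \<le> B"
    and A: "\<And>t::real. (\<Sum>n\<in>S. norm (G n (of_real t))) \<le> A"
  shows "(\<Sum>n\<in>S. norm (exp (- (\<i> * of_real s * z)) * fejer_conv s (\<lambda>t. G n (of_real t)) z))
       \<le> (1 + 1 / (2 * s) + c * pi * exp (2 * s)) * A * exp (s * \<bar>Im z\<bar>)"
proof -
  let ?K = "\<lambda>n. fejer_conv s (\<lambda>t. G n (of_real t)) z"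
  have A0: "A \<ge> 0" using A[of 0] sum_nonneg[of S "\<lambda>n. norm (G n (of_real 0))"] by simp
  have ne: "norm (exp (- (\<i> * of_real s * z))) = exp (s * Im z)" by simp
  have contG: "continuous_on UNIV (\<lambda>t::real. G n (of_real t))" if "n \<in> S" for n
    by (rule continuous_on_real_line[OF hol[OF that] a])
  have bddt: "norm (G n (of_real t)) \<le> B" if "n \<in> S" for n and t :: real using bdd[OF that] by simp
  have "(\<Sum>n\<in>S. norm (?K n)) * exp (s * Im z) \<le> (1 + 1 / (2 * s) + c * pi * exp (2 * s)) * A * exp (s * \<bar>Im z\<bar>)"
  proof (cases "Im z \<ge> 1")
    case True
    then have z: "Im z > 0" by simp
    let ?P = "\<lambda>n. LINT t|lborel. poisson z t * norm (G n (of_real t))"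
    note pa = poisson_average[OF hol a bdd z]
    have each: "norm (?K n) \<le> (1 + 1 / (2 * s)) * ?P n" if n: "n \<in> S" for n
    proof -
      have P0: "?P n \<ge> 0" by (intro Bochner_Integration.integral_nonneg mult_nonneg_nonneg poisson_nonneg z) simp
      have "norm (?K n) \<le> norm (G n z) + norm (?K n - G n z)" using norm_triangle_ineq[of "G n z" "?K n - G n z"] by simp
      also have "\<dots> \<le> ?P n + 1 / (2 * s * Im z) * ?P n"
        by (intro add_mono pa(2)[OF n n] fejer_conv_upper[OF s hol[OF n] a bdd[OF n] z]; assumption)
      also have "\<dots> \<le> ?P n + 1 / (2 * s) * ?P n"
        using True s P0 by (intro add_left_mono mult_right_mono divide_left_mono) auto
      finally show ?thesis by (simp only: distrib_right mult_1_left)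
    qed
    have "(\<Sum>n\<in>S. norm (?K n)) \<le> (\<Sum>n\<in>S. (1 + 1 / (2 * s)) * ?P n)" by (intro sum_mono each)
    also have "\<dots> = (1 + 1 / (2 * s)) * (\<Sum>n\<in>S. ?P n)" by (simp only: sum_distrib_left)
    also have "(\<Sum>n\<in>S. ?P n) = (LINT t|lborel. (\<Sum>n\<in>S. poisson z t * norm (G n (of_real t))))"
      by (rule Bochner_Integration.integral_sum[symmetric]) (rule pa(1))
    also have "\<dots> \<le> (LINT t|lborel. A * poisson z t)"
    proof (rule integral_mono)
      show "integrable lborel (\<lambda>t. \<Sum>n\<in>S. poisson z t * norm (G n (of_real t)))"
        by (rule Bochner_Integration.integrable_sum) (rule pa(1))
      show "integrable lborel (\<lambda>t. A * poisson z t)" by (intro integrable_mult_right integrable_poisson z)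
      fix t :: real
      have "poisson z t * (\<Sum>n\<in>S. norm (G n (of_real t))) \<le> poisson z t * A"
        by (intro mult_left_mono A poisson_nonneg z)
      then show "(\<Sum>n\<in>S. poisson z t * norm (G n (of_real t))) \<le> A * poisson z t"
        by (simp only: sum_distrib_left mult.commute[of A])
    qed
    also have "(LINT t|lborel. A * poisson z t) = A" 
      by (simp only: integral_mult_right_zero integral_poisson[OF z] mult_1_right)
    finally have "(\<Sum>n\<in>S. norm (?K n)) \<le> (1 + 1 / (2 * s)) * A" using s by (simp add: mult_left_mono)
    also have "\<dots> \<le> (1 + 1 / (2 * s) + c * pi * exp (2 * s)) * A" using A0 c(1) by (intro mult_right_mono) auto
    finally show ?thesis using True by (intro mult_mono) (auto intro!: mult_nonneg_nonneg A0 add_nonneg_nonneg less_imp_le[OF c(1)] less_imp_le[OF s])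
  next
    case False
    let ?w = "\<lambda>t. 1 / (1 + (Re z + (-1) * t)\<^sup>2)"
    have w: "integrable lborel ?w" "(LINT t|lborel. ?w t) = pi"
    proof -
      show "integrable lborel ?w"
        by (rule lborel_integrable_real_affine[OF integrable_inverse_1_plus_sq(1)]) simp
      have "pi = \<bar>-1\<bar> *\<^sub>R (LINT t|lborel. ?w t)"
        by (subst integrable_inverse_1_plus_sq(2)[symmetric], rule lborel_integral_real_affine) simp
      then show "(LINT t|lborel. ?w t) = pi" by simp
    qed
    define E where "E = c * exp (2 * s * \<bar>Im z\<bar>)"
    have E0: "E \<ge> 0" using c(1) by (simp add: E_def)
    have fw: "norm (fejer s (z - of_real t)) \<le> E * ?w t" for t using c(2)[of "z - of_real t"] by (simp add: E_def)
    let ?h = "\<lambda>n t. G n (of_real t) * fejer s (z - of_real t)"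
    have int: "integrable lborel (?h n)" if "n \<in> S" for n
      by (rule integrable_fejer_conv[OF s contG[OF that] bddt[OF that]])
    have "(\<Sum>n\<in>S. norm (?K n)) \<le> (\<Sum>n\<in>S. LINT t|lborel. norm (?h n t))"
      unfolding fejer_conv_def by (intro sum_mono Bochner_Integration.integral_norm_bound)
    also have "\<dots> = (LINT t|lborel. (\<Sum>n\<in>S. norm (?h n t)))"
      by (rule Bochner_Integration.integral_sum[symmetric]) (rule integrable_norm[OF int])
    also have "\<dots> \<le> (LINT t|lborel. (A * E) * ?w t)"
    proof (rule integral_mono)
      show "integrable lborel (\<lambda>t. \<Sum>n\<in>S. norm (?h n t))"
        by (rule Bochner_Integration.integrable_sum) (rule integrable_norm[OF int])
      show "integrable lborel (\<lambda>t. (A * E) * ?w t)" by (rule integrable_mult_right[OF w(1)])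
      fix t :: real
      have "(\<Sum>n\<in>S. norm (?h n t)) = (\<Sum>n\<in>S. norm (G n (of_real t))) * norm (fejer s (z - of_real t))"
        by (simp only: norm_mult sum_distrib_right)
      also have "\<dots> \<le> A * (E * ?w t)" by (rule mult_mono[OF A fw A0]) simp
      finally show "(\<Sum>n\<in>S. norm (?h n t)) \<le> (A * E) * ?w t" by (simp only: mult.assoc)
    qed
    also have "\<dots> = A * E * pi" by (simp only: integral_mult_right_zero w(2))
    finally have "(\<Sum>n\<in>S. norm (?K n)) * exp (s * Im z) \<le> A * E * pi * exp (s * Im z)" by (intro mult_right_mono) auto
    also have "\<dots> = (c * pi * A) * exp (2 * s * \<bar>Im z\<bar> + s * Im z)" by (simp add: E_def exp_add)
    also have "\<dots> \<le> (c * pi * A) * exp (2 * s + s * \<bar>Im z\<bar>)"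
    proof (intro mult_left_mono)
      have "2 * \<bar>Im z\<bar> + Im z \<le> 2 + \<bar>Im z\<bar>" using False by (cases "Im z \<ge> 0") auto
      then have "s * (2 * \<bar>Im z\<bar> + Im z) \<le> s * (2 + \<bar>Im z\<bar>)" using s by (intro mult_left_mono) auto
      then show "exp (2 * s * \<bar>Im z\<bar> + s * Im z) \<le> exp (2 * s + s * \<bar>Im z\<bar>)" by (simp add: algebra_simps)
    qed (use c(1) A0 in auto)
    also have "\<dots> = (c * pi * exp (2 * s)) * A * exp (s * \<bar>Im z\<bar>)" by (simp add: exp_add)
    also have "\<dots> \<le> (1 + 1 / (2 * s) + c * pi * exp (2 * s)) * A * exp (s * \<bar>Im z\<bar>)"
      using A0 s by (intro mult_right_mono) auto
    finally show ?thesis .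
  qed
  then show ?thesis by (simp only: norm_mult ne sum_distrib_right mult.commute[of "exp (s * Im z)"])
qed

text \<open>
  The smoothed functions take values of modulus at least \<open>1/2\<close> at the points, because the error of smoothing is at
  most \<open>4 e / (2 \<epsilon> M)\<close> there; dividing by these values gives the exact normalisation and at most doubles the sum.
\<close>
lemma half_plane_multipliers:
  fixes \<mu> :: "nat \<Rightarrow> complex"
  assumes \<epsilon>: "\<epsilon> > 0" and M: "M > 0" "M \<ge> 4 * exp 1 / \<epsilon>" "\<And>n. n \<in> I \<Longrightarrow> Im (\<mu> n) \<ge> M" and C: "C > 0"
    and carl: "\<And>n S. n \<in> I \<Longrightarrow> finite S \<Longrightarrow> S \<subseteq> I \<Longrightarrow>
        (\<Sum>j\<in>S. Im (\<mu> j) * Im (\<mu> n) / (norm (\<mu> n - cnj (\<mu> j)))\<^sup>2) \<le> C"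
  obtains g :: "nat \<Rightarrow> complex \<Rightarrow> complex" and A :: real where
    "\<And>n. n \<in> I \<Longrightarrow> g n holomorphic_on UNIV"
    "\<And>n. n \<in> I \<Longrightarrow> g n (\<mu> n) = of_real (exp (\<epsilon> * Im (\<mu> n)))"
    "\<And>S z. finite S \<Longrightarrow> S \<subseteq> I \<Longrightarrow> (\<Sum>n\<in>S. norm (g n z)) \<le> A * exp (\<epsilon> * \<bar>Im z\<bar>)"
proof -
  obtain G :: "nat \<Rightarrow> complex \<Rightarrow> complex" where
    holG: "\<And>n. n \<in> I \<Longrightarrow> G n holomorphic_on {z. Im z > - (M / 2)}" and
    G1: "\<And>n. n \<in> I \<Longrightarrow> G n (\<mu> n) = 1" and
    bddG: "\<And>n z. n \<in> I \<Longrightarrow> Im z \<ge> 0 \<Longrightarrow> norm (G n z) \<le> 4 * exp 1" and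
    sumG: "\<And>S t. finite S \<Longrightarrow> S \<subseteq> I \<Longrightarrow> (\<Sum>n\<in>S. norm (G n (of_real t))) \<le> 8 * exp 1 * C"
  proof (rule jones_functions[of M I \<mu> C])
    show "M > 0" by (rule M(1))
    show "Im (\<mu> n) \<ge> M" if "n \<in> I" for n by (rule M(3)[OF that])
    show "C > 0" by (rule C)
    show "(\<Sum>j\<in>S. Im (\<mu> j) * Im (\<mu> n) / (norm (\<mu> n - cnj (\<mu> j)))\<^sup>2) \<le> C"
      if "n \<in> I" "finite S" "S \<subseteq> I" for n S by (rule carl[OF that])
  qed (rule that)
  obtain c where c: "c > 0" "\<And>w. norm (fejer \<epsilon> w) \<le> c * exp (2 * \<epsilon> * \<bar>Im w\<bar>) / (1 + (Re w)\<^sup>2)"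
    using fejer_decay[OF \<epsilon>] by blast
  define K where "K = (\<lambda>n. fejer_conv \<epsilon> (\<lambda>t. G n (of_real t)))"
  define e where "e = (\<lambda>z. exp (- (\<i> * of_real \<epsilon> * z)))"
  have M2: "M / 2 > 0" using M(1) by simp
  have K1: "norm (K n (\<mu> n)) \<ge> 1 / 2" if n: "n \<in> I" for n
  proof -
    have w: "Im (\<mu> n) > 0" using M(1) M(3)[OF n] by linarith
    note pa = poisson_average[OF holG[OF n] M2 bddG[OF n] w]
    have "(LINT t|lborel. poisson (\<mu> n) t * norm (G n (of_real t))) \<le> (LINT t|lborel. 4 * exp 1 * poisson (\<mu> n) t)"
    proof (rule integral_mono)
      show "integrable lborel (\<lambda>t. poisson (\<mu> n) t * norm (G n (of_real t)))" by (rule pa(1))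
      show "integrable lborel (\<lambda>t. 4 * exp 1 * poisson (\<mu> n) t)" by (intro integrable_mult_right integrable_poisson w)
      fix t :: real
      have "poisson (\<mu> n) t * norm (G n (of_real t)) \<le> poisson (\<mu> n) t * (4 * exp 1)"
        by (intro mult_left_mono bddG n poisson_nonneg w) simp
      then show "poisson (\<mu> n) t * norm (G n (of_real t)) \<le> 4 * exp 1 * poisson (\<mu> n) t" by (simp only: mult.commute)
    qed
    also have "\<dots> = 4 * exp 1" by (simp only: integral_mult_right_zero integral_poisson[OF w] mult_1_right)
    finally have le: "(LINT t|lborel. poisson (\<mu> n) t * norm (G n (of_real t))) \<le> 4 * exp 1" .
    have "norm (K n (\<mu> n) - 1) \<le> 1 / (2 * \<epsilon> * Im (\<mu> n)) * (LINT t|lborel. poisson (\<mu> n) t * norm (G n (of_real t)))"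
      unfolding K_def using fejer_conv_upper[OF \<epsilon> holG[OF n] M2 bddG[OF n] w] G1[OF n] by simp
    also have "\<dots> \<le> 1 / (2 * \<epsilon> * Im (\<mu> n)) * (4 * exp 1)"
      using \<epsilon> w by (intro mult_left_mono le) auto
    also have "\<dots> \<le> 1 / 2"
    proof -
      have "4 * exp 1 \<le> \<epsilon> * M" using M(2) \<epsilon> by (simp add: divide_le_eq mult.commute)
      also have "\<dots> \<le> \<epsilon> * Im (\<mu> n)" using M(3)[OF n] \<epsilon> by (intro mult_left_mono) auto
      finally show ?thesis using \<epsilon> w by (simp add: divide_le_eq)
    qed
    finally have "norm (K n (\<mu> n) - 1) \<le> 1 / 2" .
    then show ?thesis using norm_triangle_ineq2[of 1 "1 - K n (\<mu> n)"] by (simp add: norm_minus_commute)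
  qed
  have holK: "K n holomorphic_on UNIV" if n: "n \<in> I" for n
    unfolding K_def
  proof (rule holomorphic_fejer_conv[OF \<epsilon>])
    show "continuous_on UNIV (\<lambda>t::real. G n (of_real t))"
      by (rule continuous_on_real_line[OF holG[OF n] M2])
    show "norm (G n (of_real t)) \<le> 4 * exp 1" for t :: real by (rule bddG[OF n]) simp
  qed
  define k where "k = (\<lambda>n. of_real (exp (\<epsilon> * Im (\<mu> n))) / (e (\<mu> n) * K n (\<mu> n)))"
  have nk: "norm (k n) \<le> 2" if n: "n \<in> I" for n
  proof -
    have "norm (k n) = 1 / norm (K n (\<mu> n))" by (simp add: k_def e_def norm_divide norm_mult)
    also have "\<dots> \<le> 1 / (1 / 2)" using K1[OF n] by (intro divide_left_mono mult_pos_pos) auto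
    finally show ?thesis by simp
  qed
  define D where "D = (1 + 1 / (2 * \<epsilon>) + c * pi * exp (2 * \<epsilon>)) * (8 * exp 1 * C)"
  show thesis
  proof (rule that[of "\<lambda>n z. k n * (e z * K n z)" "2 * D"])
    show "(\<lambda>z. k n * (e z * K n z)) holomorphic_on UNIV" if "n \<in> I" for n
      unfolding e_def by (intro holomorphic_intros holK that)
    show "k n * (e (\<mu> n) * K n (\<mu> n)) = of_real (exp (\<epsilon> * Im (\<mu> n)))" if "n \<in> I" for n
      using K1[OF that] by (auto simp: k_def e_def)
    fix S z assume S: "finite S" "S \<subseteq> I"
    have "(\<Sum>n\<in>S. norm (k n * (e z * K n z))) \<le> (\<Sum>n\<in>S. 2 * norm (e z * K n z))"
    proof (rule sum_mono)
      fix n assume "n \<in> S"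
      then have "norm (k n) \<le> 2" using nk S(2) by blast
      then show "norm (k n * (e z * K n z)) \<le> 2 * norm (e z * K n z)"
        by (subst norm_mult) (intro mult_right_mono norm_ge_zero)
    qed
    also have "\<dots> = 2 * (\<Sum>n\<in>S. norm (e z * K n z))" by (simp only: sum_distrib_left)
    also have "(\<Sum>n\<in>S. norm (e z * K n z)) \<le> D * exp (\<epsilon> * \<bar>Im z\<bar>)"
      unfolding e_def K_def D_def
    proof (rule fejer_multiplier_sum_le[OF \<epsilon> c S(1) _ M2])
      show "G n holomorphic_on {z. Im z > - (M / 2)}" if "n \<in> S" for n using holG that S(2) by blast
      show "norm (G n z) \<le> 4 * exp 1" if "n \<in> S" "Im z \<ge> 0" for n z using bddG that S(2) by blast
      show "(\<Sum>n\<in>S. norm (G n (of_real t))) \<le> 8 * exp 1 * C" for t :: real by (rule sumG[OF S])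
    qed
    finally show "(\<Sum>n\<in>S. norm (k n * (e z * K n z))) \<le> 2 * D * exp (\<epsilon> * \<bar>Im z\<bar>)" by (simp add: mult.assoc)
  qed
qed

text \<open>
  Points close to the real line are treated together with the others by moving the boundary: relative to the line
  \<open>Im z = - M\<close> all of them have height at least \<open>M\<close>, and the Plancherel-Polya inequality transports the \<open>L\<^sup>p\<close> bound to
  this line. A multiplier for the shifted point, shifted back and divided by \<open>exp (\<epsilon> M)\<close>, is a multiplier for the
  original one.
\<close>
lemma weak_biorthogonal_upper_multipliers:
  fixes f :: "nat \<Rightarrow> complex \<Rightarrow> complex" and \<Lambda> :: "nat \<Rightarrow> complex"
  assumes \<tau>: "\<tau> > 0" and p: "p > 1" and \<epsilon>: "\<epsilon> > 0"
    and pw: "\<And>n. f n \<in> paley_wiener \<tau> p"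
    and K: "\<And>n. (LINT t|lborel. norm (f n (of_real t)) powr p) \<le> K"
    and bio: "\<And>n k. f n (\<Lambda> k) * of_real (pw_weight \<tau> p (\<Lambda> n)) = (if n = k then 1 else 0)"
    and I: "\<And>n. n \<in> I \<Longrightarrow> Im (\<Lambda> n) \<ge> 0"
  obtains g :: "nat \<Rightarrow> complex \<Rightarrow> complex" and A :: real where
    "\<And>n. n \<in> I \<Longrightarrow> g n holomorphic_on UNIV"
    "\<And>n. n \<in> I \<Longrightarrow> g n (\<Lambda> n) = of_real (exp (\<epsilon> * Im (\<Lambda> n)))"
    "\<And>S z. finite S \<Longrightarrow> S \<subseteq> I \<Longrightarrow> (\<Sum>n\<in>S. norm (g n z)) \<le> A * exp (\<epsilon> * \<bar>Im z\<bar>)"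
proof -
  define M where "M = max 1 (4 * exp 1 / \<epsilon>)"
  have M: "M > 0" "M \<ge> 1" "M \<ge> 4 * exp 1 / \<epsilon>" by (auto simp: M_def)
  define \<mu> where "\<mu> = (\<lambda>n. \<Lambda> n + \<i> * of_real M)"
  have Im\<mu>: "Im (\<mu> n) = Im (\<Lambda> n) + M" for n by (simp add: \<mu>_def)
  have hol: "f n holomorphic_on UNIV" and type: "exp_type_le \<tau> (f n)" 
    and int: "integrable lborel (\<lambda>t::real. norm (f n (of_real t)) powr p)" for n
    using pw[of n] by (auto simp: paley_wiener_def)
  have holm: "(\<lambda>z. f n (- z)) holomorphic_on UNIV" for n by (rule holomorphic_reflect[OF hol])
  define B where "B = 2 * (1 + K) * exp \<tau>"
  have bd: "norm (f n z) \<le> B * exp (\<tau> * \<bar>Im z\<bar>)" for n z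
    unfolding B_def by (rule paley_wiener_pointwise_bound[OF hol type _ _ int K]) (use \<tau> p in auto)
  have B0: "B \<ge> 0" using order_trans[OF norm_ge_zero bd[of 0 0]] by simp
  have K0: "K \<ge> 0" by (rule order_trans[OF Bochner_Integration.integral_nonneg K[of 0]]) simp
  have wt: "pw_weight \<tau> p z > 0" for z by (auto simp: pw_weight_def intro: add_pos_nonneg)
  have f_zero: "f n (\<Lambda> k) = 0" if "n \<noteq> k" for n k using bio[of n k] wt[of "\<Lambda> n"] that by simp
  have f_diag: "norm (f n (\<Lambda> n)) = 1 / pw_weight \<tau> p (\<Lambda> n)" for n
  proof -
    have "norm (f n (\<Lambda> n) * of_real (pw_weight \<tau> p (\<Lambda> n))) = 1" unfolding bio by simp
    then show ?thesis using wt[of "\<Lambda> n"] by (simp add: norm_mult field_simps)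
  qed
  have inj: "inj \<Lambda>"
  proof (rule injI)
    fix n k assume eq: "\<Lambda> n = \<Lambda> k"
    show "n = k"
    proof (rule ccontr)
      assume "n \<noteq> k"
      then have "f n (\<Lambda> n) = 0" using f_zero[of n k] eq by simp
      then show False using bio[of n n] by simp
    qed
  qed
  \<comment> \<open>the factor \<open>exp (\<i> \<tau> z)\<close> cancels the exponential growth in the upper half-plane\<close>
  define h where "h = (\<lambda>n z. f n (z - \<i> * of_real M) * exp (\<i> * of_real \<tau> * z))"
  have nh: "norm (h n z) = norm (f n (z - \<i> * of_real M)) * exp (- (\<tau> * Im z))" for n z
    by (simp add: h_def norm_mult)
  have holh: "h n holomorphic_on UNIV" for n
  proof -
    have "(f n \<circ> (\<lambda>z. z - \<i> * of_real M)) holomorphic_on UNIV"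
      by (rule holomorphic_on_compose) (auto intro!: holomorphic_intros holomorphic_on_subset[OF hol])
    then show ?thesis unfolding h_def by (intro holomorphic_intros) (simp add: comp_def)
  qed
  have bdh: "norm (h n z) \<le> B * exp (\<tau> * M)" if "Im z \<ge> 0" for n z
  proof -
    have "norm (h n z) \<le> B * exp (\<tau> * \<bar>Im z - M\<bar>) * exp (- (\<tau> * Im z))"
      unfolding nh using bd[of n "z - \<i> * of_real M"] by (intro mult_right_mono) auto
    also have "\<dots> = B * exp (\<tau> * (\<bar>Im z - M\<bar> - Im z))" by (simp add: exp_diff exp_minus right_diff_distrib divide_inverse)
    also have "\<dots> \<le> B * exp (\<tau> * M)"
      using B0 \<tau> that M(1) by (intro mult_left_mono) auto
    finally show ?thesis .
  qed
  have hreal: "norm (h n (of_real t)) = norm (f n (- (of_real (- t) + \<i> * of_real M)))" for n t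
    by (simp add: nh)
  have pp: "integrable lborel (\<lambda>t::real. norm (h n (of_real t)) powr p)"
     "(LINT t|lborel. norm (h n (of_real t)) powr p) \<le> exp (p * \<tau> * M) * K" for n
  proof -
    have intm: "integrable lborel (\<lambda>t::real. norm (f n (- of_real t)) powr p)"
      using int[of n] lborel_reflect(1)[of "\<lambda>t. norm (f n (of_real t)) powr p"] by simp
    have Km: "(LINT t|lborel. norm (f n (- of_real t)) powr p) \<le> K"
      using K[of n] lborel_reflect(2)[of "\<lambda>t. norm (f n (of_real t)) powr p"] by simp
    have bdm: "norm (f n (- z)) \<le> B * exp (\<tau> * \<bar>Im z\<bar>)" for z using bd[of n "- z"] by simp
    have p1: "p \<ge> 1" using p by simp
    note P = plancherel_polya[OF holm bdm p1 M(1) intm]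
    show "integrable lborel (\<lambda>t::real. norm (h n (of_real t)) powr p)"
      unfolding hreal using P(1) lborel_reflect(1)[of "\<lambda>t. norm (f n (- (of_real t + \<i> * of_real M))) powr p"] by simp
    have "(LINT t|lborel. norm (h n (of_real t)) powr p) = (LINT t|lborel. norm (f n (- (of_real t + \<i> * of_real M))) powr p)"
      unfolding hreal by (rule lborel_reflect(2)[of "\<lambda>t. norm (f n (- (of_real t + \<i> * of_real M))) powr p"])
    also have "\<dots> \<le> exp (p * \<tau> * M) * (LINT t|lborel. norm (f n (- of_real t)) powr p)" by (rule P(2))
    also have "\<dots> \<le> exp (p * \<tau> * M) * K" by (intro mult_left_mono Km) simp
    finally show "(LINT t|lborel. norm (h n (of_real t)) powr p) \<le> exp (p * \<tau> * M) * K" .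
  qed
  define c where "c = exp (- (p * \<tau> * M))"
  have c: "c > 0" by (simp add: c_def)
  have hdiag: "Im (\<mu> n) * norm (h n (\<mu> n)) powr p \<ge> c" if n: "n \<in> I" for n
  proof -
    define y where "y = Im (\<Lambda> n)"
    have y: "y \<ge> 0" using I[OF n] by (simp add: y_def)
    have "norm (h n (\<mu> n)) = norm (f n (\<Lambda> n)) * exp (- (\<tau> * (y + M)))"
      unfolding nh Im\<mu> by (simp add: \<mu>_def y_def)
    also have "norm (f n (\<Lambda> n)) = (1 + y) powr (- (1 / p)) * exp (\<tau> * y)"
      unfolding f_diag pw_weight_def using y by (simp add: y_def[symmetric] powr_minus exp_minus divide_inverse)
    also have "\<dots> * exp (- (\<tau> * (y + M))) = (1 + y) powr (- (1 / p)) * exp (- (\<tau> * M))"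
      by (simp add: mult.assoc mult_exp_exp distrib_left)
    finally have "norm (h n (\<mu> n)) powr p = ((1 + y) powr (- (1 / p))) powr p * exp (- (\<tau> * M)) powr p"
      by (simp only: powr_mult)
    also have "((1 + y) powr (- (1 / p))) powr p = (1 + y) powr (- 1)" using p by (simp add: powr_powr)
    also have "\<dots> = 1 / (1 + y)" using y by (simp add: powr_minus_divide)
    also have "exp (- (\<tau> * M)) powr p = c" by (simp add: c_def powr_def mult_ac)
    finally have eq: "norm (h n (\<mu> n)) powr p = 1 / (1 + y) * c" .
    have "1 \<le> (y + M) / (1 + y)" using y M(2) by (simp add: le_divide_eq)
    then have "1 * c \<le> ((y + M) / (1 + y)) * c" using c by (intro mult_right_mono) auto
    also have "\<dots> = Im (\<mu> n) * norm (h n (\<mu> n)) powr p" unfolding eq Im\<mu> y_def by simp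
    finally show ?thesis by simp
  qed
  define C where "C = (exp (p * \<tau> * M) * K / (pi * c)) powr (2 / p) + 1"
  have C: "C > 0" unfolding C_def by (intro add_nonneg_pos) auto
  have carl: "(\<Sum>j\<in>S. Im (\<mu> j) * Im (\<mu> n) / (norm (\<mu> n - cnj (\<mu> j)))\<^sup>2) \<le> C"
    if n: "n \<in> I" and S: "finite S" "S \<subseteq> I" for n S
  proof -
    let ?X = "\<lambda>j. Im (\<mu> j) * Im (\<mu> n) / (norm (\<mu> n - cnj (\<mu> j)))\<^sup>2"
    have pos: "Im (\<mu> j) > 0" if "j \<in> I" for j using I[OF that] M(1) by (simp add: Im\<mu>)
    have "(\<Sum>j\<in>S - {n}. ?X j) \<le> (exp (p * \<tau> * M) * K / (pi * c)) powr (2 / p)"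
    proof (rule carleson_sum_bound[OF holh bdh _ pp(1) pp(2)])
      show "inj_on \<mu> (S - {n})" using inj by (auto simp: inj_on_def \<mu>_def)
      show "h n (\<mu> j) = 0" if "j \<in> S - {n}" for j using f_zero[of n j] that by (simp add: h_def \<mu>_def)
      show "Im (\<mu> j) > 0" if "j \<in> S - {n}" for j using pos S that by blast
      show "c \<le> Im (\<mu> n) * norm (h n (\<mu> n)) powr p" by (rule hdiag[OF n])
    qed (use S p c pos[OF n] in auto)
    \<comment> \<open>the term \<open>j = n\<close>, which is absent from the Blaschke product, accounts for the summand \<open>1\<close> in \<open>C\<close>\<close>
    moreover have "?X n \<le> 1"
    proof -
      have "\<mu> n - cnj (\<mu> n) = 2 * \<i> * of_real (Im (\<mu> n))" by (simp add: complex_eq_iff)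
      then have "norm (\<mu> n - cnj (\<mu> n)) = 2 * Im (\<mu> n)" using pos[OF n] by (simp add: norm_mult)
      then show ?thesis using pos[OF n] by (simp add: power2_eq_square)
    qed
    moreover have "(\<Sum>j\<in>S. ?X j) \<le> (\<Sum>j\<in>insert n (S - {n}). ?X j)"
    proof (rule sum_mono2)
      show "finite (insert n (S - {n}))" "S \<subseteq> insert n (S - {n})" using S by auto
      fix j assume "j \<in> insert n (S - {n}) - S"
      then have "j \<in> I" using n by auto
      then show "?X j \<ge> 0" by (intro divide_nonneg_nonneg mult_nonneg_nonneg less_imp_le[OF pos] n zero_le_power2)
    qed
    moreover have "(\<Sum>j\<in>insert n (S - {n}). ?X j) = ?X n + (\<Sum>j\<in>S - {n}. ?X j)"
      using S by (intro sum.insert) auto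
    ultimately show ?thesis unfolding C_def by linarith
  qed
  obtain g :: "nat \<Rightarrow> complex \<Rightarrow> complex" and A :: real where
    g: "\<And>n. n \<in> I \<Longrightarrow> g n holomorphic_on UNIV" and
    g1: "\<And>n. n \<in> I \<Longrightarrow> g n (\<mu> n) = of_real (exp (\<epsilon> * Im (\<mu> n)))" and
    gs: "\<And>S z. finite S \<Longrightarrow> S \<subseteq> I \<Longrightarrow> (\<Sum>n\<in>S. norm (g n z)) \<le> A * exp (\<epsilon> * \<bar>Im z\<bar>)"
  proof (rule half_plane_multipliers[of \<epsilon> M I \<mu> C])
    show "\<epsilon> > 0" "M > 0" "4 * exp 1 / \<epsilon> \<le> M" "C > 0" by fact+
    show "M \<le> Im (\<mu> n)" if "n \<in> I" for n using I[OF that] by (simp add: Im\<mu>)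
    show "(\<Sum>j\<in>S. Im (\<mu> j) * Im (\<mu> n) / (norm (\<mu> n - cnj (\<mu> j)))\<^sup>2) \<le> C"
      if "n \<in> I" "finite S" "S \<subseteq> I" for n S by (rule carl[OF that])
  qed (rule that)
  define E where "E = exp (- (\<epsilon> * M))"
  define g' where "g' = (\<lambda>n z. of_real E * g n (z + \<i> * of_real M))"
  show thesis
  proof (rule that[of g' A])
    show "g' n holomorphic_on UNIV" if "n \<in> I" for n
    proof -
      have "(g n \<circ> (\<lambda>z. z + \<i> * of_real M)) holomorphic_on UNIV"
        by (rule holomorphic_on_compose) (auto intro!: holomorphic_intros holomorphic_on_subset[OF g[OF that]])
      then show ?thesis unfolding g'_def by (intro holomorphic_intros) (simp add: comp_def)
    qed
    show "g' n (\<Lambda> n) = of_real (exp (\<epsilon> * Im (\<Lambda> n)))" if "n \<in> I" for n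
    proof -
      have "g' n (\<Lambda> n) = of_real E * g n (\<mu> n)" by (simp add: g'_def \<mu>_def)
      also have "\<dots> = of_real (E * exp (\<epsilon> * Im (\<mu> n)))" by (simp add: g1[OF that])
      also have "E * exp (\<epsilon> * Im (\<mu> n)) = exp (\<epsilon> * Im (\<Lambda> n))"
        unfolding E_def Im\<mu> mult_exp_exp by (simp add: distrib_left)
      finally show ?thesis .
    qed
    fix S z assume S: "finite S" "S \<subseteq> I"
    have A0: "A \<ge> 0" using gs[of "{}" 0] by simp
    have "(\<Sum>n\<in>S. norm (g' n z)) = E * (\<Sum>n\<in>S. norm (g n (z + \<i> * of_real M)))"
      by (simp add: g'_def norm_mult E_def sum_distrib_left)
    also have "\<dots> \<le> E * (A * exp (\<epsilon> * \<bar>Im z + M\<bar>))"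
      using gs[OF S, of "z + \<i> * of_real M"] by (intro mult_left_mono) (auto simp: E_def)
    also have "\<dots> = A * exp (\<epsilon> * (\<bar>Im z + M\<bar> - M))" by (simp add: E_def exp_minus exp_diff right_diff_distrib divide_inverse)
    also have "\<dots> \<le> A * exp (\<epsilon> * \<bar>Im z\<bar>)" using A0 \<epsilon> M(1) by (intro mult_left_mono) auto
    finally show "(\<Sum>n\<in>S. norm (g' n z)) \<le> A * exp (\<epsilon> * \<bar>Im z\<bar>)" .
  qed
qed

section \<open>Summing the interpolating series\<close>

text \<open>
  Jensen's inequality for weights of total mass at most \<open>A\<close>, from the tangent of \<open>x \<mapsto> x\<^sup>p\<close> at \<open>c\<close>. That the mass may be
  smaller than \<open>A\<close> is accounted for by \<open>p \<ge> 1\<close>.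
\<close>
lemma sum_weighted_powr_le:
  fixes w x :: "'a \<Rightarrow> real"
  assumes S: "finite S" and w: "\<And>n. n \<in> S \<Longrightarrow> w n \<ge> 0" and x: "\<And>n. n \<in> S \<Longrightarrow> x n \<ge> 0"
    and A: "(\<Sum>n\<in>S. w n) \<le> A" "A > 0" and p: "p \<ge> 1"
  shows "(\<Sum>n\<in>S. w n * x n) powr p \<le> A powr (p - 1) * (\<Sum>n\<in>S. w n * x n powr p)"
proof -
  define c where "c = (\<Sum>n\<in>S. w n * x n) / A"
  have c0: "c \<ge> 0" unfolding c_def using A(2) w x by (intro divide_nonneg_nonneg sum_nonneg mult_nonneg_nonneg) auto
  have Ac: "(\<Sum>n\<in>S. w n * x n) = A * c" using A(2) by (simp add: c_def)
  show ?thesis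
  proof (cases "c = 0")
    case True
    then show ?thesis using w by (simp add: Ac sum_nonneg)
  next
    case False
    then have c: "c > 0" using c0 by simp
    define W where "W = (\<Sum>n\<in>S. w n)"
    note pc = powr_minus_one_mult[OF c, of p]
    have "(p - 1) * W \<le> (p - 1) * A" using A(1) p by (intro mult_left_mono) (auto simp: W_def)
    then have "A \<le> W * (1 - p) + p * A" by (simp add: algebra_simps)
    then have "c powr p * A \<le> c powr p * (W * (1 - p) + p * A)" by (intro mult_left_mono) auto
    also have "\<dots> = W * c powr p + p * (c powr (p - 1) * (A * c) - c powr (p - 1) * c * W)"
      unfolding pc[symmetric] by (simp add: algebra_simps)
    also have "\<dots> = W * c powr p + p * (c powr (p - 1) * (\<Sum>n\<in>S. w n * x n) - c powr (p - 1) * c * (\<Sum>n\<in>S. w n))"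
      by (simp only: Ac W_def)
    also have "\<dots> = (\<Sum>n\<in>S. w n * (c powr p + p * c powr (p - 1) * (x n - c)))"
      by (simp add: W_def sum_distrib_left sum_distrib_right sum.distrib[symmetric] sum_subtractf[symmetric] algebra_simps)
    also have "\<dots> \<le> (\<Sum>n\<in>S. w n * x n powr p)"
      by (intro sum_mono mult_left_mono powr_above_tangent w x c p)
    finally have "A powr (p - 1) * (c powr p * A) \<le> A powr (p - 1) * (\<Sum>n\<in>S. w n * x n powr p)"
      by (intro mult_left_mono) auto
    moreover have "A powr (p - 1) * (c powr p * A) = (\<Sum>n\<in>S. w n * x n) powr p"
    proof -
      have "A powr (p - 1) * (c powr p * A) = A powr p * c powr p"
        using powr_minus_one_mult[OF A(2), of p] by (simp add: mult_ac)
      also have "\<dots> = (A * c) powr p" by (simp only: powr_mult)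
      finally show ?thesis by (simp only: Ac)
    qed
    ultimately show ?thesis by simp
  qed
qed

text \<open>
  Since \<open>a\<^sub>n \<rightarrow> 0\<close> and the sum of the \<open>\<bar>g\<^sub>n\<bar>\<close> is bounded, the tails of the series are locally uniformly small. On the
  real line the weights \<open>\<bar>g\<^sub>n(t)\<bar>\<close> have total mass at most \<open>A\<close>, and weighted convexity bounds the integrals of the
  partial sums uniformly; Fatou's lemma passes the bound to the limit.
\<close>
lemma interpolation_series:
  fixes f g :: "nat \<Rightarrow> complex \<Rightarrow> complex" and a :: "nat \<Rightarrow> complex"
  assumes p: "p > 1" and \<tau>: "\<tau> \<ge> 0" and \<epsilon>: "\<epsilon> \<ge> 0"
    and holf: "\<And>n. f n holomorphic_on UNIV" and bdf: "\<And>n z. norm (f n z) \<le> B * exp (\<tau> * \<bar>Im z\<bar>)"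
    and int: "\<And>n. integrable lborel (\<lambda>t::real. norm (f n (of_real t)) powr p)"
    and K: "\<And>n. (LINT t|lborel. norm (f n (of_real t)) powr p) \<le> K"
    and holg: "\<And>n. g n holomorphic_on UNIV"
    and A: "\<And>S z. finite S \<Longrightarrow> (\<Sum>n\<in>S. norm (g n z)) \<le> A * exp (\<epsilon> * \<bar>Im z\<bar>)" and A0: "A > 0"
    and a: "summable (\<lambda>n. norm (a n) powr p)"
  shows "(\<lambda>z. \<Sum>n. a n * f n z * g n z) \<in> paley_wiener (\<tau> + \<epsilon>) p"
proof -
  define F where "F = (\<lambda>z. \<Sum>n. a n * f n z * g n z)"
  have B0: "B \<ge> 0" using order_trans[OF norm_ge_zero bdf[of 0 0]] by simp
  have K0: "K \<ge> 0" by (rule order_trans[OF Bochner_Integration.integral_nonneg K[of 0]]) simp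
  have part: "(\<Sum>n\<in>S. norm (a n * f n z * g n z)) \<le> d * (B * A * exp ((\<tau> + \<epsilon>) * \<bar>Im z\<bar>))"
    if S: "finite S" and d: "\<And>n. n \<in> S \<Longrightarrow> norm (a n) \<le> d" "d \<ge> 0" for S z d
  proof -
    have "(\<Sum>n\<in>S. norm (a n * f n z * g n z)) \<le> (\<Sum>n\<in>S. d * (B * exp (\<tau> * \<bar>Im z\<bar>)) * norm (g n z))"
      unfolding norm_mult by (intro sum_mono mult_right_mono mult_mono bdf d) auto
    also have "\<dots> = d * (B * exp (\<tau> * \<bar>Im z\<bar>)) * (\<Sum>n\<in>S. norm (g n z))" by (simp only: sum_distrib_left)
    also have "\<dots> \<le> d * (B * exp (\<tau> * \<bar>Im z\<bar>)) * (A * exp (\<epsilon> * \<bar>Im z\<bar>))"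
      using d(2) B0 by (intro mult_left_mono A S) auto
    also have "\<dots> = d * (B * A * exp ((\<tau> + \<epsilon>) * \<bar>Im z\<bar>))" 
      unfolding distrib_right exp_add by (simp only: mult_ac)
    finally show ?thesis .
  qed
  have a0: "\<exists>N. \<forall>n\<ge>N. norm (a n) \<le> e" if e: "e > 0" for e
  proof -
    have "(\<lambda>n. norm (a n) powr p) \<longlonglongrightarrow> 0" by (rule summable_LIMSEQ_zero[OF a])
    then have "\<forall>\<^sub>F n in sequentially. norm (a n) powr p < e powr p" using e by (intro order_tendstoD) auto
    then have "\<forall>\<^sub>F n in sequentially. norm (a n) \<le> e"
    proof eventually_elim
      case (elim n)
      show ?case
      proof (rule ccontr)
        assume "\<not> norm (a n) \<le> e"
        then have "e powr p \<le> norm (a n) powr p" using e p by (intro powr_mono2) auto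
        then show False using elim by simp
      qed
    qed
    then show ?thesis by (simp add: eventually_at_top_linorder)
  qed
  obtain N1 where N1: "\<And>n. n \<ge> N1 \<Longrightarrow> norm (a n) \<le> 1" using a0[of 1] by auto
  define d where "d = 1 + (\<Sum>n<N1. norm (a n))"
  have d: "norm (a n) \<le> d" "d \<ge> 0" for n
  proof -
    show "norm (a n) \<le> d"
    proof (cases "n < N1")
      case True
      then have "norm (a n) \<le> (\<Sum>n<N1. norm (a n))" by (intro member_le_sum) auto
      then show ?thesis by (simp add: d_def)
    next
      case False
      then have "norm (a n) \<le> 1" using N1[of n] by simp
      moreover have "0 \<le> (\<Sum>n<N1. norm (a n))" by (intro sum_nonneg) simp
      ultimately show ?thesis by (simp add: d_def)
    qed
    show "d \<ge> 0" unfolding d_def by (intro add_nonneg_nonneg sum_nonneg) auto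
  qed
  define D where "D = B * A"
  have D0: "D \<ge> 0" using B0 A0 by (simp add: D_def)
  have abs_sum: "summable (\<lambda>n. norm (a n * f n z * g n z))" for z
    by (rule bounded_imp_summable[of _ "d * (B * A * exp ((\<tau> + \<epsilon>) * \<bar>Im z\<bar>))"])
      (simp, rule part, use d in auto)
  have smm: "summable (\<lambda>n. a n * f n z * g n z)" for z by (rule summable_norm_cancel[OF abs_sum])
  have tail: "norm (F z - (\<Sum>n<N. a n * f n z * g n z)) \<le> e * (D * exp ((\<tau> + \<epsilon>) * \<bar>Im z\<bar>))"
    if e: "e \<ge> 0" "\<And>n. n \<ge> N \<Longrightarrow> norm (a n) \<le> e" for e N z
  proof -
    let ?u = "\<lambda>n. a n * f n z * g n z"
    have "F z - (\<Sum>n<N. ?u n) = (\<Sum>n. ?u (n + N))" unfolding F_def by (rule suminf_minus_initial_segment[OF smm, symmetric])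
    also have "norm \<dots> \<le> (\<Sum>n. norm (?u (n + N)))"
      by (rule summable_norm) (use summable_ignore_initial_segment[OF abs_sum] in simp)
    also have "\<dots> \<le> e * (D * exp ((\<tau> + \<epsilon>) * \<bar>Im z\<bar>))"
    proof (rule suminf_le_const)
      show "summable (\<lambda>n. norm (?u (n + N)))" using summable_ignore_initial_segment[OF abs_sum] by simp
      fix k
      have "(\<Sum>n<k. norm (?u (n + N))) = (\<Sum>n\<in>{N..<k + N}. norm (?u n))"
        by (rule sum.reindex_bij_witness[of _ "\<lambda>n. n - N" "\<lambda>n. n + N"]) auto
      also have "\<dots> \<le> e * (B * A * exp ((\<tau> + \<epsilon>) * \<bar>Im z\<bar>))" by (rule part) (use e in auto)
      finally show "(\<Sum>n<k. norm (?u (n + N))) \<le> e * (D * exp ((\<tau> + \<epsilon>) * \<bar>Im z\<bar>))" by (simp only: D_def)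
    qed
    finally show ?thesis .
  qed
  have holF: "F holomorphic_on UNIV"
  proof (rule holomorphic_uniform_sequence[where f = "\<lambda>N z. \<Sum>n<N. a n * f n z * g n z"])
    show "(\<lambda>z. \<Sum>n<N. a n * f n z * g n z) holomorphic_on UNIV" for N by (intro holomorphic_intros holf holg)
    fix z0 :: complex
    define E where "E = D * exp ((\<tau> + \<epsilon>) * (norm z0 + 1)) + 1"
    have E0: "E > 0" using D0 by (auto simp: E_def intro!: add_nonneg_pos mult_nonneg_nonneg)
    have "uniform_limit (cball z0 1) (\<lambda>N z. \<Sum>n<N. a n * f n z * g n z) F sequentially"
    proof (rule uniform_limitI)
      fix e :: real assume e: "e > 0"
      obtain N0 where N0: "\<And>n. n \<ge> N0 \<Longrightarrow> norm (a n) \<le> e / (2 * E)" using a0[of "e / (2 * E)"] e E0 by auto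
      show "\<forall>\<^sub>F N in sequentially. \<forall>z\<in>cball z0 1. dist (\<Sum>n<N. a n * f n z * g n z) (F z) < e"
        using eventually_ge_at_top[of N0]
      proof eventually_elim
        case (elim N)
        show ?case
        proof
          fix z assume z: "z \<in> cball z0 1"
          have "norm z \<le> norm z0 + 1" using norm_triangle_ineq2[of z z0] z by (simp add: dist_norm norm_minus_commute)
          then have im: "\<bar>Im z\<bar> \<le> norm z0 + 1" using abs_Im_le_cmod[of z] by linarith
          have "norm (F z - (\<Sum>n<N. a n * f n z * g n z)) \<le> e / (2 * E) * (D * exp ((\<tau> + \<epsilon>) * \<bar>Im z\<bar>))"
            by (rule tail) (use N0 elim e E0 in auto)
          also have "\<dots> \<le> e / (2 * E) * E"
          proof (intro mult_left_mono)
            have "D * exp ((\<tau> + \<epsilon>) * \<bar>Im z\<bar>) \<le> D * exp ((\<tau> + \<epsilon>) * (norm z0 + 1))"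
              using im \<tau> \<epsilon> D0 by (intro mult_left_mono) (auto intro!: mult_left_mono)
            then show "D * exp ((\<tau> + \<epsilon>) * \<bar>Im z\<bar>) \<le> E" by (simp add: E_def)
          qed (use e E0 in auto)
          also have "\<dots> < e" using e E0 by simp
          finally show "dist (\<Sum>n<N. a n * f n z * g n z) (F z) < e" by (simp add: dist_norm norm_minus_commute)
        qed
      qed
    qed
    then show "\<exists>d>0. cball z0 d \<subseteq> UNIV \<and> uniform_limit (cball z0 d) (\<lambda>N z. \<Sum>n<N. a n * f n z * g n z) F sequentially"
      by (intro exI[of _ 1]) auto
  qed simp
  have bdF: "norm (F z) \<le> d * D * exp ((\<tau> + \<epsilon>) * \<bar>Im z\<bar>)" for z
    using tail[of d 0 z] d by (simp add: mult.assoc)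
  have typeF: "exp_type_le (\<tau> + \<epsilon>) F"
    unfolding exp_type_le_def
  proof (intro allI impI exI)
    fix \<eta> :: real and z assume \<eta>: "\<eta> > 0"
    have "(\<tau> + \<epsilon>) * \<bar>Im z\<bar> \<le> (\<tau> + \<epsilon> + \<eta>) * norm z"
      using \<tau> \<epsilon> \<eta> abs_Im_le_cmod[of z] by (intro mult_mono) auto
    then have "d * D * exp ((\<tau> + \<epsilon>) * \<bar>Im z\<bar>) \<le> d * D * exp ((\<tau> + \<epsilon> + \<eta>) * norm z)"
      using d(2) D0 by (intro mult_left_mono) auto
    then show "norm (F z) \<le> d * D * exp ((\<tau> + \<epsilon> + \<eta>) * norm z)" using bdF[of z] by linarith
  qed
  have contr: "continuous_on UNIV (\<lambda>t::real. q (of_real t))" if "q holomorphic_on UNIV" for q :: "complex \<Rightarrow> complex"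
    by (rule continuous_on_real_line[where a = 1, OF holomorphic_on_subset[OF that]]) auto
  have [measurable]: "(\<lambda>t::real. F (of_real t)) \<in> borel_measurable borel"
    "(\<lambda>t::real. f n (of_real t)) \<in> borel_measurable borel" "(\<lambda>t::real. g n (of_real t)) \<in> borel_measurable borel" for n
    by (intro borel_measurable_continuous_onI contr holF holf holg)+
  define L where "L = A powr p * (K * (\<Sum>n. norm (a n) powr p))"
  define P where "P = (\<lambda>N (t::real). \<Sum>n<N. a n * f n (of_real t) * g n (of_real t))"
  have [measurable]: "P N \<in> borel_measurable borel" for N unfolding P_def by measurable
  have partL: "(\<integral>\<^sup>+ t. ennreal (norm (P N t) powr p) \<partial>lborel) \<le> ennreal L" for N
  proof -
    define H where "H = (\<lambda>t::real. \<Sum>n<N. A powr p * norm (a n) powr p * norm (f n (of_real t)) powr p)"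
    have H0: "H t \<ge> 0" for t unfolding H_def by (intro sum_nonneg mult_nonneg_nonneg) auto
    have le: "norm (P N t) powr p \<le> H t" for t
    proof -
      let ?w = "\<lambda>n. norm (g n (of_real t))" and ?x = "\<lambda>n. norm (a n * f n (of_real t))"
      have w: "(\<Sum>n\<in>S. ?w n) \<le> A" if "finite S" for S using A[OF that, of "of_real t"] by simp
      have "norm (P N t) \<le> (\<Sum>n<N. norm (a n * f n (of_real t) * g n (of_real t)))" unfolding P_def by (rule norm_sum)
      also have "\<dots> = (\<Sum>n<N. ?w n * ?x n)" by (simp only: norm_mult mult_ac)
      finally have "norm (P N t) powr p \<le> (\<Sum>n<N. ?w n * ?x n) powr p" using p by (intro powr_mono2) auto
      also have "\<dots> \<le> A powr (p - 1) * (\<Sum>n<N. ?w n * ?x n powr p)"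
        by (rule sum_weighted_powr_le) (use w A0 p in auto)
      also have "\<dots> \<le> A powr (p - 1) * (\<Sum>n<N. A * ?x n powr p)"
        using w[of "{n}" for n] by (intro mult_left_mono sum_mono mult_right_mono) auto
      also have "\<dots> = A powr (p - 1) * A * (\<Sum>n<N. ?x n powr p)" by (simp only: sum_distrib_left mult.assoc)
      also have "A powr (p - 1) * A = A powr p"
        by (rule powr_minus_one_mult[OF A0])
      also have "A powr p * (\<Sum>n<N. ?x n powr p) = H t"
        by (simp add: H_def norm_mult powr_mult sum_distrib_left mult.assoc)
      finally show ?thesis .
    qed
    have intH: "integrable lborel H" unfolding H_def
      by (intro Bochner_Integration.integrable_sum integrable_mult_right int)
    have "(LINT t|lborel. H t) = (\<Sum>n<N. A powr p * norm (a n) powr p * (LINT t|lborel. norm (f n (of_real t)) powr p))"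
      unfolding H_def
      by (subst Bochner_Integration.integral_sum) (auto intro!: integrable_mult_right int simp only: integral_mult_right_zero)
    also have "\<dots> \<le> (\<Sum>n<N. A powr p * norm (a n) powr p * K)" by (intro sum_mono mult_left_mono K) auto
    also have "\<dots> = A powr p * (K * (\<Sum>n<N. norm (a n) powr p))" by (simp add: sum_distrib_left mult_ac)
    also have "\<dots> \<le> L" unfolding L_def using K0 by (intro mult_left_mono sum_le_suminf a) auto
    finally have HL: "(LINT t|lborel. H t) \<le> L" .
    have "(\<integral>\<^sup>+ t. ennreal (norm (P N t) powr p) \<partial>lborel) \<le> (\<integral>\<^sup>+ t. ennreal (H t) \<partial>lborel)"
      by (intro nn_integral_mono ennreal_leI le)
    also have "\<dots> = ennreal (LINT t|lborel. H t)" by (rule nn_integral_eq_integral[OF intH]) (use H0 in auto)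
    also have "\<dots> \<le> ennreal L" by (intro ennreal_leI HL)
    finally show ?thesis .
  qed
  have "(\<integral>\<^sup>+ t. ennreal (norm (F (of_real t)) powr p) \<partial>lborel) = (\<integral>\<^sup>+ t. liminf (\<lambda>N. ennreal (norm (P N t) powr p)) \<partial>lborel)"
  proof (rule nn_integral_cong)
    fix t :: real
    have "(\<lambda>N. P N t) \<longlonglongrightarrow> F (of_real t)" unfolding P_def F_def by (rule summable_LIMSEQ[OF smm])
    then have "(\<lambda>N. norm (P N t) powr p) \<longlonglongrightarrow> norm (F (of_real t)) powr p"
      using p by (intro tendsto_powr' tendsto_norm tendsto_const) auto
    then have "(\<lambda>N. ennreal (norm (P N t) powr p)) \<longlonglongrightarrow> ennreal (norm (F (of_real t)) powr p)"
      by (rule tendsto_ennrealI)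
    then show "ennreal (norm (F (of_real t)) powr p) = liminf (\<lambda>N. ennreal (norm (P N t) powr p))"
      by (rule lim_imp_Liminf[OF sequentially_bot, symmetric])
  qed
  also have "\<dots> \<le> liminf (\<lambda>N. \<integral>\<^sup>+ t. ennreal (norm (P N t) powr p) \<partial>lborel)"
    by (rule nn_integral_liminf) measurable
  also have "\<dots> \<le> limsup (\<lambda>N. \<integral>\<^sup>+ t. ennreal (norm (P N t) powr p) \<partial>lborel)"
    by (rule Liminf_le_Limsup) simp
  also have "\<dots> \<le> ennreal L" by (rule Limsup_bounded) (use partL in auto)
  finally have fin: "(\<integral>\<^sup>+ t. ennreal (norm (F (of_real t)) powr p) \<partial>lborel) < \<infinity>"
    by (rule le_less_trans) simp
  have "integrable lborel (\<lambda>t::real. norm (F (of_real t)) powr p)"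
    by (rule integrableI_bounded) (use fin in auto)
  then show ?thesis using holF typeF unfolding paley_wiener_def F_def by simp
qed

lemma pw_weight_add: "pw_weight (\<tau> + \<epsilon>) p z = pw_weight \<tau> p z * exp (- (\<epsilon> * \<bar>Im z\<bar>))"
  by (simp add: pw_weight_def exp_add[symmetric] algebra_simps)

theorem corollary5:
  fixes \<tau> p :: real and \<Lambda> :: "nat \<Rightarrow> complex"
  assumes "\<tau> > 0" and "1 < p"
    and "weak_interpolating \<tau> p \<Lambda>"
  shows "\<forall>\<epsilon>>0. interpolating (\<tau> + \<epsilon>) p \<Lambda>"
proof (intro allI impI)
  fix \<epsilon> :: real assume \<epsilon>: "\<epsilon> > 0"
  obtain f where pw: "\<And>n. f n \<in> paley_wiener \<tau> p"
    and bio: "\<And>n k. f n (\<Lambda> k) * of_real (pw_weight \<tau> p (\<Lambda> n)) = (if n = k then 1 else 0)"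
    and bdd: "bdd_above (range (\<lambda>n. pw_norm p (f n)))"
    using assms(3) unfolding weak_interpolating_def by blast
  obtain K' where K': "\<And>n. pw_norm p (f n) \<le> K'" using bdd by (auto simp: bdd_above_def)
  define K where "K = K' powr p"
  have K: "(LINT t|lborel. norm (f n (of_real t)) powr p) \<le> K" for n
  proof -
    define J where "J = (LINT t|lborel. norm (f n (of_real t)) powr p)"
    have J0: "J \<ge> 0" unfolding J_def by (rule Bochner_Integration.integral_nonneg) simp
    have "J = (J powr (1 / p)) powr p" using J0 assms(2) by (simp add: powr_powr)
    also have "\<dots> \<le> K' powr p" using K'[of n] assms(2) by (intro powr_mono2) (auto simp: pw_norm_def J_def)
    finally show ?thesis by (simp add: J_def K_def)
  qed
  have hol: "f n holomorphic_on UNIV" and type: "exp_type_le \<tau> (f n)" 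
    and int: "integrable lborel (\<lambda>t::real. norm (f n (of_real t)) powr p)" for n
    using pw[of n] by (auto simp: paley_wiener_def)
  have bd: "norm (f n z) \<le> 2 * (1 + K) * exp \<tau> * exp (\<tau> * \<bar>Im z\<bar>)" for n z
    by (rule paley_wiener_pointwise_bound[OF hol type _ _ int K]) (use assms in auto)
  \<comment> \<open>the lower half-plane is handled through \<open>z \<mapsto> -z\<close>, which preserves the Paley-Wiener norm and the weight\<close>
  define I where "I = {n. Im (\<Lambda> n) \<ge> 0}"
  obtain g1 A1 where
    g1: "\<And>n. n \<in> I \<Longrightarrow> g1 n holomorphic_on UNIV"
      "\<And>n. n \<in> I \<Longrightarrow> g1 n (\<Lambda> n) = of_real (exp (\<epsilon> * Im (\<Lambda> n)))"
      "\<And>S z. finite S \<Longrightarrow> S \<subseteq> I \<Longrightarrow> (\<Sum>n\<in>S. norm (g1 n z)) \<le> A1 * exp (\<epsilon> * \<bar>Im z\<bar>)"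
  proof (rule weak_biorthogonal_upper_multipliers[of \<tau> p \<epsilon> f K \<Lambda> I])
    show "Im (\<Lambda> n) \<ge> 0" if "n \<in> I" for n using that by (simp add: I_def)
    show "\<tau> > 0" "p > 1" "\<epsilon> > 0" by fact+
    show "f n \<in> paley_wiener \<tau> p" for n by (rule pw)
    show "(LINT t|lborel. norm (f n (of_real t)) powr p) \<le> K" for n by (rule K)
    show "f n (\<Lambda> k) * of_real (pw_weight \<tau> p (\<Lambda> n)) = (if n = k then 1 else 0)" for n k by (rule bio)
  qed (rule that)
  obtain g2 A2 where
    g2: "\<And>n. n \<in> - I \<Longrightarrow> g2 n holomorphic_on UNIV"
      "\<And>n. n \<in> - I \<Longrightarrow> g2 n (- \<Lambda> n) = of_real (exp (\<epsilon> * Im (- \<Lambda> n)))"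
      "\<And>S z. finite S \<Longrightarrow> S \<subseteq> - I \<Longrightarrow> (\<Sum>n\<in>S. norm (g2 n z)) \<le> A2 * exp (\<epsilon> * \<bar>Im z\<bar>)"
  proof (rule weak_biorthogonal_upper_multipliers[of \<tau> p \<epsilon> "\<lambda>n z. f n (- z)" K "\<lambda>n. - \<Lambda> n" "- I"])
    show "(\<lambda>z. f n (- z)) \<in> paley_wiener \<tau> p" for n
    proof -
      have "integrable lborel (\<lambda>t::real. norm (f n (- of_real t)) powr p)"
        using int[of n] lborel_reflect(1)[of "\<lambda>t. norm (f n (of_real t)) powr p"] by simp
      then show ?thesis using type[of n] holomorphic_reflect[OF hol]
        by (simp add: paley_wiener_def exp_type_le_reflect)
    qed
    show "(LINT t|lborel. norm (f n (- of_real t)) powr p) \<le> K" for n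
      using K[of n] lborel_reflect(2)[of "\<lambda>t. norm (f n (of_real t)) powr p"] by simp
    show "f n (- (- \<Lambda> k)) * of_real (pw_weight \<tau> p (- \<Lambda> n)) = (if n = k then 1 else 0)" for n k
      using bio[of n k] by (simp add: pw_weight_def)
    show "Im (- \<Lambda> n) \<ge> 0" if "n \<in> - I" for n using that by (simp add: I_def)
    show "\<tau> > 0" "p > 1" "\<epsilon> > 0" by fact+
  qed (rule that)
  define g where "g = (\<lambda>n z. if n \<in> I then g1 n z else g2 n (- z))"
  have holg: "g n holomorphic_on UNIV" for n
  proof (cases "n \<in> I")
    case True then show ?thesis using g1(1) by (simp add: g_def)
  next
    case False
    then show ?thesis using holomorphic_reflect[OF g2(1)] by (simp add: g_def)
  qed
  have gdiag: "g n (\<Lambda> n) = of_real (exp (\<epsilon> * \<bar>Im (\<Lambda> n)\<bar>))" for n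
    using g1(2)[of n] g2(2)[of n] by (cases "n \<in> I") (auto simp: g_def I_def)
  have gsum: "(\<Sum>n\<in>S. norm (g n z)) \<le> (\<bar>A1\<bar> + \<bar>A2\<bar> + 1) * exp (\<epsilon> * \<bar>Im z\<bar>)" if S: "finite S" for S z
  proof -
    have "(\<Sum>n\<in>S. norm (g n z)) = (\<Sum>n\<in>S \<inter> I. norm (g n z)) + (\<Sum>n\<in>S - I. norm (g n z))"
      using S by (rule sum.Int_Diff)
    also have "(\<Sum>n\<in>S \<inter> I. norm (g n z)) = (\<Sum>n\<in>S \<inter> I. norm (g1 n z))" by (rule sum.cong) (auto simp: g_def)
    also have "(\<Sum>n\<in>S - I. norm (g n z)) = (\<Sum>n\<in>S - I. norm (g2 n (- z)))" by (rule sum.cong) (auto simp: g_def)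
    also have "(\<Sum>n\<in>S \<inter> I. norm (g1 n z)) \<le> A1 * exp (\<epsilon> * \<bar>Im z\<bar>)" by (rule g1(3)) (use S in auto)
    also have "(\<Sum>n\<in>S - I. norm (g2 n (- z))) \<le> A2 * exp (\<epsilon> * \<bar>Im z\<bar>)" using g2(3)[of "S - I" "- z"] S by auto
    also have "A1 * exp (\<epsilon> * \<bar>Im z\<bar>) + A2 * exp (\<epsilon> * \<bar>Im z\<bar>) \<le> (\<bar>A1\<bar> + \<bar>A2\<bar> + 1) * exp (\<epsilon> * \<bar>Im z\<bar>)"
      unfolding distrib_right[symmetric] by (intro mult_right_mono) auto
    finally show ?thesis by simp
  qed
  show "interpolating (\<tau> + \<epsilon>) p \<Lambda>" unfolding interpolating_def
  proof (intro allI impI)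
    fix a :: "nat \<Rightarrow> complex" assume a: "summable (\<lambda>n. norm (a n) powr p)"
    let ?F = "\<lambda>z. \<Sum>n. a n * f n z * g n z"
    show "\<exists>f\<in>paley_wiener (\<tau> + \<epsilon>) p. \<forall>n. f (\<Lambda> n) * of_real (pw_weight (\<tau> + \<epsilon>) p (\<Lambda> n)) = a n"
    proof (intro bexI allI)
      show "?F \<in> paley_wiener (\<tau> + \<epsilon>) p"
        by (rule interpolation_series[OF assms(2) _ _ hol bd int K holg gsum _ a]) (use assms(1) \<epsilon> in auto)
      fix k
      have zero: "f n (\<Lambda> k) = 0" if "n \<noteq> k" for n
      proof -
        have "pw_weight \<tau> p (\<Lambda> n) \<noteq> 0" using abs_ge_zero[of "Im (\<Lambda> n)"] by (simp add: pw_weight_def)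
        then show ?thesis using bio[of n k] that by simp
      qed
      have "?F (\<Lambda> k) = (\<Sum>n\<in>{k}. a n * f n (\<Lambda> k) * g n (\<Lambda> k))"
        by (rule suminf_finite) (use zero in auto)
      also have "\<dots> = a k * f k (\<Lambda> k) * of_real (exp (\<epsilon> * \<bar>Im (\<Lambda> k)\<bar>))" by (simp add: gdiag)
      finally have "?F (\<Lambda> k) * of_real (pw_weight (\<tau> + \<epsilon>) p (\<Lambda> k))
        = a k * (f k (\<Lambda> k) * of_real (pw_weight \<tau> p (\<Lambda> k))) * of_real (exp (\<epsilon> * \<bar>Im (\<Lambda> k)\<bar>) * exp (- (\<epsilon> * \<bar>Im (\<Lambda> k)\<bar>)))"
        by (simp only: pw_weight_add of_real_mult mult_ac)
      also have "\<dots> = a k" unfolding bio exp_minus_inverse by simp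
      finally show "?F (\<Lambda> k) * of_real (pw_weight (\<tau> + \<epsilon>) p (\<Lambda> k)) = a k" .
    qed
  qed
qed

end
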